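(* Let $k_1,k_2,k_3\ge2$ be integers and $\mathrm{d}=q\frac{d}{dq}$. With $g^{\mathrm{sh}}$, $\mathfrak{g}^{\mathrm{sh}}$, $\operatorname{ds}$ and $\mathcal{G}^{\mathrm{sh}}_{\le k}$ as defined in the context: (i) $$\mathrm{d}\,g^{\mathrm{sh}}_{k_1,k_2}\equiv 2k_1\Big(\mathfrak{g}^{\mathrm{sh}}(\operatorname{ds}(e_1,e_{k_1+1}e_{k_2}))-\mathfrak{g}^{\mathrm{sh}}(\operatorname{ds}(e_{k_2},e_{k_1+1}e_1))\Big)+2k_2\,\mathfrak{g}^{\mathrm{sh}}(\operatorname{ds}(e_1,e_{k_1}e_{k_2+1}))\mod \mathcal{G}^{\mathrm{sh}}_{\le k_1+k_2+1}.$$ (ii) $$\begin{aligned}\mathrm{d}\,g^{\mathrm{sh}}_{k_1,k_2,k_3}\equiv\;&2k_1\,\mathfrak{g}^{\mathrm{sh}}\big(\operatorname{ds}(e_1,e_{k_1+1}e_{k_2}e_{k_3})+\operatorname{ds}(e_{k_3},e_{k_2}e_{k_1+1}e_1)\big)\\&+2k_1\,\mathfrak{g}^{\mathrm{sh}}\big(\operatorname{ds}(e_{k_3},e_{k_1+1+k_2}e_1)-\operatorname{ds}(e_{k_1+1}e_1,e_{k_2}e_{k_3})\big)\\&+2k_2\,\mathfrak{g}^{\mathrm{sh}}\big(\operatorname{ds}(e_1,e_{k_1}e_{k_2+1}e_{k_3})-\operatorname{ds}(e_{k_3},e_{k_1}e_{k_2+1}e_1)\big)\\&+2k_3\,\mathfrak{g}^{\mathrm{sh}}\big(\operatorname{ds}(e_1,e_{k_1}e_{k_2}e_{k_3+1})\big)\mod\mathcal{G}^{\mathrm{sh}}_{\le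 k_1+k_2+k_3+1}.\end{aligned}$$ Here $f\equiv h \bmod V$ means $f-h\in V$.
   Context: Words and products. Let $\mathfrak{H}=\mathbb{Q}\langle e_0,e_1\rangle$ be the noncommutative polynomial algebra, $\mathfrak{H}^1=\mathbb{Q}\cdot 1+e_1\mathfrak{H}$, and $e_k=e_1e_0^{k-1}$ for $k\ge1$; the monomials $e_{k_1}\cdots e_{k_r}$ ($r\ge 0$, $k_i\ge 1$) form a basis of $\mathfrak{H}^1$. The shuffle product $\sqcup\!\sqcup$ on $\mathfrak{H}$ is the $\mathbb{Q}$-bilinear product with $1\sqcup\!\sqcup w=w\sqcup\!\sqcup 1=w$ and $av\sqcup\!\sqcup bw=a(v\sqcup\!\sqcup bw)+b(av\sqcup\!\sqcup w)$ for $a,b\in\{e_0,e_1\}$, $v,w\in\mathfrak{H}$; $\mathfrak{H}^1$ is closed under it. The harmonic product $\ast$ on $\mathfrak{H}^1$ is the $\mathbb{Q}$-bilinear product with $1\ast w=w\ast1=w$ and $e_{k_1}v\ast e_{k_2}w=e_{k_1}(v\ast e_{k_2}w)+e_{k_2}(e_{k_1}v\ast w)+e_{k_1+k_2}(v\ast w)$ for $k_1,k_2\geq 1$, $v,w\in\mathfrak{H}^1$. For $u,v\in\mathfrak{H}^1$ put $\operatorname{ds}(u,v)=u\ast v-u\sqcup\!\sqcup v\in\mathfrak{H}^1$. The $q$-series. For integers $n_1,\dots,n_m\ge 1$ set $$H\binom{n_1,\dots,n_m}{X_1,\dots,X_m} = \sum_{0<d_1<\dots<d_m} e^{d_1X_1}\left(\frac{q^{d_1}}{1-q^{d_1}}\right)^{n_1}\cdots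 e^{d_mX_m}\left(\frac{q^{d_m}}{1-q^{d_m}}\right)^{n_m}.$$ The $q$-series $g^{\mathrm{sh}}_{k_1,\dots,k_r}\in\mathbb{Q}[[q]]$ ($r\ge 1$, $k_i\ge1$) are defined by $$\sum_{k_1,\dots,k_r\ge1} g^{\mathrm{sh}}_{k_1,\dots,k_r}X_1^{k_1-1}\cdots X_r^{k_r-1} := \sum_{m=1}^{r}\ \sum_{\substack{i_1+\dots+i_m=r\\ i_1,\dots,i_m\ge1}}\frac{1}{i_1!\cdots i_m!}\,H\binom{i_1,\,i_2,\,\dots,\,i_m}{X_r-X_{r-i_1},\;X_{r-i_1}-X_{r-i_1-i_2},\;\dots,\;X_{i_m}},$$ i.e. the $j$-th lower entry is $X_{r-i_1-\dots-i_{j-1}}-X_{r-i_1-\dots-i_j}$ with $X_0=0$. For $r=0$ the series is $1$. The $\mathbb{Q}$-linear map $\mathfrak{g}^{\mathrm{sh}}:\mathfrak{H}^1\to\mathbb{Q}[[q]]$ is defined by $\mathfrak{g}^{\mathrm{sh}}(1)=1$ and $\mathfrak{g}^{\mathrm{sh}}(e_{k_1}\cdots e_{k_r})=g^{\mathrm{sh}}_{k_1,\dots,k_r}$. For $k\ge1$, $\mathcal{G}^{\mathrm{sh}}_{\le k}$ is the $\mathbb{Q}$-span in $\mathbb{Q}[[q]]$ of all $g^{\mathrm{sh}}_{k_1,\dots,k_r}$ with $0\le r\le k$, $k_i\ge 1$ and $k_1+\dots+k_r\le k$. *)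

theory Defs
  imports "HOL-Analysis.Infinite_Sum" "HOL-Library.Poly_Mapping"
begin

section \<open>Words, the shuffle product and the harmonic product\<close>

text \<open>Words are lists, regarded as the free monoid written additively. The ring structure of
  \<open>\<Rightarrow>\<^sub>0\<close> then makes \<open>letter list \<Rightarrow>\<^sub>0 rat\<close> the noncommutative polynomial
  algebra \<open>\<rat>\<langle>e\<^sub>0, e\<^sub>1\<rangle>\<close>, with concatenation as multiplication.\<close>

instantiation list :: (type) monoid_add
begin

definition zero_list :: "'a list" where
  "0 = []"

definition plus_list :: "'a list \<Rightarrow> 'a list \<Rightarrow> 'a list" where
  "xs + ys = xs @ ys"

instance
  by standard (simp_all add: zero_list_def plus_list_def)

end

datatype letter = L0 | L1

type_synonym ncpoly = "letter list \<Rightarrow>\<^sub>0 rat"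

definition word :: "letter list \<Rightarrow> ncpoly" where
  "word w = Poly_Mapping.single w 1"

definition e0 :: ncpoly where
  "e0 = word [L0]"

definition e1 :: ncpoly where
  "e1 = word [L1]"

definition ek :: "nat \<Rightarrow> ncpoly" where
  "ek k = e1 * e0 ^ (k - 1)"

definition e_word :: "nat list \<Rightarrow> ncpoly" where
  "e_word ks = prod_list (map ek ks)"

text \<open>\<open>\<HH>\<^sup>1 = \<rat> + e\<^sub>1 \<HH>\<close>: the polynomials all of whose nonempty words begin with
  \<open>e\<^sub>1\<close>.\<close>

definition H1 :: "ncpoly set" where
  "H1 = {u. \<forall>w \<in> Poly_Mapping.keys u. w = [] \<or> hd w = L1}"

text \<open>The index \<open>(k\<^sub>1, \<dots>, k\<^sub>r)\<close> of a word \<open>e\<^sub>k\<^sub>1 \<cdots> e\<^sub>k\<^sub>r\<close>; it is only meaningful for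
  words in \<open>H1\<close>.\<close>

fun index_of_word :: "letter list \<Rightarrow> nat list" where
  "index_of_word [] = []"
| "index_of_word (L0 # w) = index_of_word w"
| "index_of_word (L1 # w) = Suc (length (takeWhile (\<lambda>a. a = L0) w)) # index_of_word w"

definition bilinear_ext ::
  "(letter list \<Rightarrow> letter list \<Rightarrow> ncpoly) \<Rightarrow> ncpoly \<Rightarrow> ncpoly \<Rightarrow> ncpoly" where
  "bilinear_ext f u v = (\<Sum>x \<in> Poly_Mapping.keys u. \<Sum>y \<in> Poly_Mapping.keys v.
     Poly_Mapping.single [] (Poly_Mapping.lookup u x * Poly_Mapping.lookup v y) * f x y)"

fun shuffle_words :: "letter list \<Rightarrow> letter list \<Rightarrow> ncpoly" where
  "shuffle_words [] w = word w"
| "shuffle_words v [] = word v"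
| "shuffle_words (a # v) (b # w) =
     word [a] * shuffle_words v (b # w) + word [b] * shuffle_words (a # v) w"

definition shuffle_prod :: "ncpoly \<Rightarrow> ncpoly \<Rightarrow> ncpoly" where
  "shuffle_prod = bilinear_ext shuffle_words"

fun harmonic_index :: "nat list \<Rightarrow> nat list \<Rightarrow> ncpoly" where
  "harmonic_index [] w = e_word w"
| "harmonic_index v [] = e_word v"
| "harmonic_index (k # v) (l # w) =
     ek k * harmonic_index v (l # w) + ek l * harmonic_index (k # v) w
       + ek (k + l) * harmonic_index v w"

text \<open>The harmonic product, only meaningful on \<open>H1\<close>.\<close>

definition harmonic_prod :: "ncpoly \<Rightarrow> ncpoly \<Rightarrow> ncpoly" where
  "harmonic_prod =
     bilinear_ext (\<lambda>x y. harmonic_index (index_of_word x) (index_of_word y))"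

definition ds :: "ncpoly \<Rightarrow> ncpoly \<Rightarrow> ncpoly" where
  "ds u v = harmonic_prod u v - shuffle_prod u v"

lemma word_mult: "word v * word w = word (v @ w)"
  by (simp add: word_def mult_single plus_list_def)

lemma word_Nil: "word [] = 1"
  by (simp add: word_def zero_list_def flip: single_one)

lemma ek_eq_word: "ek k = word (L1 # replicate (k - 1) L0)"
proof -
  have "e0 ^ n = word (replicate n L0)" for n
    by (induction n) (simp_all add: word_Nil e0_def word_mult)
  then show ?thesis
    by (simp add: ek_def e1_def word_mult)
qed

lemma e_word_eq_word: "e_word ks = word (concat (map (\<lambda>k. L1 # replicate (k - 1) L0) ks))"
  by (induction ks) (simp_all add: e_word_def word_Nil ek_eq_word word_mult)

text \<open>\<open>index_of_word\<close> inverts the enumeration of the words in \<open>H1\<close> by indices.\<close>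

lemma index_of_word_concat:
  assumes "\<forall>k \<in> set ks. 1 \<le> k"
  shows "index_of_word (concat (map (\<lambda>k. L1 # replicate (k - 1) L0) ks)) = ks"
  using assms
proof (induction ks)
  case (Cons k ks)
  have 1: "index_of_word (replicate n L0 @ w) = index_of_word w" for n w
    by (induction n) simp_all
  have 2: "takeWhile (\<lambda>a. a = L0) (concat (map (\<lambda>k. L1 # replicate (k - 1) L0) ks)) = []"
    by (cases ks) simp_all
  have 3: "takeWhile (\<lambda>a. a = L0) (replicate n L0 @ w) = replicate n L0 @ takeWhile (\<lambda>a. a = L0) w"
    for n w
    by (induction n) simp_all
  from Cons 2 show ?case
    by (simp add: 1 3)
qed simp

section \<open>Formal power series in countably many variables\<close>

text \<open>A series is the family of its coefficients, indexed by the exponent vectors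
  \<open>nat \<Rightarrow>\<^sub>0 nat\<close>.\<close>

typedef 'a mfps = "UNIV :: ((nat \<Rightarrow>\<^sub>0 nat) \<Rightarrow> 'a) set"
  morphisms mfps_coeff Abs_mfps
  by simp

setup_lifting type_definition_mfps

lemma mfps_eqI:
  assumes "\<And>m. mfps_coeff f m = mfps_coeff g m"
  shows "f = g"
  using assms by (metis ext mfps_coeff_inject)

lemma finite_decompositions:
  fixes m :: "nat \<Rightarrow>\<^sub>0 nat"
  shows "finite {p. fst p + snd p = m}"
proof -
  let ?S = "{f. \<forall>i. (i \<in> Poly_Mapping.keys m \<longrightarrow>
        f i \<in> {..Max (Poly_Mapping.lookup m ` Poly_Mapping.keys m)})
      \<and> (i \<notin> Poly_Mapping.keys m \<longrightarrow> f i = (0::nat))}"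
  define V where "V = (Poly_Mapping.lookup -` ?S :: (nat \<Rightarrow>\<^sub>0 nat) set)"
  have "finite ?S"
    by (rule finite_set_of_finite_funs) simp_all
  then have "finite V"
    unfolding V_def by (intro finite_vimageI) (simp_all add: inj_def)
  have in_V: "a \<in> V" if "\<And>i. Poly_Mapping.lookup a i \<le> Poly_Mapping.lookup m i" for a
  proof -
    have "Poly_Mapping.lookup a i \<le> Max (Poly_Mapping.lookup m ` Poly_Mapping.keys m)"
      if "i \<in> Poly_Mapping.keys m" for i
    proof -
      have "Poly_Mapping.lookup m i \<le> Max (Poly_Mapping.lookup m ` Poly_Mapping.keys m)"
        using that by (intro Max_ge) simp_all
      with \<open>\<And>i. Poly_Mapping.lookup a i \<le> Poly_Mapping.lookup m i\<close>[of i]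
      show ?thesis by linarith
    qed
    moreover have "Poly_Mapping.lookup a i = 0" if "i \<notin> Poly_Mapping.keys m" for i
      using \<open>\<And>i. Poly_Mapping.lookup a i \<le> Poly_Mapping.lookup m i\<close>[of i] that
      by (simp add: in_keys_iff)
    ultimately show ?thesis
      unfolding V_def by simp
  qed
  have "{p. fst p + snd p = m} \<subseteq> V \<times> V"
    by (intro subsetI) (auto simp: mem_Times_iff lookup_add intro!: in_V)
  then show ?thesis
    using \<open>finite V\<close> by (meson finite_SigmaI finite_subset)
qed

instantiation mfps :: (comm_ring_1) comm_ring_1
begin

lift_definition zero_mfps :: "'a mfps" is "\<lambda>m. 0" .

lift_definition one_mfps :: "'a mfps" is "\<lambda>m. if m = 0 then 1 else 0" .

lift_definition plus_mfps :: "'a mfps \<Rightarrow> 'a mfps \<Rightarrow> 'a mfps" is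
  "\<lambda>f g m. f m + g m" .

lift_definition minus_mfps :: "'a mfps \<Rightarrow> 'a mfps \<Rightarrow> 'a mfps" is
  "\<lambda>f g m. f m - g m" .

lift_definition uminus_mfps :: "'a mfps \<Rightarrow> 'a mfps" is
  "\<lambda>f m. - f m" .

lift_definition times_mfps :: "'a mfps \<Rightarrow> 'a mfps \<Rightarrow> 'a mfps" is
  "\<lambda>f g m. \<Sum>p | fst p + snd p = m. f (fst p) * g (snd p)" .

instance
proof
  fix a b c :: "'a mfps"
  show "a * b * c = a * (b * c)"
  proof (transfer, rule ext)
    fix f g h :: "(nat \<Rightarrow>\<^sub>0 nat) \<Rightarrow> 'a" and m
    let ?D = "\<lambda>m :: nat \<Rightarrow>\<^sub>0 nat. {p. fst p + snd p = m}"
    have "(\<Sum>p\<in>?D m. (\<Sum>p\<in>?D (fst p). f (fst p) * g (snd p)) * h (snd p)) =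
        (\<Sum>(p, p')\<in>(SIGMA p : ?D m. ?D (fst p)). f (fst p') * g (snd p') * h (snd p))"
      by (simp add: sum_distrib_right sum.Sigma finite_decompositions)
    also have "\<dots> = (\<Sum>(p, p')\<in>(SIGMA p : ?D m. ?D (snd p)). f (fst p) * (g (fst p') * h (snd p')))"
      by (rule sum.reindex_bij_witness[where
            i = "\<lambda>(p, p'). ((fst p + fst p', snd p'), (fst p, fst p'))" and
            j = "\<lambda>(p, p'). ((fst p', snd p' + snd p), (snd p', snd p))"])
         (auto simp: ac_simps)
    also have "\<dots> = (\<Sum>p\<in>?D m. f (fst p) * (\<Sum>p\<in>?D (snd p). g (fst p) * h (snd p)))"
      by (simp add: sum_distrib_left sum.Sigma finite_decompositions)
    finally show "(\<Sum>p\<in>?D m. (\<Sum>p\<in>?D (fst p). f (fst p) * g (snd p)) * h (snd p)) =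
        (\<Sum>p\<in>?D m. f (fst p) * (\<Sum>p\<in>?D (snd p). g (fst p) * h (snd p)))" .
  qed
  show "a * b = b * a"
    by (transfer, rule ext, rule sum.reindex_bij_witness[where i = prod.swap and j = prod.swap])
       (auto simp: ac_simps)
  show "1 * a = a"
  proof (transfer, rule ext)
    fix f :: "(nat \<Rightarrow>\<^sub>0 nat) \<Rightarrow> 'a" and m
    have "(\<Sum>p | fst p + snd p = m. (if fst p = 0 then 1 else 0) * f (snd p)) =
        (\<Sum>p\<in>{(0 :: nat \<Rightarrow>\<^sub>0 nat, m)}. (if fst p = 0 then 1 else 0) * f (snd p))"
      by (rule sum.mono_neutral_right) (auto simp: finite_decompositions)
    then show "(\<Sum>p | fst p + snd p = m. (if fst p = 0 then 1 else 0) * f (snd p)) = f m"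
      by simp
  qed
  show "(a + b) * c = a * c + b * c"
    by (transfer, rule ext) (simp add: distrib_right sum.distrib)
  show "(0 :: 'a mfps) \<noteq> 1"
    by transfer (auto simp: fun_eq_iff)
  show "a + b + c = a + (b + c)"
    by transfer (simp add: add.assoc)
  show "a + b = b + a"
    by transfer (simp add: add.commute)
  show "0 + a = a"
    by transfer simp
  show "- a + a = 0"
    by transfer simp
  show "a - b = a + - b"
    by transfer simp
qed

end

definition mfps_const :: "'a \<Rightarrow> 'a::zero mfps" where
  "mfps_const c = Abs_mfps (\<lambda>m. if m = 0 then c else 0)"

text \<open>The variables \<open>X\<^sub>1, X\<^sub>2, \<dots>\<close>, with the convention \<open>X\<^sub>0 = 0\<close>.\<close>

definition mfps_X :: "nat \<Rightarrow> 'a::comm_ring_1 mfps" where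
  "mfps_X i = (if i = 0 then 0 else Abs_mfps (\<lambda>m. if m = Poly_Mapping.single i 1 then 1 else 0))"

text \<open>The exponential of a series without constant term. For such a series, only finitely many
  \<open>n\<close> contribute to each coefficient.\<close>

definition mfps_exp :: "rat fps mfps \<Rightarrow> rat fps mfps" where
  "mfps_exp f = Abs_mfps (\<lambda>m. \<Sum>\<^sub>\<infinity>n. fps_const (1 / fact n) * mfps_coeff (f ^ n) m)"

section \<open>The q-series\<close>

text \<open>The variable \<open>q\<close> is \<open>fps_X\<close>. The sum over \<open>0 < d\<^sub>1 < \<dots> < d\<^sub>m\<close> is taken
  coefficientwise in the \<open>X\<^sub>i\<close>, and in the q-adic topology of \<open>rat fps\<close>.\<close>

definition H_ser :: "nat list \<Rightarrow> rat fps mfps list \<Rightarrow> rat fps mfps" where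
  "H_ser ns Ys = Abs_mfps (\<lambda>M. \<Sum>\<^sub>\<infinity> d | length d = length ns \<and> sorted_wrt (<) (0 # d).
     mfps_coeff (\<Prod>j<length ns. mfps_exp (of_nat (d ! j) * Ys ! j) *
       mfps_const ((fps_X ^ (d ! j) / (1 - fps_X ^ (d ! j))) ^ (ns ! j))) M)"

definition g_sh_gen :: "nat \<Rightarrow> rat fps mfps" where
  "g_sh_gen r = (\<Sum>m = 1..r. \<Sum>i | length i = m \<and> (\<forall>n \<in> set i. 1 \<le> n) \<and> sum_list i = r.
     mfps_const (fps_const (1 / (\<Prod>j<m. fact (i ! j)))) *
     H_ser i (map (\<lambda>j. mfps_X (r - sum_list (take j i)) -
       mfps_X (r - sum_list (take (Suc j) i))) [0..<m]))"

definition g_sh :: "nat list \<Rightarrow> rat fps" where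
  "g_sh ks = (if ks = [] then 1
     else mfps_coeff (g_sh_gen (length ks))
            (\<Sum>i<length ks. Poly_Mapping.single (Suc i) (ks ! i - 1)))"

text \<open>The linear map \<open>\<gg>\<^sup>s\<^sup>h\<close>, only meaningful on \<open>H1\<close>.\<close>

definition g_sh_map :: "ncpoly \<Rightarrow> rat fps" where
  "g_sh_map u = (\<Sum>w \<in> Poly_Mapping.keys u.
     fps_const (Poly_Mapping.lookup u w) * g_sh (index_of_word w))"

global_interpretation rat_fps: vector_space "\<lambda>(c::rat) f. fps_const c * f"
proof
  fix a b :: rat and f g :: "rat fps"
  show "fps_const a * (f + g) = fps_const a * f + fps_const a * g"
    by (rule distrib_left)
  show "fps_const (a + b) * f = fps_const a * f + fps_const b * f"
    by (simp only: fps_const_add[symmetric] distrib_right)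
  show "fps_const a * (fps_const b * f) = fps_const (a * b) * f"
    by (simp only: fps_const_mult[symmetric] mult.assoc)
  show "fps_const 1 * f = f"
    by simp
qed

definition G_sh_le :: "nat \<Rightarrow> rat fps set" where
  "G_sh_le k = rat_fps.span
     {g_sh ks | ks. length ks \<le> k \<and> (\<forall>n \<in> set ks. 1 \<le> n) \<and> sum_list ks \<le> k}"

definition q_deriv :: "rat fps \<Rightarrow> rat fps" where
  "q_deriv f = fps_X * fps_deriv f"

end

theory Submission
  imports Defs
begin

text \<open>
  Put \<open>Q(d) = q\<^sup>d / (1 - q\<^sup>d)\<close>. Read from its last letter to its first, a word of \<open>\<HH>\<^sup>1\<close>
  is sent by \<open>\<gg>\<^sup>s\<^sup>h\<close> to an iterated sum over the half-line in which \<open>e\<^sub>0\<close> acts as \<open>dt\<close> and \<open>e\<^sub>1\<close> as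
  the sum of the point masses \<open>Q(d)\<close> at \<open>d = 1, 2, \<dots>\<close>; the factors \<open>1 / i!\<close> distribute ties evenly.
  Hence, modulo \<open>q\<^bsup>N+1\<^esup>\<close>, the map \<open>\<gg>\<^sup>s\<^sup>h\<close> reads off the coefficients of the group-like series
  \<open>exp(e\<^sub>0) exp(Q(N) e\<^sub>1) exp(e\<^sub>0) \<cdots> exp(Q(1) e\<^sub>1) exp(e\<^sub>0)\<close>, so it is multiplicative for the shuffle
  product.

  Expanding \<open>Q(d)\<close> into a geometric series and conjugating the resulting partitions turns
  \<open>g\<^sup>s\<^sup>h(k\<^sub>1, \<dots>, k\<^sub>r)\<close> into the sum over \<open>0 < u\<^sub>1 < \<dots> < u\<^sub>r\<close> of the products of
  \<open>L\<^sub>k(u) = \<Sum>\<^sub>v v\<^bsup>k-1\<^esup> / (k-1)! q\<^bsup>uv\<^esup>\<close>, except that a single entry \<open>1\<close> in position \<open>p < r\<close> contributes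
  a correction: the sum with \<open>u\<^sub>p\<close> removed and weighted by \<open>(u\<^bsub>p+1\<^esub> - u\<^bsub>p-1\<^esub> - 1) / 2\<close>. These nested sums
  multiply by a quasi-shuffle product in which \<open>L\<^sub>a L\<^sub>b\<close> equals \<open>L\<^bsub>a+b\<^esub>\<close> plus a combination of \<open>L\<^sub>j\<close> with
  \<open>2 \<le> j < a + b\<close>. So, up to terms of lower weight, only the corrections survive in
  \<open>\<gg>\<^sup>s\<^sup>h(ds(u, v))\<close>. In the combinations of the theorem the corrections telescope to the sums in which
  \<open>L\<^sub>k(u\<^sub>p)\<close>, with \<open>k = k\<^sub>p\<close>, is replaced by \<open>k u\<^sub>p L\<^bsub>k+1\<^esub>(u\<^sub>p)\<close>, and this is the effect of \<open>q d/dq\<close>.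
\<close>

unbundle fps_syntax

section \<open>Shuffle characters\<close>

text \<open>All interleavings listed with multiplicity, so that values of a functional can be summed
  directly.\<close>

fun shuffle_list :: "'a list \<Rightarrow> 'a list \<Rightarrow> 'a list list" where
  "shuffle_list [] w = [w]"
| "shuffle_list (a # v) [] = [a # v]"
| "shuffle_list (a # v) (b # w) =
     map ((#) a) (shuffle_list v (b # w)) @ map ((#) b) (shuffle_list (a # v) w)"

lemma shuffle_list_Nil2 [simp]: "shuffle_list v [] = [v]"
  by (cases v) auto

lemma shuffle_words_eq: "shuffle_words v w = sum_list (map word (shuffle_list v w))"
proof (induction v w rule: shuffle_list.induct)
  case (3 a v b w)
  have "word [c] * sum_list (map word ws) = sum_list (map (word \<circ> (#) c) ws)" for c ws
    by (induction ws) (simp_all add: distrib_left word_mult)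
  with 3 show ?case by simp
qed simp_all

text \<open>The linear extension of \<open>\<phi>\<close> evaluated on the shuffle product of
  \<open>v\<close> and \<open>w\<close>.\<close>

definition shuffle_sum :: "('a list \<Rightarrow> 'b::comm_ring_1) \<Rightarrow> 'a list \<Rightarrow> 'a list \<Rightarrow> 'b" where
  "shuffle_sum \<phi> v w = sum_list (map \<phi> (shuffle_list v w))"

lemma shuffle_sum_simps [simp]:
  "shuffle_sum \<phi> [] w = \<phi> w"
  "shuffle_sum \<phi> v [] = \<phi> v"
  "shuffle_sum \<phi> (a # v) (b # w) =
     shuffle_sum (\<lambda>x. \<phi> (a # x)) v (b # w) + shuffle_sum (\<lambda>x. \<phi> (b # x)) (a # v) w"
  by (simp_all add: shuffle_sum_def o_def)

lemma shuffle_sum_add: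
  "shuffle_sum (\<lambda>x. \<phi> x + \<psi> x) v w = shuffle_sum \<phi> v w + shuffle_sum \<psi> v w"
  by (simp add: shuffle_sum_def sum_list_addf)

lemma shuffle_sum_cmult: "shuffle_sum (\<lambda>x. c * \<phi> x) v w = c * shuffle_sum \<phi> v w"
  by (simp add: shuffle_sum_def sum_list_const_mult)

section \<open>Convolution along deconcatenation, and characters of the shuffle algebra\<close>

definition convolution :: "('a list \<Rightarrow> 'b::comm_ring_1) \<Rightarrow> ('a list \<Rightarrow> 'b) \<Rightarrow> 'a list \<Rightarrow> 'b" where
  "convolution \<phi> \<psi> w = (\<Sum>i\<le>length w. \<phi> (take i w) * \<psi> (drop i w))"

lemma convolution_Nil [simp]: "convolution \<phi> \<psi> [] = \<phi> [] * \<psi> []"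
  by (simp add: convolution_def)

lemma convolution_Cons: "convolution \<phi> \<psi> (a # w) = \<phi> [] * \<psi> (a # w)
    + convolution (\<lambda>x. \<phi> (a # x)) \<psi> w"
  by (simp add: convolution_def sum.atMost_Suc_shift del: sum.atMost_Suc)

text \<open>Deconcatenation is compatible with shuffling: cutting a shuffle of \<open>v\<close> and
  \<open>w\<close> amounts to cutting both words and shuffling the pieces separately. The induction
  keeps \<open>\<phi>\<close> arbitrary because peeling off a letter \<open>a\<close> replaces it by
  \<open>\<lambda>x. \<phi> (a # x)\<close>.\<close>

lemma shuffle_sum_convolution:
  "shuffle_sum (convolution \<phi> \<psi>) v w =
     (\<Sum>i\<le>length v. \<Sum>j\<le>length w. shuffle_sum \<phi> (take i v) (take j w) * shuffle_sum \<psi> (drop i v)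
         (drop j w))"
proof (induction v w arbitrary: \<phi> rule: shuffle_list.induct)
  case (1 w)
  then show ?case by (simp add: convolution_def)
next
  case (2 a v)
  then show ?case by (simp add: convolution_def)
next
  case (3 a v b w)
  have "shuffle_sum (convolution \<phi> \<psi>) (a # v) (b # w) = \<phi> [] * shuffle_sum \<psi> (a # v) (b # w)
     + shuffle_sum (convolution (\<lambda>x. \<phi> (a # x)) \<psi>) v (b # w) + shuffle_sum (convolution (\<lambda>x. \<phi> (b
         # x)) \<psi>) (a # v) w"
    by (simp add: convolution_Cons shuffle_sum_add shuffle_sum_cmult algebra_simps)
  then show ?case
    unfolding "3.IH"
    by (simp add: sum.atMost_Suc_shift sum.distrib algebra_simps del: sum.atMost_Suc)
qed

definition shuffle_character :: "('a list \<Rightarrow> 'b::comm_ring_1) \<Rightarrow> bool" where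
  "shuffle_character \<phi> \<longleftrightarrow> (\<forall>v w. shuffle_sum \<phi> v w = \<phi> v * \<phi> w)"

lemma shuffle_character_convolution:
  assumes "shuffle_character \<phi>" and "shuffle_character \<psi>"
  shows "shuffle_character (convolution \<phi> \<psi>)"
  using assms unfolding shuffle_character_def
  by (simp add: shuffle_sum_convolution convolution_def sum_product mult_ac)

section \<open>Exponentials of a single letter and the characters built from them\<close>

definition power_functional :: "'a \<Rightarrow> (nat \<Rightarrow> 'b::comm_ring_1) \<Rightarrow> 'a list \<Rightarrow> 'b" where
  "power_functional a f w = (if set w \<subseteq> {a} then f (length w) else 0)"

lemma power_functional_simps [simp]:
  "power_functional a f [] = f 0"
  "power_functional a f (b # w) = (if a = b then power_functional a (\<lambda>n. f (Suc n)) w else 0)"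
  by (auto simp: power_functional_def)

lemma shuffle_sum_zero [simp]: "shuffle_sum (\<lambda>x. 0) v w = 0"
  by (simp add: shuffle_sum_def)

text \<open>All shuffles of two powers of \<open>a\<close> are the same word, and a binomial
  coefficient counts them. Any other letter survives in every shuffle and makes the functional
  vanish.\<close>

lemma shuffle_sum_power_functional:
  "shuffle_sum (power_functional a f) v w = (if set v \<subseteq> {a} \<and> set w \<subseteq> {a}
     then of_nat ((length v + length w) choose length v) * f (length v + length w) else 0)"
proof (induction v w arbitrary: f rule: shuffle_list.induct)
  case (3 b v c w)
  then show ?case
    by (cases "a = b"; cases "a = c") (auto simp: algebra_simps)
qed (auto simp: power_functional_def)

definition exp_functional :: "'a \<Rightarrow> rat fps \<Rightarrow> 'a list \<Rightarrow> rat fps" where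
  "exp_functional a t = power_functional a (\<lambda>n. fps_const (1 / fact n) * t ^ n)"

text \<open>The factorials of the divided powers absorb the binomial coefficient that counts the
  shuffles.\<close>

lemma shuffle_character_exp: "shuffle_character (exp_functional a t)"
proof -
  have "of_nat ((m + n) choose m) * (fps_const (1 / fact (m + n)) * t ^ (m + n)) =
      fps_const (1 / fact m) * t ^ m * (fps_const (1 / fact n) * t ^ n)" for m n
  proof -
    have "of_nat ((m + n) choose m) * (1 / fact (m + n)) = 1 / fact m * (1 / fact n :: rat)"
      using binomial_fact[of m "m + n", where 'a = rat] by (simp add: field_simps)
    then have "fps_const (of_nat ((m + n) choose m)) * fps_const (1 / fact (m + n)) =
        fps_const (1 / fact m) * fps_const (1 / fact n :: rat)"
      by (simp only: fps_const_mult)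
    then show ?thesis
      by (simp add: fps_of_nat power_add mult_ac)
  qed
  then show ?thesis
    unfolding shuffle_character_def exp_functional_def shuffle_sum_power_functional
    by (auto simp: power_functional_def)
qed

definition geom :: "nat \<Rightarrow> rat fps" where
  "geom d = fps_X ^ d / (1 - fps_X ^ d)"

text \<open>The coefficients of \<open>exp(e\<^sub>0) exp(Q(N) e\<^sub>1) exp(e\<^sub>0) \<cdots> exp(Q(1) e\<^sub>1) exp(e\<^sub>0)\<close>.\<close>

fun path_character :: "nat \<Rightarrow> letter list \<Rightarrow> rat fps" where
  "path_character 0 = exp_functional L0 1"
| "path_character (Suc N) = convolution (exp_functional L0 1) (convolution (exp_functional L1
    (geom (Suc N))) (path_character N))"

lemma shuffle_character_path_character: "shuffle_character (path_character N)"
  by (induction N) (simp_all add: shuffle_character_exp shuffle_character_convolution)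

abbreviation index_word :: "nat list \<Rightarrow> letter list" where
  "index_word ks \<equiv> concat (map (\<lambda>k. L1 # replicate (k - 1) L0) ks)"

text \<open>The ways to let a factor \<open>exp(Q(x) e\<^sub>1)\<close> consume the initial letters \<open>e\<^sub>1\<close> of a word, which
  requires all entries of the index to be \<open>1\<close> except for the last one that is touched.\<close>

fun blocks :: "(nat \<Rightarrow> 'b::comm_ring_1) \<Rightarrow> (nat \<Rightarrow> nat list \<Rightarrow> 'b) \<Rightarrow> nat list \<Rightarrow> 'b" where
  "blocks f \<psi> [] = 0"
| "blocks f \<psi> (k # ks) = f 0 * \<psi> (k - 1) ks + (if k = 1 then blocks (\<lambda>n. f (Suc n)) \<psi> ks else 0)"

text \<open>The coefficient of \<open>e\<^sub>0\<^sup>l e\<^sub>k\<^sub>1 \<cdots> e\<^sub>k\<^sub>r\<close> in \<^term>\<open>path_character (D - 1)\<close>, organised by the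
  largest summation index \<open>x < D\<close>; for \<open>l = 0\<close> it is \<open>g\<^sup>s\<^sup>h(k\<^sub>1, \<dots>, k\<^sub>r)\<close> modulo \<open>q\<^sup>D\<close>.\<close>

function g_trunc :: "nat \<Rightarrow> nat \<Rightarrow> nat list \<Rightarrow> rat fps" where
  "g_trunc D l ks = (if ks = [] then fps_const (of_nat D ^ l / fact l) else
     (\<Sum>x\<in>{1..<D}. fps_const (of_nat (D - x) ^ l / fact l) *
        blocks (\<lambda>n. fps_const (1 / fact (Suc n)) * geom x ^ Suc n) (g_trunc x) ks))"
  by pat_completeness auto
termination by (relation "measure (\<lambda>(D, l, ks). D)") auto

declare g_trunc.simps [simp del]

lemma g_trunc_Nil [simp]: "g_trunc D l [] = fps_const (of_nat D ^ l / fact l)"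
  by (subst g_trunc.simps) simp

lemma g_trunc_nonempty:
  assumes "ks \<noteq> []"
  shows "g_trunc D l ks = (\<Sum>x\<in>{1..<D}. fps_const (of_nat (D - x) ^ l / fact l) *
     blocks (\<lambda>n. fps_const (1 / fact (Suc n)) * geom x ^ Suc n) (g_trunc x) ks)"
  using assms by (subst g_trunc.simps) simp

section \<open>Evaluation of the path character by a recursion on indices\<close>

lemma convolution_zero [simp]: "convolution (\<lambda>x. 0) \<psi> w = 0"
  by (simp add: convolution_def)

lemma convolution_L0:
  assumes "w = [] \<or> hd w = L1"
  shows "convolution (power_functional L0 f) \<psi> (replicate l L0 @ w)
      = (\<Sum>j\<le>l. f j * \<psi> (replicate (l - j) L0 @ w))"
proof (induction l arbitrary: f)
  case 0
  with assms show ?case by (cases w) (simp_all add: convolution_Cons)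
next
  case (Suc l)
  then show ?case by (simp add: convolution_Cons sum.atMost_Suc_shift del: sum.atMost_Suc)
qed

text \<open>A nonempty prefix consisting of \<open>L1\<close> only ends at the first letter of some
  entry \<open>k\<close>, and every entry before it equals 1. The \<open>k - 1\<close> letters
  \<open>L0\<close> of that entry are left in front of the remaining index.\<close>

lemma convolution_L1:
  assumes "\<forall>k\<in>set ks. 1 \<le> k"
  shows "convolution (power_functional L1 f) \<psi> (index_word ks) =
    f 0 * \<psi> (index_word ks) + blocks (\<lambda>n. f (Suc n)) (\<lambda>l ks. \<psi> (replicate l L0 @ index_word ks))
        ks"
  using assms
proof (induction ks arbitrary: f)
  case (Cons k ks)
  show ?case
  proof (cases "k = 1")
    case True
    with Cons show ?thesis by (simp add: convolution_Cons)
  next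
    case False
    with Cons.prems obtain l where k: "k = Suc (Suc l)"
      by (metis One_nat_def Suc_le_D list.set_intros(1) not0_implies_Suc)
    show ?thesis by (simp add: k convolution_Cons)
  qed
qed simp

lemma blocks_cong:
  assumes "\<And>l ks'. set ks' \<subseteq> set ks \<Longrightarrow> \<psi> l ks' = \<psi>' l ks'"
  shows "blocks f \<psi> ks = blocks f \<psi>' ks"
  using assms
proof (induction ks arbitrary: f)
  case (Cons k ks)
  have "blocks g \<psi> ks = blocks g \<psi>' ks" for g
    by (rule Cons.IH) (use Cons.prems in auto)
  moreover have "\<psi> (k - 1) ks = \<psi>' (k - 1) ks"
    by (rule Cons.prems) auto
  ultimately show ?case by simp
qed simp

lemma power_div_fact_binomial:
  fixes a b :: rat
  shows "(\<Sum>j\<le>l. a ^ j / fact j * (b ^ (l - j) / fact (l - j))) = (a + b) ^ l / fact l"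
proof -
  have "(a + b) ^ l / fact l = (\<Sum>j\<le>l. of_nat (l choose j) * a ^ j * b ^ (l - j) / fact l)"
    by (simp add: binomial_ring sum_divide_distrib)
  also have "\<dots> = (\<Sum>j\<le>l. a ^ j / fact j * (b ^ (l - j) / fact (l - j)))"
    by (rule sum.cong) (auto simp: binomial_fact)
  finally show ?thesis ..
qed

lemma sum_fps_const: "(\<Sum>x\<in>A. fps_const (f x)) = fps_const (\<Sum>x\<in>A. f x)"
  by (induction A rule: infinite_finite_induct) simp_all

text \<open>Split by the largest index \<open>x\<close>. For \<open>x < Suc N\<close>, the extra
  factor \<open>exp(e0)\<close> lengthens the gap by 1 through the binomial theorem; for
  \<open>x = Suc N\<close> the gap is 1, which leaves the factor \<open>1 / fact l\<close>.\<close>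

lemma g_trunc_step:
  assumes "ks \<noteq> []"
  shows "(\<Sum>j\<le>l. fps_const (1 / fact j) * g_trunc (Suc N) (l - j) ks)
     + fps_const (1 / fact l) * blocks (\<lambda>n. fps_const (1 / fact (Suc n)) * geom (Suc N) ^ Suc n)
         (g_trunc (Suc N)) ks
    = g_trunc (Suc (Suc N)) l ks"
proof -
  define Bx where "Bx x = blocks (\<lambda>n. fps_const (1 / fact (Suc n)) * geom x ^ Suc n) (g_trunc x)
      ks" for x
  have S: "(\<Sum>j\<le>l. fps_const (1 / fact j) * fps_const (of_nat (Suc N - x) ^ (l - j) / fact (l
      - j))) =
      fps_const (of_nat (Suc (Suc N) - x) ^ l / fact l :: rat)" if "x \<in> {1..<Suc N}" for x
  proof -
    have "of_nat (Suc (Suc N) - x) = (1 + of_nat (Suc N - x) :: rat)"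
      using that by (simp add: of_nat_diff)
    then show ?thesis
      using power_div_fact_binomial[where a = 1 and l = l and b = "of_nat (Suc N - x)"]
      by (simp add: sum_fps_const)
  qed
  have "(\<Sum>j\<le>l. fps_const (1 / fact j) * g_trunc (Suc N) (l - j) ks) =
     (\<Sum>x\<in>{1..<Suc N}. (\<Sum>j\<le>l. fps_const (1 / fact j) * fps_const (of_nat (Suc N - x) ^ (l
         - j) / fact (l - j))) * Bx x)"
    unfolding g_trunc_nonempty[OF assms] Bx_def[symmetric] sum_distrib_left sum_distrib_right
        mult.assoc
    by (rule sum.swap)
  also have "\<dots> = (\<Sum>x\<in>{1..<Suc N}. fps_const (of_nat (Suc (Suc N) - x) ^ l / fact l) * Bx x)"
    by (intro sum.cong refl arg_cong2[where f = "(*)"] S)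
  finally show ?thesis
    by (simp add: Bx_def g_trunc_nonempty[OF assms])
qed

lemma path_character_eq_g_trunc:
  assumes "\<forall>k\<in>set ks. 1 \<le> k"
  shows "path_character N (replicate l L0 @ index_word ks) = g_trunc (Suc N) l ks"
  using assms
proof (induction N arbitrary: l ks)
  case 0
  show ?case
    by (cases ks) (auto simp: g_trunc_nonempty exp_functional_def power_functional_def)
next
  case (Suc N)
  have hd: "index_word ks = [] \<or> hd (index_word ks) = L1" by (cases ks) auto
  let ?\<psi> = "convolution (exp_functional L1 (geom (Suc N))) (path_character N)"
  \<comment> \<open>A leading \<open>L0\<close> stops the factor \<open>exp(Q e1)\<close> at its
    constant term.\<close>
  have 1: "?\<psi> (replicate (Suc n) L0 @ index_word ks) = g_trunc (Suc N) (Suc n) ks" for n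
    using Suc.IH[OF Suc.prems, of "Suc n"] by (simp add: exp_functional_def convolution_Cons)
  \<comment> \<open>Without a leading \<open>L0\<close> the point mass at \<open>Suc N\<close> may
    absorb initial letters, which adds the \<open>blocks\<close> term.\<close>
  have 2: "?\<psi> (index_word ks) = g_trunc (Suc N) 0 ks +
       blocks (\<lambda>n. fps_const (1 / fact (Suc n)) * geom (Suc N) ^ Suc n) (g_trunc (Suc N)) ks"
  proof -
    have "blocks f (\<lambda>l ks. path_character N (replicate l L0 @ index_word ks)) ks
        = blocks f (g_trunc (Suc N)) ks" for f
    proof (rule blocks_cong)
      fix l ks' assume "set ks' \<subseteq> set ks"
      then have "\<forall>k\<in>set ks'. 1 \<le> k" using Suc.prems by blast
      then show "path_character N (replicate l L0 @ index_word ks') = g_trunc (Suc N) l ks'"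
          by (rule Suc.IH)
    qed
    then show ?thesis
      using Suc.IH[OF Suc.prems, of 0] unfolding exp_functional_def
      by (subst convolution_L1[OF Suc.prems]) simp
  qed
  have "path_character (Suc N) (replicate l L0 @ index_word ks) =
      (\<Sum>j\<le>l. fps_const (1 / fact j) * ?\<psi> (replicate (l - j) L0 @ index_word ks))"
    unfolding path_character.simps by (subst (1) exp_functional_def, subst convolution_L0[OF hd])
        simp
  \<comment> \<open>Only the summand \<open>j = l\<close>, where \<open>exp(e0)\<close> consumes the
    whole initial run, exposes a letter \<open>L1\<close> to the point mass.\<close>
  also have "\<dots> = (\<Sum>j<l. fps_const (1 / fact j) * g_trunc (Suc N) (l - j) ks)
      + fps_const (1 / fact l) * ?\<psi> (index_word ks)"
  proof -
    have "?\<psi> (replicate (l - j) L0 @ index_word ks) = g_trunc (Suc N) (l - j) ks" if "j < l" for j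
      using 1[of "l - Suc j"] that by (simp only: Suc_diff_Suc)
    then show ?thesis by (simp flip: lessThan_Suc_atMost)
  qed
  also have "\<dots> = (\<Sum>j\<le>l. fps_const (1 / fact j) * g_trunc (Suc N) (l - j) ks)
     + fps_const (1 / fact l) * blocks (\<lambda>n. fps_const (1 / fact (Suc n)) * geom (Suc N) ^ Suc n)
         (g_trunc (Suc N)) ks"
    unfolding 2 by (simp add: algebra_simps flip: lessThan_Suc_atMost)
  also have "\<dots> = g_trunc (Suc (Suc N)) l ks"
  proof (cases "ks = []")
    case False
    then show ?thesis by (rule g_trunc_step)
  next
    case True
    then show ?thesis
      using power_div_fact_binomial[where a = 1 and l = l and b = "of_nat (Suc N)"]
      by (simp add: sum_fps_const)
  qed
  finally show ?case .
qed

section \<open>Exponentials of linear forms\<close>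

lemma mfps_coeff_simps [simp]:
  "mfps_coeff 0 m = 0"
  "mfps_coeff (f + g) m = mfps_coeff f m + mfps_coeff g m"
  "mfps_coeff (f - g) m = mfps_coeff f m - mfps_coeff g m"
  "mfps_coeff (mfps_const c) m = (if m = 0 then c else 0)"
  by (simp_all add: zero_mfps.rep_eq plus_mfps.rep_eq minus_mfps.rep_eq mfps_const_def
      Abs_mfps_inverse)

lemma mfps_coeff_sum: "mfps_coeff (\<Sum>x\<in>A. f x) m = (\<Sum>x\<in>A. mfps_coeff (f x) m)"
  by (induction A rule: infinite_finite_induct) simp_all

lemma mfps_coeff_mult:
  "mfps_coeff (f * g) m = (\<Sum>p | fst p + snd p = m. mfps_coeff f (fst p) * mfps_coeff g (snd p))"
  by (rule times_mfps.rep_eq[THEN fun_cong])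

lemma mfps_coeff_const_mult [simp]: "mfps_coeff (mfps_const c * f) m = c * mfps_coeff f m"
proof -
  have "mfps_coeff (mfps_const c * f) m = (\<Sum>p\<in>{(0, m)}. mfps_coeff (mfps_const c) (fst p) *
      mfps_coeff f (snd p))"
    unfolding mfps_coeff_mult by (rule sum.mono_neutral_right) (auto simp: finite_decompositions)
  then show ?thesis by simp
qed

lemma mfps_const_mult: "mfps_const c * mfps_const d = mfps_const (c * d :: 'a::comm_ring_1)"
  by (rule mfps_eqI) simp

lemma mfps_const_1: "mfps_const 1 = (1 :: 'a::comm_ring_1 mfps)"
  by (rule mfps_eqI) (simp add: one_mfps.rep_eq)

lemma prod_mfps_const: "(\<Prod>x\<in>A. mfps_const (f x)) = mfps_const (\<Prod>x\<in>A. f x :: 'a::comm_ring_1)"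
  by (induction A rule: infinite_finite_induct) (simp_all add: mfps_const_mult mfps_const_1)

lemma mfps_coeff_of_nat_mult [simp]: "mfps_coeff (of_nat n * f) m = of_nat n * mfps_coeff f m"
  by (induction n) (simp_all add: algebra_simps)

lemma mfps_coeff_X:
  assumes "i \<noteq> 0"
  shows "mfps_coeff (mfps_X i) m = (if m = Poly_Mapping.single i 1 then 1 else 0)"
  using assms by (simp add: mfps_X_def Abs_mfps_inverse)

lemma mfps_coeff_X_mult:
  assumes "i \<noteq> 0"
  shows "mfps_coeff (mfps_X i * f) m =
    (if Poly_Mapping.lookup m i = 0 then 0 else mfps_coeff f (m - Poly_Mapping.single i 1))"
proof -
  let ?s = "Poly_Mapping.single i (1::nat)"
  let ?A = "{p. fst p + snd p = m}"
  have iff: "p \<in> ?A \<and> fst p = ?s \<longleftrightarrow> Poly_Mapping.lookup m i \<noteq> 0 \<and> p = (?s, m - ?s)" for p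
  proof
    assume "p \<in> ?A \<and> fst p = ?s"
    then show "Poly_Mapping.lookup m i \<noteq> 0 \<and> p = (?s, m - ?s)"
      by (cases p) (auto simp: lookup_add)
  next
    assume r: "Poly_Mapping.lookup m i \<noteq> 0 \<and> p = (?s, m - ?s)"
    have "?s + (m - ?s) = m"
      using r by (intro poly_mapping_eqI) (auto simp: lookup_add lookup_minus lookup_single
          when_def)
    with r show "p \<in> ?A \<and> fst p = ?s" by simp
  qed
  have "mfps_coeff (mfps_X i * f) m = (\<Sum>p\<in>?A \<inter> {p. fst p = ?s}. mfps_coeff f (snd p))"
    unfolding mfps_coeff_mult mfps_coeff_X[OF assms]
    by (subst sum.inter_restrict) (auto simp: finite_decompositions intro!: sum.cong)
  also have "?A \<inter> {p. fst p = ?s} = (if Poly_Mapping.lookup m i = 0 then {} else {(?s, m - ?s)})"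
    by (rule set_eqI) (use iff in simp)
  finally show ?thesis by simp
qed

section \<open>Homogeneous series and the functional equation of the exponential\<close>

definition monom_degree :: "(nat \<Rightarrow>\<^sub>0 nat) \<Rightarrow> nat" where
  "monom_degree m = (\<Sum>i\<in>Poly_Mapping.keys m. Poly_Mapping.lookup m i)"

lemma monom_degree_eq:
  assumes "finite A" "Poly_Mapping.keys m \<subseteq> A"
  shows "monom_degree m = (\<Sum>i\<in>A. Poly_Mapping.lookup m i)"
  unfolding monom_degree_def using assms by (intro sum.mono_neutral_left) (auto simp: in_keys_iff)

lemma monom_degree_add: "monom_degree (p + q) = monom_degree p + monom_degree q"
proof -
  let ?A = "Poly_Mapping.keys p \<union> Poly_Mapping.keys q"
  show ?thesis
    using monom_degree_eq[of ?A p] monom_degree_eq[of ?A q] monom_degree_eq[of ?A "p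
        + q"] Poly_Mapping.keys_add[of p q]
    by (simp add: lookup_add sum.distrib)
qed

definition homogeneous :: "nat \<Rightarrow> 'a::comm_ring_1 mfps \<Rightarrow> bool" where
  "homogeneous n f \<longleftrightarrow> (\<forall>m. monom_degree m \<noteq> n \<longrightarrow> mfps_coeff f m = 0)"

lemma homogeneous_mult:
  assumes "homogeneous a f" and "homogeneous b g"
  shows "homogeneous (a + b) (f * g)"
  unfolding homogeneous_def mfps_coeff_mult
proof (intro allI impI sum.neutral ballI)
  fix m p assume "monom_degree m \<noteq> a + b" "p \<in> {p. fst p + snd p = m}"
  then have "monom_degree (fst p) \<noteq> a \<or> monom_degree (snd p) \<noteq> b"
    by (auto simp: monom_degree_add)
  then show "mfps_coeff f (fst p) * mfps_coeff g (snd p) = 0"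
    using assms by (auto simp: homogeneous_def)
qed

lemma homogeneous_power: "homogeneous 1 f \<Longrightarrow> homogeneous n (f ^ n)"
proof (induction n)
  case 0
  then show ?case by (simp add: homogeneous_def one_mfps.rep_eq monom_degree_def)
next
  case (Suc n)
  then show ?case using homogeneous_mult[of 1 f n "f ^ n"] by simp
qed

lemma homogeneous_lin:
  "homogeneous n 0"
  "homogeneous n f \<Longrightarrow> homogeneous n g \<Longrightarrow> homogeneous n (f + g)"
  "homogeneous n f \<Longrightarrow> homogeneous n g \<Longrightarrow> homogeneous n (f - g)"
  "homogeneous n f \<Longrightarrow> homogeneous n (mfps_const c * f)"
  "homogeneous n f \<Longrightarrow> homogeneous n (of_nat k * f)"
  by (auto simp: homogeneous_def)

lemma homogeneous_sum:
  "(\<And>x. x \<in> A \<Longrightarrow> homogeneous n (f x)) \<Longrightarrow> homogeneous n (\<Sum>x\<in>A. f x)"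
  by (induction A rule: infinite_finite_induct) (auto intro: homogeneous_lin)

lemma homogeneous_X: "homogeneous 1 (mfps_X i)"
proof (cases "i = 0")
  case True
  then show ?thesis by (simp add: mfps_X_def homogeneous_lin)
next
  case False
  then show ?thesis by (auto simp: homogeneous_def mfps_coeff_X monom_degree_def)
qed

text \<open>The power \<open>f ^ n\<close> is homogeneous of degree \<open>n\<close>, so a single
  term of the exponential series reaches a given monomial.\<close>

lemma mfps_coeff_exp:
  assumes "homogeneous 1 f"
  shows "mfps_coeff (mfps_exp f) m = fps_const (1 / fact (monom_degree m)) * mfps_coeff (f ^
      monom_degree m) m"
proof -
  have "mfps_coeff (mfps_exp f) m = (\<Sum>\<^sub>\<infinity>n. fps_const (1 / fact n) * mfps_coeff (f ^ n) m)"
    by (simp add: mfps_exp_def Abs_mfps_inverse)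
  also have "\<dots> = (\<Sum>\<^sub>\<infinity>n\<in>{monom_degree m}. fps_const (1 / fact n) * mfps_coeff (f ^ n) m)"
    using homogeneous_power[OF assms] by (intro infsum_cong_neutral) (auto simp: homogeneous_def)
  finally show ?thesis by simp
qed

lemma mfps_exp_0 [simp]: "mfps_exp 0 = 1"
proof (rule mfps_eqI)
  fix m :: "nat \<Rightarrow>\<^sub>0 nat"
  have "monom_degree m = 0 \<longleftrightarrow> m = 0"
    by (auto simp: monom_degree_def in_keys_iff keys_eq_empty[symmetric] simp del: keys_eq_empty)
  then show "mfps_coeff (mfps_exp 0) m = mfps_coeff 1 m"
    by (auto simp: mfps_coeff_exp homogeneous_lin one_mfps.rep_eq power_0_left)
qed

text \<open>For each splitting of the monomial, homogeneity selects one term of the binomial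
  expansion, and its binomial coefficient divided by \<open>fact n\<close> is the product of the two
  inverse factorials.\<close>

lemma mfps_exp_add:
  assumes "homogeneous 1 f" and "homogeneous 1 g"
  shows "mfps_exp (f + g) = mfps_exp f * mfps_exp g"
proof (rule mfps_eqI)
  fix m :: "nat \<Rightarrow>\<^sub>0 nat"
  let ?A = "{p. fst p + snd p = m}"
  define n where "n = monom_degree m"
  have *: "fps_const (1 / fact n) * (\<Sum>k\<le>n. of_nat (n choose k) *
      (mfps_coeff (f ^ k) (fst p) * mfps_coeff (g ^ (n - k)) (snd p))) =
     mfps_coeff (mfps_exp f) (fst p) * mfps_coeff (mfps_exp g) (snd p)" if "p \<in> ?A" for p
  proof -
    let ?a = "monom_degree (fst p)" and ?b = "monom_degree (snd p)"
    have n: "n = ?a + ?b" using that by (auto simp: n_def monom_degree_add)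
    have "(\<Sum>k\<le>n. of_nat (n choose k) *
        (mfps_coeff (f ^ k) (fst p) * mfps_coeff (g ^ (n - k)) (snd p))) =
      (\<Sum>k\<in>{?a}. of_nat (n choose k) *
        (mfps_coeff (f ^ k) (fst p) * mfps_coeff (g ^ (n - k)) (snd p)))"
      using homogeneous_power[OF assms(1)] n
      by (intro sum.mono_neutral_right) (auto simp: homogeneous_def)
    also have "\<dots> = of_nat (n choose ?a) * (mfps_coeff (f ^ ?a) (fst p) * mfps_coeff (g ^ ?b) (snd
        p))"
      by (simp add: n)
    finally have 1: "fps_const (1 / fact n) * (\<Sum>k\<le>n. of_nat (n choose k) *
      (mfps_coeff (f ^ k) (fst p) * mfps_coeff (g ^ (n - k)) (snd p))) =
      fps_const (1 / fact n) * of_nat (n choose ?a) * (mfps_coeff (f ^ ?a) (fst p) * mfps_coeff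
          (g ^ ?b) (snd p))"
      by (simp only: mult.assoc)
    have "1 / fact n * of_nat (n choose ?a) = (1 / fact ?a * (1 / fact ?b) :: rat)"
      using n by (simp add: binomial_fact)
    then have "fps_const (1 / fact n) * of_nat (n choose ?a) = fps_const (1 / fact ?a) *
        fps_const (1 / fact ?b :: rat)"
      by (simp only: fps_const_mult fps_of_nat[symmetric])
    with 1 show ?thesis
      by (simp only: mfps_coeff_exp assms mult_ac)
  qed
  have "mfps_coeff (mfps_exp (f + g)) m = fps_const (1 / fact n) * mfps_coeff ((f + g) ^ n) m"
    unfolding n_def by (rule mfps_coeff_exp[OF homogeneous_lin(2)[OF assms]])
  also have "(f + g) ^ n = (\<Sum>k\<le>n. of_nat (n choose k) * (f ^ k * g ^ (n - k)))"
    by (simp add: binomial_ring mult.assoc)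
  also have "mfps_coeff \<dots> m = (\<Sum>k\<le>n. \<Sum>p\<in>?A. of_nat (n choose k) * (mfps_coeff (f ^ k) (fst p) *
      mfps_coeff (g ^ (n - k)) (snd p)))"
    unfolding mfps_coeff_sum mfps_coeff_of_nat_mult by (simp add: mfps_coeff_mult
        sum_distrib_left)
  also have "\<dots> = (\<Sum>p\<in>?A. \<Sum>k\<le>n. of_nat (n choose k) * (mfps_coeff (f ^ k) (fst p) * mfps_coeff (g
      ^ (n - k)) (snd p)))"
    by (rule sum.swap)
  also have "fps_const (1 / fact n) * \<dots> = (\<Sum>p\<in>?A. mfps_coeff (mfps_exp f) (fst p) * mfps_coeff
      (mfps_exp g) (snd p))"
    by (subst sum_distrib_left, rule sum.cong[OF refl *])
  finally show "mfps_coeff (mfps_exp (f + g)) m = mfps_coeff (mfps_exp f * mfps_exp g) m"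
    by (simp add: mfps_coeff_mult)
qed

lemma prod_mfps_exp:
  assumes "\<And>x. x \<in> A \<Longrightarrow> homogeneous 1 (f x)"
  shows "(\<Prod>x\<in>A. mfps_exp (f x)) = mfps_exp (\<Sum>x\<in>A. f x)"
  using assms
  by (induction A rule: infinite_finite_induct) (simp_all add: mfps_exp_add homogeneous_sum)

section \<open>Coefficients of powers and exponentials of linear forms\<close>

definition linear_form :: "nat \<Rightarrow> (nat \<Rightarrow> rat) \<Rightarrow> rat fps mfps" where
  "linear_form r c = (\<Sum>s = 1..r. mfps_const (fps_const (c s)) * mfps_X s)"

lemma homogeneous_linear_form: "homogeneous 1 (linear_form r c)"
  unfolding linear_form_def by (intro homogeneous_sum homogeneous_lin homogeneous_X)

text \<open>The multinomial theorem. Splitting off one factor and choosing \<open>X_s\<close> in it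
  contributes in proportion to the exponent of \<open>X_s\<close>; these exponents add up to
  \<open>Suc n\<close>, which completes the factorial.\<close>

lemma mfps_coeff_linear_form_power:
  assumes "Poly_Mapping.keys m \<subseteq> {1..r}" and "monom_degree m = n"
  shows "mfps_coeff (linear_form r c ^ n) m =
    fps_const (fact n * (\<Prod>s = 1..r. c s ^ Poly_Mapping.lookup m s / fact (Poly_Mapping.lookup m
        s)))"
  using assms
proof (induction n arbitrary: m)
  case 0
  then have "\<forall>s\<in>Poly_Mapping.keys m. Poly_Mapping.lookup m s = 0"
    by (simp add: monom_degree_def)
  then have "m = 0" by (metis in_keys_iff keys_eq_empty ex_in_conv)
  then show ?case by (simp add: one_mfps.rep_eq)
next
  case (Suc n)
  let ?P = "\<lambda>m. \<Prod>s = 1..r. c s ^ Poly_Mapping.lookup m s / fact (Poly_Mapping.lookup m s)"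
  have step: "fps_const (c s) * (if Poly_Mapping.lookup m s = 0 then 0
      else mfps_coeff (linear_form r c ^ n) (m - Poly_Mapping.single s 1)) =
     fps_const (of_nat (Poly_Mapping.lookup m s) * fact n * ?P m)" if s: "s \<in> {1..r}" for s
  proof (cases "Poly_Mapping.lookup m s = 0")
    case False
    define m' where "m' = m - Poly_Mapping.single s 1"
    have m: "m = m' + Poly_Mapping.single s 1"
      using False unfolding m'_def
      by (intro poly_mapping_eqI) (auto simp: lookup_add lookup_minus lookup_single when_def)
    have "monom_degree m' = n"
      using Suc.prems(2) unfolding m monom_degree_add by (simp add: monom_degree_def)
    moreover have "Poly_Mapping.keys m' \<subseteq> {1..r}"
      using Suc.prems(1) unfolding m'_def by (auto simp: in_keys_iff lookup_minus)
    ultimately have IH: "mfps_coeff (linear_form r c ^ n) m' = fps_const (fact n * ?P m')"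
      by (rule Suc.IH[rotated])
    have "c s * ?P m' = of_nat (Poly_Mapping.lookup m s) * ?P m"
    proof -
      have 1: "?P q = c s ^ Poly_Mapping.lookup q s / fact (Poly_Mapping.lookup q s) *
        (\<Prod>t\<in>{1..r} - {s}. c t ^ Poly_Mapping.lookup q t / fact (Poly_Mapping.lookup q t))" for q
        using s by (intro prod.remove) auto
      have 2: "(\<Prod>t\<in>{1..r} - {s}. c t ^ Poly_Mapping.lookup m t / fact (Poly_Mapping.lookup m t)) =
        (\<Prod>t\<in>{1..r} - {s}. c t ^ Poly_Mapping.lookup m' t / fact (Poly_Mapping.lookup m' t))"
        by (rule prod.cong) (auto simp: m lookup_add lookup_single)
      have 3: "Poly_Mapping.lookup m s = Suc (Poly_Mapping.lookup m' s)"
        by (simp add: m lookup_add)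
      show ?thesis unfolding 1 2 3 by (simp add: divide_simps)
    qed
    then show ?thesis
      using False IH unfolding m'_def[symmetric] by (simp add: mult_ac)
  qed simp
  have "mfps_coeff (linear_form r c ^ Suc n) m = (\<Sum>s = 1..r. fps_const (c s) *
     (if Poly_Mapping.lookup m s = 0 then 0 else mfps_coeff (linear_form r c ^ n) (m
         - Poly_Mapping.single s 1)))"
    by (subst power_Suc, subst (1) linear_form_def)
      (simp add: sum_distrib_right mfps_coeff_sum mult.assoc mfps_coeff_X_mult)
  also have "\<dots> = (\<Sum>s = 1..r. fps_const (of_nat (Poly_Mapping.lookup m s) * fact n * ?P m))"
    by (rule sum.cong[OF refl step])
  also have "\<dots> = fps_const (of_nat (\<Sum>s = 1..r. Poly_Mapping.lookup m s) * fact n * ?P m)"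
    by (simp add: sum_fps_const sum_distrib_right)
  also have "(\<Sum>s = 1..r. Poly_Mapping.lookup m s) = Suc n"
    using Suc.prems monom_degree_eq[of "{1..r}" m] by simp
  finally show ?case by (simp add: mult_ac)
qed

lemma mfps_coeff_exp_linear_form:
  assumes "Poly_Mapping.keys m \<subseteq> {1..r}"
  shows "mfps_coeff (mfps_exp (linear_form r c)) m =
    fps_const (\<Prod>s = 1..r. c s ^ Poly_Mapping.lookup m s / fact (Poly_Mapping.lookup m s))"
  by (simp add: mfps_coeff_exp[OF homogeneous_linear_form] mfps_coeff_linear_form_power[OF assms])

lemma linear_form_lin:
  "linear_form r c - linear_form r c' = linear_form r (\<lambda>s. c s - c' s)"
  "of_nat n * linear_form r c = linear_form r (\<lambda>s. of_nat n * c s)"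
  "(\<Sum>x\<in>A. linear_form r (d x)) = linear_form r (\<lambda>s. \<Sum>x\<in>A. d x s)"
proof -
  show 1: "linear_form r c - linear_form r c' = linear_form r (\<lambda>s. c s - c' s)" for c c'
    by (rule mfps_eqI) (simp add: linear_form_def mfps_coeff_sum sum_subtractf[symmetric]
        fps_const_sub[symmetric] left_diff_distrib del: fps_const_sub)
  show "of_nat n * linear_form r c = linear_form r (\<lambda>s. of_nat n * c s)"
    by (rule mfps_eqI) (simp add: linear_form_def mfps_coeff_sum sum_distrib_left
        fps_const_mult[symmetric] fps_of_nat mult.assoc del: fps_const_mult)
  show "(\<Sum>x\<in>A. linear_form r (d x)) = linear_form r (\<lambda>s. \<Sum>x\<in>A. d x s)"
    by (rule mfps_eqI) (simp add: linear_form_def mfps_coeff_sum sum_fps_const[symmetric]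
        sum_distrib_right sum.swap[of _ A])
qed

lemma mfps_X_eq_linear_form:
  assumes "i \<le> r"
  shows "mfps_X i = linear_form r (\<lambda>s. if s = i then 1 else 0)"
proof (rule mfps_eqI)
  fix m
  have "mfps_coeff (linear_form r (\<lambda>s. if s = i then 1 else 0)) m =
      (\<Sum>s = 1..r. if s = i then mfps_coeff (mfps_X s) m else 0)"
    unfolding linear_form_def mfps_coeff_sum by (rule sum.cong) auto
  also have "\<dots> = mfps_coeff (mfps_X i) m"
    using assms by (simp add: mfps_X_def)
  finally show "mfps_coeff (mfps_X i) m = mfps_coeff (linear_form r (\<lambda>s. if s
      = i then 1 else 0)) m" ..
qed

section \<open>An explicit recursion for the coefficients\<close>

text \<open>Convergence in the q-adic topology is coefficientwise, and each coefficient is constant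
  once a finite set of indices is included.\<close>

lemma infsum_fps_nth:
  fixes f :: "'b \<Rightarrow> rat fps"
  assumes fin: "\<And>n. finite {d \<in> A. f d $ n \<noteq> 0}"
    and B: "finite B" "B \<subseteq> A" "{d \<in> A. f d $ n \<noteq> 0} \<subseteq> B"
  shows "infsum f A $ n = (\<Sum>d\<in>B. f d $ n)"
proof -
  define S where "S = Abs_fps (\<lambda>n. \<Sum>d | d \<in> A \<and> f d $ n \<noteq> 0. f d $ n)"
  have *: "(\<Sum>d\<in>F. f d $ n) = S $ n" if "finite F" "F \<subseteq> A" "{d \<in> A. f d $ n \<noteq> 0} \<subseteq> F" for F n
    unfolding S_def fps_nth_Abs_fps using that by (intro sum.mono_neutral_right) auto
  have "(f has_sum S) A"
    unfolding has_sum_def tendsto_fps_iff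
  proof
    fix n
    show "\<forall>\<^sub>F F in finite_subsets_at_top A. sum f F $ n = S $ n"
      unfolding eventually_finite_subsets_at_top
      by (rule exI[of _ "{d \<in> A. f d $ n \<noteq> 0}"]) (use fin[of n] * in \<open>auto simp: fps_sum_nth\<close>)
  qed
  then show ?thesis
    using *[OF B] by (simp add: infsumI)
qed

lemma geom_nth:
  assumes "d > 0"
  shows "geom d $ n = (if n > 0 \<and> d dvd n then 1 else 0)"
proof -
  define f :: "rat fps" where "f = Abs_fps (\<lambda>n. if n > 0 \<and> d dvd n then 1 else 0)"
  have "f * (1 - fps_X ^ d) = fps_X ^ d"
  proof (rule fps_ext)
    fix n
    show "(f * (1 - fps_X ^ d)) $ n = fps_X ^ d $ n"
      using assms
      by (auto simp: right_diff_distrib fps_X_power_mult_right_nth f_def dvd_imp_le not_less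
          dvd_minus_self)
  qed
  moreover have "1 - fps_X ^ d \<noteq> (0 :: rat fps)"
  proof
    assume "1 - fps_X ^ d = (0 :: rat fps)"
    then have "(1 - fps_X ^ d) $ 0 = (0 :: rat)" by simp
    with assms show False by simp
  qed
  ultimately have "geom d = f"
    unfolding geom_def by (metis nonzero_mult_div_cancel_right)
  then show ?thesis by (simp add: f_def)
qed

lemma fps_mult_nth_zero_left:
  assumes "\<And>i. i \<le> n \<Longrightarrow> f $ i = 0"
  shows "(f * g) $ n = (0 :: 'a::comm_ring_1)"
  using assms by (auto simp: fps_mult_nth intro!: sum.neutral)

lemma prod_fps_nth_zero:
  assumes "finite A" "x \<in> A" "\<And>i. i \<le> n \<Longrightarrow> f x $ i = 0"
  shows "prod f A $ n = (0 :: 'a::comm_ring_1)"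
  using assms by (simp add: prod.remove[of A x] fps_mult_nth_zero_left)

lemma geom_power_nth_zero:
  assumes "n < d" "k \<ge> 1"
  shows "(geom d ^ k) $ n = 0"
proof -
  obtain k' where "k = Suc k'" using assms(2) by (cases k) auto
  moreover have "geom d $ i = 0" if "i \<le> n" for i
    using assms that by (auto simp: geom_nth dest: dvd_imp_le)
  ultimately show ?thesis by (simp add: fps_mult_nth_zero_left)
qed

text \<open>The coefficient of \<open>X\<^sub>s\<close> in the exponent \<open>\<Sum>\<^sub>j d\<^sub>j Y\<^sub>j\<close> of the summand of \<^const>\<open>H_ser\<close>. At
  \<open>s = 0\<close>, where \<open>X\<^sub>0 = 0\<close>, its value only serves the recursion in \<open>jump_snoc\<close>.\<close>

definition jump :: "nat \<Rightarrow> nat list \<Rightarrow> nat list \<Rightarrow> nat \<Rightarrow> rat" where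
  "jump r il dl s = (\<Sum>j<length il. of_nat (dl ! j) *
     ((if s = r - sum_list (take j il) then 1 else 0) - (if s = r
         - sum_list (take (Suc j) il) then 1 else 0)))"

lemma sum_list_take_le: "sum_list (take j xs) \<le> (sum_list xs :: nat)"
  by (metis append_take_drop_id le_add1 sum_list_append)

text \<open>Appending a block of size \<open>b\<close> shifts all old variables by \<open>b\<close>
  and adds \<open>x (X_b - X_0)\<close>. The new boundary \<open>X_b\<close> falls on the image of
  the old \<open>X_0\<close>, so the two contributions there combine to a gap between consecutive
  summation indices.\<close>

lemma jump_snoc:
  assumes "length il = length dl" "b \<ge> 1"
  shows "jump (sum_list il + b) (il @ [b]) (dl @ [x]) s =
    (if s = 0 then - of_nat x else if s < b then 0
     else jump (sum_list il) il dl (s - b) + (if s = b then of_nat x else 0))"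
proof -
  have le: "sum_list (take j il) \<le> sum_list il" for j by (rule sum_list_take_le)
  have "jump (sum_list il + b) (il @ [b]) (dl @ [x]) s = (\<Sum>j<length il. of_nat (dl ! j) *
     ((if s = sum_list il + b - sum_list (take j il) then 1 else 0) - (if s = sum_list il + b
         - sum_list (take (Suc j) il) then 1 else 0)))
     + of_nat x * ((if s = b then 1 else 0) - (if s = 0 then 1 else 0))"
    using assms by (simp add: jump_def nth_append)
  also have "(\<Sum>j<length il. of_nat (dl ! j) *
     ((if s = sum_list il + b - sum_list (take j il) then 1 else 0) - (if s = sum_list il + b
         - sum_list (take (Suc j) il) then 1 else 0)))
     = (if s < b then 0 else jump (sum_list il) il dl (s - b))"
  proof -
    have "s = sum_list il + b - sum_list (take j il) \<longleftrightarrow> s \<ge> b \<and> s - b = sum_list il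
        - sum_list (take j il)" for j
      using le[of j] by linarith
    then show ?thesis by (auto simp: jump_def)
  qed
  finally show ?thesis using assms by auto
qed

lemma jump_0:
  assumes "length il = length dl" "\<forall>n\<in>set il. 1 \<le> n"
  shows "jump (sum_list il) il dl 0 = - of_nat (last (0 # dl))"
proof (cases il rule: rev_cases)
  case Nil
  with assms show ?thesis by (simp add: jump_def)
next
  case (snoc js b)
  with assms obtain es x where dl: "dl = es @ [x]"
    by (cases dl rule: rev_cases) auto
  with snoc assms jump_snoc[of js es b x 0] show ?thesis by simp
qed

text \<open>The coefficient of the monomial with exponents \<open>k_s - 1\<close> in the exponential
  of the linear form given by \<open>jump\<close>.\<close>

definition jump_prod :: "nat list \<Rightarrow> nat list \<Rightarrow> nat list \<Rightarrow> rat" where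
  "jump_prod il dl ks = (\<Prod>s<length ks. jump (length ks) il dl (Suc s) ^ (ks ! s
      - 1) / fact (ks ! s - 1))"

lemma prod_lessThan_add:
  "(\<Prod>s<m + n. g s) = (\<Prod>s<m. g s) * (\<Prod>s<n. g (m + s :: nat) :: 'a::comm_monoid_mult)"
  by (induction n) (simp_all add: mult.assoc)

text \<open>The last block governs the first \<open>Suc a\<close> variables, since the definition
  reads the variables backwards. Inside the block the linear form has coefficient 0, and a power
  \<open>0 ^ (k - 1)\<close> survives only for \<open>k = 1\<close>; this is the source of the
  condition in \<open>blocks\<close>. At the block boundary the coefficient is the gap
  \<open>x - last (0 # dl)\<close>.\<close>

lemma jump_prod_snoc:
  assumes "length il = length dl" "\<forall>n\<in>set il. 1 \<le> n" "\<forall>k\<in>set ks. 1 \<le> k"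
    and "length ks = sum_list il + Suc a" and "last (0 # dl) \<le> x"
  shows "jump_prod (il @ [Suc a]) (dl @ [x]) ks = (if \<forall>s<a. ks ! s = 1 then
     of_nat (x - last (0 # dl)) ^ (ks ! a - 1) / fact (ks ! a
         - 1) * jump_prod il dl (drop (Suc a) ks) else 0)"
proof -
  define r where "r = sum_list il"
  let ?J = "\<lambda>s. jump (r + Suc a) (il @ [Suc a]) (dl @ [x]) (Suc s)"
  have J: "?J s = (if s < a then 0 else if s = a then of_nat (x
      - last (0 # dl)) else jump r il dl (s - a))" for s
    using jump_snoc[OF assms(1), of "Suc a" x "Suc s"] jump_0[OF assms(1,2)] assms(5)
    by (auto simp: r_def of_nat_diff)
  let ?g = "\<lambda>s. ?J s ^ (ks ! s - 1) / fact (ks ! s - 1)"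
  have len: "length ks = Suc a + r" using assms by (simp add: r_def)
  have ge: "ks ! s \<ge> 1" if "s < length ks" for s using assms(3) that by auto
  have "jump_prod (il @ [Suc a]) (dl @ [x]) ks = (\<Prod>s<Suc a + r. ?g s)"
    by (simp add: jump_prod_def len add.commute)
  also have "\<dots> = (\<Prod>s<Suc a. ?g s) * (\<Prod>s<r. ?g (Suc a + s))"
    by (rule prod_lessThan_add)
  also have "(\<Prod>s<Suc a. ?g s) = (\<Prod>s<a. ?g s) * ?g a" by simp
  also have "(\<Prod>s<r. ?g (Suc a + s)) = jump_prod il dl (drop (Suc a) ks)"
  proof -
    have "?J (Suc a + s) = jump r il dl (Suc s)" for s unfolding J by simp
    then show ?thesis
      unfolding jump_prod_def by (intro prod.cong) (simp_all only: len length_drop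
          diff_add_inverse nth_drop)
  qed
  also have "(\<Prod>s<a. ?g s) = (if \<forall>s<a. ks ! s = 1 then 1 else 0)"
  proof (cases "\<forall>s<a. ks ! s = 1")
    case True
    then show ?thesis by simp
  next
    case False
    then obtain s where "s < a" "ks ! s \<noteq> 1" by blast
    have pos: "ks ! s - 1 > 0" using ge[of s] len \<open>s < a\<close> \<open>ks ! s \<noteq> 1\<close> by simp
    have J0: "?J s = 0" unfolding J using \<open>s < a\<close> by simp
    have "?g s = 0" unfolding J0 using pos by simp
    with \<open>s < a\<close> False show ?thesis by (auto intro!: prod_zero)
  qed
  finally have *: "jump_prod (il @ [Suc a]) (dl @ [x]) ks =
     (if \<forall>s<a. ks ! s = 1 then 1 else 0) * ?g a * jump_prod il dl (drop (Suc a) ks)" .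
  have Ja: "?J a = of_nat (x - last (0 # dl))" unfolding J by simp
  show ?thesis
  proof (cases "\<forall>s<a. ks ! s = 1")
    case True
    show ?thesis unfolding * if_P[OF True] Ja by simp
  next
    case False
    show ?thesis unfolding * if_not_P[OF False] by simp
  qed
qed

lemma blocks_eq_sum:
  "blocks f \<psi> ks = (\<Sum>a<length ks. if \<forall>s<a. ks ! s = 1 then f a * \<psi> (ks ! a
      - 1) (drop (Suc a) ks) else 0)"
proof (induction ks arbitrary: f)
  case (Cons k ks)
  show ?case
    unfolding blocks.simps Cons.IH
    by (simp add: sum.lessThan_Suc_shift All_less_Suc2 del: sum.lessThan_Suc cong: if_cong)
qed simp

section \<open>Compositions paired with chains of summation indices\<close>

definition chain_data :: "nat \<Rightarrow> nat \<Rightarrow> (nat list \<times> nat list) set" where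
  "chain_data D r = {(il, dl). length il = length dl \<and> (\<forall>n\<in>set il. 1 \<le> n) \<and> sum_list il = r \<and>
     sorted_wrt (<) (0 # dl) \<and> (\<forall>x\<in>set dl. x < D)}"

lemma finite_chain_data: "finite (chain_data D r)"
proof -
  have len: "length xs \<le> sum_list xs" if "\<forall>n\<in>set xs. 1 \<le> n" for xs :: "nat list"
    using that by (induction xs) auto
  have "set il \<subseteq> {..r} \<and> length il \<le> r \<and> set dl \<subseteq> {..D} \<and> length dl \<le> r"
    if "(il, dl) \<in> chain_data D r" for il dl
    using that len[of il] unfolding chain_data_def by (auto dest: member_le_sum_list less_imp_le)
  then have "chain_data D r \<subseteq> {xs. set xs \<subseteq> {..r} \<and> length xs \<le> r} \<times> {xs. set xs \<subseteq> {..D}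
      \<and> length xs \<le> r}"
    by auto
  then show ?thesis
    by (rule finite_subset) (auto intro: finite_lists_length_le)
qed

lemma chain_data_0: "chain_data D 0 = {([], [])}"
proof (intro equalityI subsetI)
  fix p assume p: "p \<in> chain_data D 0"
  obtain il dl where p': "p = (il, dl)" by fastforce
  have "il = []" using p p' by (cases il) (auto simp: chain_data_def)
  with p p' show "p \<in> {([], [])}" by (simp add: chain_data_def)
qed (simp add: chain_data_def)

lemma chain_data_snoc_iff:
  "(il @ [Suc a], dl @ [x]) \<in> chain_data D r \<longleftrightarrow> x \<in> {1..<D} \<and> a < r \<and> (il, dl) \<in> chain_data x (r
      - Suc a)"
  unfolding chain_data_def by (auto simp: sorted_wrt_append)

text \<open>Sort by the largest summation index \<open>x\<close> and the size \<open>Suc a\<close>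
  of its block; the rest is a datum of the same kind below \<open>x\<close>.\<close>

lemma sum_chain_data:
  assumes "r > 0"
  shows "(\<Sum>(il, dl)\<in>chain_data D r. F il dl) =
    (\<Sum>x\<in>{1..<D}. \<Sum>a<r. \<Sum>(il, dl)\<in>chain_data x (r - Suc a). F (il @ [Suc a]) (dl @ [x]) ::
        'a::comm_monoid_add)"
proof -
  let ?S = "SIGMA x:{1..<D}. SIGMA a:{..<r}. chain_data x (r - Suc a)"
  let ?f = "\<lambda>(x, a, il, dl). (il @ [Suc a], dl @ [x])"
  have "bij_betw ?f ?S (chain_data D r)"
  proof (rule bij_betwI')
    fix p q assume "p \<in> ?S" "q \<in> ?S"
    then show "(?f p = ?f q) = (p = q)" by auto
  next
    fix p assume "p \<in> ?S"
    then show "?f p \<in> chain_data D r"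
      by (auto simp: chain_data_snoc_iff)
  next
    fix y assume y: "y \<in> chain_data D r"
    obtain il dl where y': "y = (il, dl)" by fastforce
    have "il \<noteq> []" "dl \<noteq> []"
      using y y' assms by (auto simp: chain_data_def)
    then obtain js b es x where eq: "il = js @ [b]" "dl = es @ [x]"
      by (metis rev_exhaust)
    moreover have "b \<ge> 1" using y y' eq by (auto simp: chain_data_def)
    ultimately obtain a where "y = (js @ [Suc a], es @ [x])"
      using y' by (cases b) auto
    with y show "\<exists>p\<in>?S. y = ?f p"
      by (intro bexI[of _ "(x, a, js, es)"]) (auto simp: chain_data_snoc_iff)
  qed
  then have "(\<Sum>p\<in>chain_data D r. case p of (il, dl) \<Rightarrow> F il dl)
      = (\<Sum>p\<in>?S. case ?f p of (il, dl) \<Rightarrow> F il dl)"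
    by (rule sum.reindex_bij_betw[symmetric])
  also have "\<dots> = (\<Sum>x\<in>{1..<D}. \<Sum>a<r. \<Sum>(il, dl)\<in>chain_data x (r
      - Suc a). F (il @ [Suc a]) (dl @ [x]))"
    by (simp add: sum.Sigma finite_chain_data case_prod_unfold)
  finally show ?thesis .
qed

definition geom_prod :: "nat list \<Rightarrow> nat list \<Rightarrow> rat fps" where
  "geom_prod il dl = (\<Prod>j<length il. fps_const (1 / fact (il ! j)) * geom (dl ! j) ^ (il ! j))"

lemma geom_prod_snoc:
  "length il = length dl \<Longrightarrow>
   geom_prod (il @ [b]) (dl @ [x]) = geom_prod il dl * (fps_const (1 / fact b) * geom x ^ b)"
  unfolding geom_prod_def by (auto simp: nth_append intro!: prod.cong arg_cong2[where f = "(*)"])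

lemma distrib_if:
  "(\<Sum>a\<in>A. \<Sum>(i, d)\<in>S a. c * (if P a then B a * F a i d else 0)) =
   (c * (\<Sum>a\<in>A. if P a then B a * (\<Sum>(i, d)\<in>S a. F a i d) else 0) :: 'a::comm_ring_1)"
  unfolding sum_distrib_left by (intro sum.cong refl) (simp add: sum_distrib_left
      case_prod_unfold)

text \<open>Both sides satisfy the same recursion: removing the largest index with its block
  produces the gap factor and the block condition by \<open>jump_prod_snoc\<close>.\<close>

lemma g_trunc_eq_sum_chain_data:
  assumes "\<forall>k\<in>set ks. 1 \<le> k"
  shows "g_trunc D l ks = (\<Sum>(il, dl)\<in>chain_data D (length ks).
     fps_const (of_nat (D - last (0 # dl)) ^ l / fact l * jump_prod il dl ks) * geom_prod il dl)"
  using assms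
proof (induction "length ks" arbitrary: D l ks rule: less_induct)
  case less
  show ?case
  proof (cases "ks = []")
    case True
    then show ?thesis by (simp add: chain_data_0 jump_prod_def geom_prod_def)
  next
    case False
    let ?r = "length ks"
    let ?c = "\<lambda>D x l. of_nat (D - x) ^ l / fact l :: rat"
    let ?one = "\<lambda>a. \<forall>s<a. ks ! s = 1"
    let ?B = "\<lambda>x a. fps_const (1 / fact (Suc a)) * geom x ^ Suc a"
    have summand: "fps_const (?c D (last (0 # dl @ [x])) l * jump_prod (il @ [Suc a]) (dl @ [x])
        ks) * geom_prod (il @ [Suc a]) (dl @ [x]) =
      fps_const (?c D x l) * (if ?one a then ?B x a * (fps_const (?c x (last (0 # dl)) (ks ! a
          - 1) * jump_prod il dl (drop (Suc a) ks)) * geom_prod il dl) else 0)"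
      if "a < ?r" "(il, dl) \<in> chain_data x (?r - Suc a)" for x a il dl
    proof -
      have 1: "length il = length dl" "\<forall>n\<in>set il. 1 \<le> n" "length ks = sum_list il + Suc a"
        using that by (auto simp: chain_data_def)
      have 2: "last (0 # dl) \<le> x"
        using that by (auto simp: chain_data_def intro: less_imp_le)
      have 3: "last (0 # dl @ [x]) = x" by simp
      note * = 3 jump_prod_snoc[OF 1(1,2) less.prems 1(3) 2] geom_prod_snoc[OF 1(1)]
      show ?thesis
      proof (cases "?one a")
        case True
        show ?thesis unfolding * if_P[OF True] by (simp only: fps_const_mult[symmetric] mult_ac)
      next
        case False
        show ?thesis unfolding * if_not_P[OF False] by simp
      qed
    qed
    have "(\<Sum>(il, dl)\<in>chain_data D ?r. fps_const (?c D (last (0 # dl)) l * jump_prod il dl ks) *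
        geom_prod il dl) =
      (\<Sum>x\<in>{1..<D}. \<Sum>a<?r. \<Sum>(il, dl)\<in>chain_data x (?r - Suc a).
        fps_const (?c D x l) * (if ?one a then ?B x a * (fps_const (?c x (last (0 # dl)) (ks ! a
            - 1) * jump_prod il dl (drop (Suc a) ks)) * geom_prod il dl) else 0))"
    proof (subst sum_chain_data, use False in simp, intro sum.cong refl)
      fix x a p assume "a \<in> {..<?r}" "p \<in> chain_data x (?r - Suc a)"
      then show "(case p of (il, dl) \<Rightarrow> fps_const (?c D (last (0 # dl @ [x])) l * jump_prod (il @
          [Suc a]) (dl @ [x]) ks) * geom_prod (il @ [Suc a]) (dl @ [x])) =
        (case p of (il, dl) \<Rightarrow> fps_const (?c D x l) * (if ?one a then ?B x a * (fps_const (?c x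
            (last (0 # dl)) (ks ! a - 1) * jump_prod il dl (drop (Suc a) ks)) * geom_prod il dl)
            else 0))"
        by (cases p) (simp only: case_prod_conv lessThan_iff summand)
    qed
    also have "\<dots> = (\<Sum>x\<in>{1..<D}. fps_const (?c D x l) * (\<Sum>a<?r. if ?one a then ?B x a *
        (\<Sum>(il, dl)\<in>chain_data x (?r - Suc a). fps_const (?c x (last (0 # dl)) (ks ! a
            - 1) * jump_prod il dl (drop (Suc a) ks)) * geom_prod il dl) else 0))"
      by (intro sum.cong refl distrib_if)
    also have "\<dots> = (\<Sum>x\<in>{1..<D}. fps_const (?c D x l) * (\<Sum>a<?r.
        if ?one a then ?B x a * g_trunc x (ks ! a - 1) (drop (Suc a) ks) else 0))"
    proof -
      have "g_trunc x (ks ! a - 1) (drop (Suc a) ks) = (\<Sum>(il, dl)\<in>chain_data x (?r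
          - Suc a). fps_const (?c x (last (0 # dl)) (ks ! a - 1) * jump_prod il dl (drop (Suc a)
          ks)) * geom_prod il dl)" if "a < ?r" for a x
        using less.hyps[of "drop (Suc a) ks" x "ks ! a - 1"] less.prems that
            by (simp add: in_set_dropD Ball_def del: last.simps)
      then show ?thesis by (auto intro!: sum.cong simp del: last.simps)
    qed
    also have "\<dots> = g_trunc D l ks"
      unfolding g_trunc_nonempty[OF False] blocks_eq_sum by simp
    finally show ?thesis by simp
  qed
qed

section \<open>Coefficients of the defining generating series\<close>

definition index_monom :: "nat list \<Rightarrow> (nat \<Rightarrow>\<^sub>0 nat)" where
  "index_monom ks = (\<Sum>i<length ks. Poly_Mapping.single (Suc i) (ks ! i - 1))"

lemma lookup_index_monom:
  "Poly_Mapping.lookup (index_monom ks) s = (if 1 \<le> s \<and> s \<le> length ks then ks ! (s - 1)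
      - 1 else 0)"
proof -
  have "Poly_Mapping.lookup (index_monom ks) s = (\<Sum>i<length ks. if Suc i = s then ks ! i
      - 1 else 0)"
    by (auto simp: index_monom_def lookup_sum lookup_single when_def intro!: sum.cong)
  also have "\<dots> = (if 1 \<le> s \<and> s \<le> length ks then ks ! (s - 1) - 1 else 0)"
    by (cases s) auto
  finally show ?thesis .
qed

lemma keys_index_monom: "Poly_Mapping.keys (index_monom ks) \<subseteq> {1..length ks}"
  by (auto simp: in_keys_iff lookup_index_monom split: if_splits)

definition g_sh_args :: "nat \<Rightarrow> nat list \<Rightarrow> rat fps mfps list" where
  "g_sh_args r il = map (\<lambda>j. mfps_X (r - sum_list (take j il)) - mfps_X (r
      - sum_list (take (Suc j) il))) [0..<length il]"

lemma H_ser_summand_coeff: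
  fixes ks :: "nat list"
  shows "mfps_coeff (\<Prod>j<length il. mfps_exp (of_nat (dl ! j) * g_sh_args (length ks) il ! j) *
       mfps_const ((fps_X ^ (dl ! j) / (1 - fps_X ^ (dl ! j))) ^ (il ! j))) (index_monom ks) =
     fps_const (jump_prod il dl ks) * (\<Prod>j<length il. geom (dl ! j) ^ (il ! j))"
proof -
  let ?r = "length ks" and ?m = "length il"
  let ?Y = "\<lambda>j. of_nat (dl ! j) * g_sh_args ?r il ! j"
  have Y: "?Y j = linear_form ?r (\<lambda>s. of_nat (dl ! j) * ((if s = ?r
      - sum_list (take j il) then 1 else 0) -
      (if s = ?r - sum_list (take (Suc j) il) then 1 else 0)))" if "j < ?m" for j
    using that by (simp add: g_sh_args_def mfps_X_eq_linear_form[of _ ?r] linear_form_lin)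
  have "(\<Sum>j<?m. ?Y j) = linear_form ?r (jump ?r il dl)"
    by (simp add: Y linear_form_lin jump_def[abs_def])
  then have "(\<Prod>j<?m. mfps_exp (?Y j)) = mfps_exp (linear_form ?r (jump ?r il dl))"
    by (subst prod_mfps_exp) (auto simp: Y intro: homogeneous_linear_form[unfolded One_nat_def])
  then have "mfps_coeff (\<Prod>j<?m. mfps_exp (?Y j) * mfps_const (geom (dl ! j) ^ (il ! j)))
      (index_monom ks) =
     (\<Prod>j<?m. geom (dl ! j) ^ (il ! j)) * mfps_coeff (mfps_exp (linear_form ?r (jump ?r il dl)))
         (index_monom ks)"
    by (simp add: prod.distrib prod_mfps_const mult.commute[of "mfps_exp _"])
  also have "mfps_coeff (mfps_exp (linear_form ?r (jump ?r il dl))) (index_monom ks)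
      = fps_const (jump_prod il dl ks)"
  proof -
    have "(\<Prod>s = 1..?r. jump ?r il dl s ^ Poly_Mapping.lookup (index_monom ks) s / fact
        (Poly_Mapping.lookup (index_monom ks) s)) = jump_prod il dl ks"
      unfolding jump_prod_def by (rule prod.reindex_bij_witness[of _ Suc "\<lambda>s. s
          - 1"]) (auto simp: lookup_index_monom)
    then show ?thesis by (simp only: mfps_coeff_exp_linear_form[OF keys_index_monom])
  qed
  finally show ?thesis by (simp only: geom_def mult.commute)
qed

text \<open>A chain containing an index \<open>x > n\<close> contributes a multiple of
  \<open>q^(n+1)\<close>, because every exponent in \<open>il\<close> is positive. This truncates
  the infinite sum.\<close>

lemma H_ser_coeff_nth:
  assumes "\<forall>a\<in>set il. 1 \<le> a" and "n \<le> N"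
  shows "mfps_coeff (H_ser il (g_sh_args (length ks) il)) (index_monom ks) $ n =
    (\<Sum>dl | length dl = length il \<and> sorted_wrt (<) (0 # dl) \<and> (\<forall>x\<in>set dl. x < Suc N).
      (fps_const (jump_prod il dl ks) * (\<Prod>j<length il. geom (dl ! j) ^ (il ! j))) $ n)"
proof -
  let ?A = "{dl. length dl = length il \<and> sorted_wrt (<) (0 # dl)}"
  let ?f = "\<lambda>dl. fps_const (jump_prod il dl ks) * (\<Prod>j<length il. geom (dl ! j) ^ (il ! j))"
  have zero: "?f dl $ n = 0" if "length dl = length il" "x \<in> set dl" "n < x" for dl x n
  proof -
    from that(1,2) obtain j where j: "j < length il" "dl ! j = x"
      by (auto simp: in_set_conv_nth)
    have "(\<Prod>j<length il. geom (dl ! j) ^ (il ! j)) $ n = 0"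
    proof (rule prod_fps_nth_zero)
      fix i assume "i \<le> n"
      moreover have "1 \<le> il ! j" using assms(1) j(1) by simp
      ultimately show "(geom (dl ! j) ^ (il ! j)) $ i = 0"
        using j(2) that(3) by (intro geom_power_nth_zero) simp_all
    qed (use j in simp_all)
    then show ?thesis by simp
  qed
  have fin: "finite {dl. length dl = length il \<and> sorted_wrt (<) (0 # dl)
      \<and> (\<forall>x\<in>set dl. x < Suc N)}" for N
    by (rule finite_subset[OF _ finite_lists_length_eq[of "{..<Suc N}" "length il"]]) auto
  have 1: "mfps_coeff (H_ser il (g_sh_args (length ks) il)) (index_monom ks) = infsum ?f ?A"
    by (simp add: H_ser_def Abs_mfps_inverse H_ser_summand_coeff)
  have 2: "infsum ?f ?A $ n = (\<Sum>dl | length dl = length il \<and> sorted_wrt (<) (0 # dl)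
      \<and> (\<forall>x\<in>set dl. x < Suc N). ?f dl $ n)"
  proof (rule infsum_fps_nth)
    fix m show "finite {dl \<in> ?A. ?f dl $ m \<noteq> 0}"
    proof (rule finite_subset[OF _ fin[of m]], rule subsetI)
      fix dl assume "dl \<in> {dl \<in> ?A. ?f dl $ m \<noteq> 0}"
      moreover from this have "x < Suc m" if "x \<in> set dl" for x
        using zero[of dl x m] that by (simp only: mem_Collect_eq) (metis not_less_eq)
      ultimately show "dl \<in> {dl. length dl = length il \<and> sorted_wrt (<) (0 # dl)
          \<and> (\<forall>x\<in>set dl. x < Suc m)}"
        by (simp only: mem_Collect_eq) blast
    qed
  next
    show "{dl \<in> ?A. ?f dl $ n \<noteq> 0} \<subseteq> {dl. length dl = length il \<and> sorted_wrt (<) (0 # dl)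
        \<and> (\<forall>x\<in>set dl. x < Suc N)}"
    proof (rule subsetI)
      fix dl assume "dl \<in> {dl \<in> ?A. ?f dl $ n \<noteq> 0}"
      moreover from this have "x < Suc N" if "x \<in> set dl" for x
        using zero[of dl x n] that assms(2) by (simp only: mem_Collect_eq) (metis le_imp_less_Suc
            le_trans not_less)
      ultimately show "dl \<in> {dl. length dl = length il \<and> sorted_wrt (<) (0 # dl)
          \<and> (\<forall>x\<in>set dl. x < Suc N)}"
        by (simp only: mem_Collect_eq) blast
    qed
  next
    show "finite {dl. length dl = length il \<and> sorted_wrt (<) (0 # dl) \<and> (\<forall>x\<in>set dl. x < Suc N)}"
      by (rule fin)
  next
    show "{dl. length dl = length il \<and> sorted_wrt (<) (0 # dl) \<and> (\<forall>x\<in>set dl. x < Suc N)} \<subseteq> ?A"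
      by blast
  qed
  show ?thesis unfolding 1 by (rule 2)
qed

lemma sum_Sigma_Sigma:
  assumes "finite A" "\<And>m. finite (I m)" "\<And>m. finite (D m)"
  shows "(\<Sum>m\<in>A. \<Sum>x\<in>I m. \<Sum>y\<in>D m. F x y) =
    (\<Sum>(m, x, y)\<in>(SIGMA m:A. SIGMA x:I m. D m). F x y :: 'a::comm_monoid_add)"
  using assms by (simp add: sum.Sigma)

text \<open>The number of blocks is the length of the composition, so the truncated triple sum is a
  single sum over \<open>chain_data\<close>, evaluated by \<open>g_trunc_eq_sum_chain_data\<close>
  with \<open>l = 0\<close>.\<close>

lemma g_sh_nth:
  assumes "\<forall>k\<in>set ks. 1 \<le> k" and "n \<le> N"
  shows "g_sh ks $ n = g_trunc (Suc N) 0 ks $ n"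
proof (cases "ks = []")
  case True
  then show ?thesis by (simp add: g_sh_def)
next
  case False
  let ?r = "length ks"
  let ?I = "\<lambda>m. {il. length il = m \<and> (\<forall>a\<in>set il. 1 \<le> a) \<and> sum_list il = ?r}"
  let ?D = "\<lambda>m. {dl. length dl = m \<and> sorted_wrt (<) (0 # dl) \<and> (\<forall>x\<in>set dl. x < Suc N)}"
  let ?F = "\<lambda>il dl. (fps_const (jump_prod il dl ks) * geom_prod il dl) $ n"
  have len: "length xs \<le> sum_list xs" if "\<forall>n\<in>set xs. 1 \<le> n" for xs :: "nat list"
    using that by (induction xs) auto
  have fin: "finite (?D m)" for m
    by (rule finite_subset[OF _ finite_lists_length_eq[of "{..<Suc N}" m]]) auto
  have finI: "finite (?I m)" for m
    by (rule finite_subset[OF _ finite_lists_length_eq[of "{..?r}" m]]) (auto dest: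
        member_le_sum_list)
  have 1: "mfps_coeff (mfps_const (fps_const (1 / (\<Prod>j<m. fact (il ! j)))) *
     H_ser il (map (\<lambda>j. mfps_X (?r - sum_list (take j il)) - mfps_X (?r
         - sum_list (take (Suc j) il))) [0..<m])) (index_monom ks) $ n
     = (\<Sum>dl\<in>?D m. ?F il dl)" if "il \<in> ?I m" for m il
  proof -
    have m: "m = length il" and ge: "\<forall>a\<in>set il. 1 \<le> a" using that by auto
    have "1 / (\<Prod>j<length il. fact (il ! j)) = (\<Prod>j<length il. 1 / fact (il ! j) :: rat)"
      by (simp add: prod_dividef)
    moreover have "(\<Prod>j\<in>A. fps_const (f j)) = fps_const (\<Prod>j\<in>A. f j :: rat)" for f and A :: "nat
        set"
      by (induction A rule: infinite_finite_induct) simp_all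
    ultimately have *: "geom_prod il dl = fps_const (1 / (\<Prod>j<length il. fact (il ! j))) *
        (\<Prod>j<length il. geom (dl ! j) ^ (il ! j))" for dl
      by (simp add: geom_prod_def prod.distrib)
    show ?thesis
      unfolding m mfps_coeff_const_mult fps_mult_left_const_nth g_sh_args_def[symmetric]
          H_ser_coeff_nth[OF ge assms(2)] *
      by (simp add: sum_distrib_left mult_ac)
  qed
  have "g_sh ks $ n = (\<Sum>m = 1..?r. \<Sum>il\<in>?I m. \<Sum>dl\<in>?D m. ?F il dl)"
    unfolding g_sh_def g_sh_gen_def if_not_P[OF False] index_monom_def[symmetric] mfps_coeff_sum
        fps_sum_nth
    by (rule sum.cong[OF refl sum.cong[OF refl 1]])
  also have "\<dots> = (\<Sum>(m, il, dl)\<in>(SIGMA m:{1..?r}. SIGMA il:?I m. ?D m). ?F il dl)"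
    by (rule sum_Sigma_Sigma[OF finite_atLeastAtMost finI fin])
  also have "\<dots> = (\<Sum>(il, dl)\<in>chain_data (Suc N) ?r. ?F il dl)"
  proof (rule sum.reindex_bij_witness[of _ "\<lambda>(il, dl). (length il, il, dl)" "\<lambda>(m, il, dl). (il,
      dl)"])
    fix p assume p: "p \<in> chain_data (Suc N) ?r"
    obtain il dl where p': "p = (il, dl)" by fastforce
    have "il \<noteq> []" using p p' False by (auto simp: chain_data_def)
    then show "(case p of (il, dl) \<Rightarrow> (length il, il, dl)) \<in> (SIGMA m:{1..?r}. SIGMA il:?I m. ?D
        m)"
      using p p' len[of il] by (auto simp: chain_data_def Suc_le_eq)
  qed (auto simp: chain_data_def)
  also have "\<dots> = g_trunc (Suc N) 0 ks $ n"
    unfolding g_trunc_eq_sum_chain_data[OF assms(1)] fps_sum_nth by (simp add: case_prod_unfold)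
  finally show ?thesis .
qed

section \<open>Conjugation and quasi-shuffle products of nested sums\<close>

text \<open>Congruence modulo \<open>q^(N+1)\<close>.\<close>

definition fps_agree :: "nat \<Rightarrow> rat fps \<Rightarrow> rat fps \<Rightarrow> bool" where
  "fps_agree N f g \<longleftrightarrow> (\<forall>n\<le>N. f $ n = g $ n)"

lemma fps_agree_refl [simp]: "fps_agree N f f"
  by (simp add: fps_agree_def)

lemma fps_agree_trans [trans]: "fps_agree N f g \<Longrightarrow> fps_agree N g h \<Longrightarrow> fps_agree N f h"
  by (simp add: fps_agree_def)

lemma fps_agree_sym: "fps_agree N f g \<Longrightarrow> fps_agree N g f"
  by (simp add: fps_agree_def)

lemma fps_agree_eq_trans [trans]:
  "f = g \<Longrightarrow> fps_agree N g h \<Longrightarrow> fps_agree N f h"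
  "fps_agree N f g \<Longrightarrow> g = h \<Longrightarrow> fps_agree N f h"
  by simp_all

lemma fps_agree_add: "fps_agree N f f' \<Longrightarrow> fps_agree N g g' \<Longrightarrow> fps_agree N (f + g) (f' + g')"
  by (simp add: fps_agree_def)

lemma fps_agree_mult: "fps_agree N f f' \<Longrightarrow> fps_agree N g g' \<Longrightarrow> fps_agree N (f * g) (f' * g')"
  by (auto simp: fps_agree_def fps_mult_nth intro!: sum.cong)

lemma fps_agree_sum: "(\<And>x. x \<in> A \<Longrightarrow> fps_agree N (f x) (g x)) \<Longrightarrow> fps_agree N (sum f A) (sum g A)"
  by (induction A rule: infinite_finite_induct) (auto intro: fps_agree_add)

section \<open>Lambert series in one summation index, and chain sums of them\<close>

definition divisor_fps :: "(nat \<Rightarrow> rat) \<Rightarrow> nat \<Rightarrow> rat fps" where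
  "divisor_fps h x = Abs_fps (\<lambda>n. if x dvd n \<and> n > 0 then h (n div x) else 0)"

lemma divisor_fps_nth: "divisor_fps h x $ n = (if x dvd n \<and> n > 0 then h (n div x) else 0)"
  by (simp add: divisor_fps_def)

lemma divisor_fps_agree:
  assumes "x > 0"
  shows "fps_agree N (divisor_fps h x) (\<Sum>n\<in>{1..N}. fps_const (h n) * fps_X ^ (n * x))"
  unfolding fps_agree_def
proof (intro allI impI)
  fix j assume j: "j \<le> N"
  have "(\<Sum>n\<in>{1..N}. fps_const (h n) * fps_X ^ (n * x)) $ j = (\<Sum>n\<in>{1..N}. if n * x
      = j then h n else 0)"
    by (auto simp: fps_sum_nth intro!: sum.cong)
  also have "\<dots> = divisor_fps h x $ j"
  proof (cases "x dvd j \<and> j > 0")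
    case True
    then obtain n where n: "j = n * x" by (metis dvdE mult.commute)
    have "n \<noteq> 0" using n True by auto
    moreover have "n \<le> n * x" using assms by simp
    ultimately have "n \<in> {1..N}" using j n le_trans[of n "n * x" N] by simp
    moreover have "(n' * x = j) = (n' = n)" for n' using assms n by simp
    ultimately show ?thesis using n assms True by (simp add: divisor_fps_nth)
  next
    case False
    then have *: "n * x \<noteq> j" if "n \<in> {1..N}" for n using that assms by auto
    have "(\<Sum>n\<in>{1..N}. if n * x = j then h n else 0) = 0"
      by (rule sum.neutral) (use * in simp)
    with False show ?thesis by (simp only: divisor_fps_nth if_False)
  qed
  finally show "divisor_fps h x $ j = (\<Sum>n\<in>{1..N}. fps_const (h n) * fps_X ^ (n * x)) $ j" ..
qed

lemma geom_eq_divisor_fps: "x > 0 \<Longrightarrow> geom x = divisor_fps (\<lambda>n. 1) x"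
  by (rule fps_ext) (auto simp: geom_nth divisor_fps_nth)

text \<open>There are \<open>k - 1\<close> ordered ways to write \<open>k\<close> as a sum of two
  positive integers.\<close>

lemma geom_power2_eq_divisor_fps:
  assumes "x > 0"
  shows "geom x ^ 2 = divisor_fps (\<lambda>n. of_nat n - 1) x"
proof (rule fps_ext)
  fix n
  have "(geom x ^ 2) $ n = (\<Sum>i=0..n. if 0 < i \<and> x dvd i \<and> 0 < n - i \<and> x dvd n - i then 1 else 0)"
    by (auto simp: power2_eq_square fps_mult_nth geom_nth assms intro!: sum.cong)
  also have "\<dots> = of_nat (card {i\<in>{0..n}. 0 < i \<and> x dvd i \<and> 0 < n - i \<and> x dvd n - i})"
    by (simp flip: sum.inter_filter)
  also have "\<dots> = divisor_fps (\<lambda>n. of_nat n - 1) x $ n"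
  proof (cases "x dvd n \<and> n > 0")
    case True
    then obtain k where k: "n = x * k" by blast
    with True assms have "k > 0" by simp
    have "{i\<in>{0..n}. 0 < i \<and> x dvd i \<and> 0 < n - i \<and> x dvd n - i} = (\<lambda>j. x * j) ` {1..<k}"
      using assms by (auto simp: k image_iff diff_mult_distrib2[symmetric] elim!: dvdE)
    then have "card {i\<in>{0..n}. 0 < i \<and> x dvd i \<and> 0 < n - i \<and> x dvd n - i} = card {1..<k}"
      using assms by (simp add: card_image inj_on_def)
    with True k assms \<open>k > 0\<close> show ?thesis by (simp add: divisor_fps_nth of_nat_diff)
  next
    case False
    then have "{i\<in>{0..n}. 0 < i \<and> x dvd i \<and> 0 < n - i \<and> x dvd n - i} = {}"
      by (auto dest: dvd_diffD[OF _ _ less_imp_le])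
    with False show ?thesis by (simp only: divisor_fps_nth) simp
  qed
  finally show "(geom x ^ 2) $ n = divisor_fps (\<lambda>n. of_nat n - 1) x $ n" .
qed

text \<open>As \<^const>\<open>g_trunc\<close>, but without the choice of blocks and with \<open>Q(x)\<close> replaced by
  \<open>\<Sum>\<^sub>n h(n) q\<^bsup>nx\<^esup>\<close>. The weight \<open>h(n) = (n - 1) / 2\<close> comes from a block of two letters, since
  \<open>Q(x)\<^sup>2 / 2! = \<Sum>\<^sub>n (n - 1) / 2 q\<^bsup>nx\<^esup>\<close>.\<close>

fun chain_sum :: "nat \<Rightarrow> nat \<Rightarrow> ((nat \<Rightarrow> rat) \<times> nat) list \<Rightarrow> rat fps" where
  "chain_sum D l [] = fps_const (of_nat D ^ l / fact l)"
| "chain_sum D l ((h, k) # ps) =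
     (\<Sum>x\<in>{1..<D}. fps_const (of_nat (D - x) ^ l / fact l) * divisor_fps h x * chain_sum x (k
         - 1) ps)"

abbreviation unweighted :: "nat list \<Rightarrow> ((nat \<Rightarrow> rat) \<times> nat) list" where
  "unweighted ks \<equiv> map (Pair (\<lambda>_. 1)) ks"

text \<open>A block of several letters has to start at an entry 1 that is not the last one, so here
  every block is a single letter.\<close>

lemma g_trunc_eq_chain_sum:
  assumes "1 \<notin> set (butlast ks)"
  shows "g_trunc D l ks = chain_sum D l (unweighted ks)"
  using assms
proof (induction ks arbitrary: D l)
  case (Cons k ks)
  have 1: "1 \<notin> set (butlast ks)" and 2: "k \<noteq> 1 \<or> ks = []"
    using Cons.prems by (auto split: if_splits)
  have "blocks f (g_trunc x) (k # ks) = f 0 * g_trunc x (k - 1) ks" for f x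
    using 2 by auto
  then show ?case
    by (simp add: g_trunc_nonempty Cons.IH[OF 1] geom_eq_divisor_fps mult.assoc del: blocks.simps)
qed simp

text \<open>The only longer block joins the entry 1 with its successor \<open>k\<close>; the second
  hypothesis keeps it from extending further. The first sum has only single-letter blocks, the
  second uses this pair.\<close>

lemma g_trunc_eq_chain_sum_single_1:
  assumes "1 \<notin> set pre" and "1 \<notin> set (butlast (k # post))"
  shows "g_trunc D l (pre @ 1 # k # post) = chain_sum D l (unweighted (pre @ 1 # k # post))
     + chain_sum D l (unweighted pre @ (\<lambda>n. (of_nat n - 1) / 2, k) # unweighted post)"
  using assms(1)
proof (induction pre arbitrary: D l)
  case Nil
  have 2: "k \<noteq> 1 \<or> post = []" and 3: "1 \<notin> set (butlast post)" using assms(2) by (auto split: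
      if_splits)
  have "blocks f (g_trunc x) (1 # k # post) = f 0 * g_trunc x 0 (k # post) + f 1 * g_trunc x (k
      - 1) post" for f x
    using 2 by auto
  moreover have "fps_const (1 / fact (Suc 1)) * geom x ^ Suc 1 = divisor_fps (\<lambda>n. (of_nat n
      - 1) / 2) x" if "x > 0" for x
    using geom_power2_eq_divisor_fps[OF that]
    by (auto simp: numeral_2_eq_2[symmetric] fps_eq_iff divisor_fps_nth)
  ultimately show ?case
    using g_trunc_eq_chain_sum[OF assms(2)] g_trunc_eq_chain_sum[OF 3]
    by (simp add: g_trunc_nonempty geom_eq_divisor_fps sum.distrib algebra_simps del:
        blocks.simps)
next
  case (Cons j pre)
  then have "blocks f (g_trunc x) (j # pre @ 1 # k # post) = f 0 * g_trunc x (j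
      - 1) (pre @ 1 # k # post)" for f x
    by auto
  with Cons show ?case
    by (simp add: g_trunc_nonempty geom_eq_divisor_fps sum.distrib algebra_simps del:
        blocks.simps)
qed

section \<open>Conjugation of chain sums into nested sums\<close>

definition polylog :: "nat \<Rightarrow> nat \<Rightarrow> rat fps" where
  "polylog k u = divisor_fps (\<lambda>v. of_nat v ^ (k - 1) / fact (k - 1)) u"

lemma polylog_nth_zero: "n < u \<Longrightarrow> polylog k u $ n = 0"
  by (auto simp: polylog_def divisor_fps_nth dest: dvd_imp_le)

text \<open>The nested sum over \<open>m < u\<^sub>1 < u\<^sub>2 < \<dots>\<close> in disguise: writing \<open>n\<^sub>i = u\<^sub>i - u\<^bsub>i-1\<^esub>\<close> with \<open>u\<^sub>0 = m\<close> and
  \<open>d\<^sub>i = v\<^sub>i + v\<^bsub>i+1\<^esub> + \<dots>\<close>, one has \<open>\<Sum>\<^sub>i u\<^sub>i v\<^sub>i = m d\<^sub>1 + \<Sum>\<^sub>i n\<^sub>i d\<^sub>i\<close>.\<close>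

definition dual_sum :: "nat \<Rightarrow> nat \<Rightarrow> ((nat \<Rightarrow> rat) \<times> nat) list \<Rightarrow> rat fps" where
  "dual_sum N m ps = (case ps of [] \<Rightarrow> 1 | (h, k) # ps' \<Rightarrow>
     (\<Sum>x\<in>{1..N}. fps_X ^ (m * x) * divisor_fps h x * chain_sum x (k - 1) ps'))"

lemma chain_sum_eq_dual_sum: "chain_sum (Suc N) 0 ps = dual_sum N 0 ps"
  by (cases ps) (auto simp: dual_sum_def atLeastLessThanSuc_atLeastAtMost)

lemma shifted_polylog_agree:
  assumes "u > 0" "y > 0"
  shows "fps_agree N (fps_X ^ (u * y) * polylog k u)
    (\<Sum>x\<in>{y<..N}. fps_const (of_nat (x - y) ^ (k - 1) / fact (k - 1)) * fps_X ^ (u * x))"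
  unfolding fps_agree_def
proof (intro allI impI)
  fix j assume j: "j \<le> N"
  let ?c = "\<lambda>v. of_nat v ^ (k - 1) / fact (k - 1) :: rat"
  have "(\<Sum>x\<in>{y<..N}. fps_const (?c (x - y)) * fps_X ^ (u * x)) $ j = (\<Sum>x\<in>{y<..N}. if u * x
      = j then ?c (x - y) else 0)"
    by (auto simp: fps_sum_nth intro!: sum.cong)
  also have "\<dots> = (fps_X ^ (u * y) * polylog k u) $ j"
  proof (cases "u dvd j \<and> u * y < j")
    case True
    then obtain x where x: "j = u * x" by blast
    with True assms have "y < x" by simp
    moreover have "x \<le> u * x" using assms by simp
    with j x have "x \<le> N" using le_trans[of x "u * x" N] by simp
    moreover have "(u * x' = j) = (x' = x)" for x' using assms x by simp
    moreover have "polylog k u $ (u * x - u * y) = ?c (x - y)"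
      using \<open>y < x\<close> assms by (simp add: polylog_def divisor_fps_nth flip: diff_mult_distrib2)
    ultimately show ?thesis using True x by (simp add: fps_X_power_mult_nth)
  next
    case False
    have "u * x \<noteq> j" if "x \<in> {y<..N}" for x using that False assms by auto
    then have "(\<Sum>x\<in>{y<..N}. if u * x = j then ?c (x - y) else 0) = 0"
      by (intro sum.neutral ballI if_not_P) blast
    moreover have "polylog k u $ (j - u * y) = 0"
    proof (cases "u dvd j - u * y \<and> 0 < j - u * y")
      case True
      then have "u dvd j" by (metis dvd_diffD dvd_triv_left less_imp_le zero_less_diff)
      with True False show ?thesis by simp
    next
      case False
      then show ?thesis by (auto simp: polylog_def divisor_fps_nth)
    qed
    ultimately show ?thesis by (simp add: fps_X_power_mult_nth)
  qed
  finally show "(fps_X ^ (u * y) * polylog k u) $ j = (\<Sum>x\<in>{y<..N}. fps_const (?c (x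
      - y)) * fps_X ^ (u * x)) $ j" ..
qed

text \<open>With the next index \<open>y\<close> fixed, the outermost index is
  \<open>x = y + v\<close>. Summing over the gap \<open>v\<close> gives \<open>polylog k u\<close>,
  and the remaining power \<open>q^(u y)\<close> is the one built into
  \<open>dual_sum N u\<close>.\<close>

lemma generating_chain_sum_agree:
  assumes "u > 0"
  shows "fps_agree N (\<Sum>x\<in>{1..N}. fps_X ^ (u * x) * chain_sum x (k
      - 1) ps) (polylog k u * dual_sum N u ps)"
proof (cases ps)
  case Nil
  then show ?thesis
    using divisor_fps_agree[OF assms, of N "\<lambda>v. of_nat v ^ (k - 1) / fact (k - 1)"]
    by (simp add: dual_sum_def polylog_def mult.commute fps_agree_sym)
next
  case (Cons p ps')
  obtain h k' where p: "p = (h, k')" by fastforce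
  let ?c = "\<lambda>v. fps_const (of_nat v ^ (k - 1) / fact (k - 1)) :: rat fps"
  let ?T = "\<lambda>y. divisor_fps h y * chain_sum y (k' - 1) ps'"
  have "(\<Sum>x\<in>{1..N}. fps_X ^ (u * x) * chain_sum x (k - 1) ps) =
      (\<Sum>x\<in>{1..N}. \<Sum>y\<in>{1..<x}. ?c (x - y) * fps_X ^ (u * x) * ?T y)"
    by (simp add: Cons p sum_distrib_left mult_ac)
  also have "\<dots> = (\<Sum>y\<in>{1..N}. \<Sum>x\<in>{y<..N}. ?c (x - y) * fps_X ^ (u * x) * ?T y)"
    by (simp add: sum.Sigma, rule sum.reindex_bij_witness[of _ prod.swap prod.swap]) auto
  also have "fps_agree N \<dots> (\<Sum>y\<in>{1..N}. fps_X ^ (u * y) * polylog k u * ?T y)"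
    unfolding sum_distrib_right[symmetric]
    by (intro fps_agree_sum fps_agree_mult fps_agree_refl fps_agree_sym[OF
        shifted_polylog_agree[OF assms]]) simp
  also have "(\<Sum>y\<in>{1..N}. fps_X ^ (u * y) * polylog k u * ?T y) = polylog k u * dual_sum N u ps"
    by (simp add: dual_sum_def Cons p sum_distrib_left mult_ac)
  finally show ?thesis .
qed

text \<open>Expanding the series of \<open>h\<close> turns the power of \<open>q\<close> into
  \<open>q^((m + n) x)\<close>; the new summation index is \<open>u = m + n\<close>, and
  \<open>generating_chain_sum_agree\<close> carries out the sum over \<open>x\<close>.\<close>

lemma dual_sum_Cons_agree:
  "fps_agree N (dual_sum N m ((h, k) # ps)) (\<Sum>u\<in>{m<..N}. fps_const (h (u
      - m)) * (polylog k u * dual_sum N u ps))"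
proof -
  have "dual_sum N m ((h, k) # ps) = (\<Sum>x\<in>{1..N}. fps_X ^ (m * x) * divisor_fps h x * chain_sum x
      (k - 1) ps)"
    by (simp add: dual_sum_def)
  also have "fps_agree N \<dots> (\<Sum>x\<in>{1..N}. fps_X ^ (m * x) * (\<Sum>n\<in>{1..N}. fps_const (h n) * fps_X ^ (n
      * x)) * chain_sum x (k - 1) ps)"
    by (intro fps_agree_sum fps_agree_mult fps_agree_refl divisor_fps_agree) simp
  also have "(\<Sum>x\<in>{1..N}. fps_X ^ (m * x) * (\<Sum>n\<in>{1..N}. fps_const (h n) * fps_X ^ (n * x)) *
      chain_sum x (k - 1) ps) =
     (\<Sum>n\<in>{1..N}. fps_const (h n) * (\<Sum>x\<in>{1..N}. fps_X ^ ((m + n) * x) * chain_sum x (k - 1) ps))"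
    by (simp add: sum_distrib_left sum_distrib_right, subst sum.swap) (simp add: algebra_simps
        power_add)
  also have "fps_agree N \<dots> (\<Sum>n\<in>{1..N}. fps_const (h n) * (polylog k (m + n) * dual_sum N (m
      + n) ps))"
    by (intro fps_agree_sum fps_agree_mult fps_agree_refl generating_chain_sum_agree) simp
  also have "(\<Sum>n\<in>{1..N}. fps_const (h n) * (polylog k (m + n) * dual_sum N (m + n) ps)) =
     (\<Sum>u\<in>{m<..N+m}. fps_const (h (u - m)) * (polylog k u * dual_sum N u ps))"
    by (rule sum.reindex_bij_witness[of _ "\<lambda>u. u - m" "\<lambda>n. m + n"]) auto
  also have "fps_agree N \<dots> (\<Sum>u\<in>{m<..N}. fps_const (h (u - m)) * (polylog k u * dual_sum N u ps))"
  proof -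
    \<comment> \<open>The range can be cut at \<open>N\<close> because \<open>polylog k u\<close> is
      divisible by \<open>q^u\<close>.\<close>
    have "fps_agree N (fps_const (h (u - m)) * (polylog k u * dual_sum N u ps)) 0"
        if "u > N" for u
      using that by (auto simp: fps_agree_def intro!: fps_mult_nth_zero_left polylog_nth_zero)
    then have "fps_agree N (\<Sum>u\<in>{m<..N+m} - {m<..N}. fps_const (h (u
        - m)) * (polylog k u * dual_sum N u ps)) (\<Sum>u\<in>{m<..N+m} - {m<..N}. 0)"
      by (intro fps_agree_sum) auto
    then have "fps_agree N ((\<Sum>u\<in>{m<..N+m} - {m<..N}. fps_const (h (u
        - m)) * (polylog k u * dual_sum N u ps)) +
       (\<Sum>u\<in>{m<..N}. fps_const (h (u - m)) * (polylog k u * dual_sum N u ps)))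
       (0 + (\<Sum>u\<in>{m<..N}. fps_const (h (u - m)) * (polylog k u * dual_sum N u ps)))"
      by (intro fps_agree_add fps_agree_refl) simp
    then show ?thesis
      by (subst (asm) sum.subset_diff[symmetric]) auto
  qed
  finally show ?thesis .
qed

fun nested_sum :: "nat \<Rightarrow> nat \<Rightarrow> (nat \<Rightarrow> rat fps) list \<Rightarrow> rat fps" where
  "nested_sum M m [] = 1"
| "nested_sum M m (f # fs) = (\<Sum>u\<in>{m<..M}. f u * nested_sum M u fs)"

lemma dual_sum_unweighted_agree: "fps_agree N (dual_sum N m (unweighted ks)) (nested_sum N m (map
    polylog ks))"
proof (induction ks arbitrary: m)
  case Nil
  then show ?case by (simp add: dual_sum_def)
next
  case (Cons k ks)
  have "fps_agree N (dual_sum N m (unweighted (k # ks))) (\<Sum>u\<in>{m<..N}. fps_const 1 * (polylog k u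
      * dual_sum N u (unweighted ks)))"
    using dual_sum_Cons_agree[of N m "\<lambda>_. 1" k "unweighted ks"] by simp
  also have "fps_agree N \<dots> (\<Sum>u\<in>{m<..N}. polylog k u * nested_sum N u (map polylog ks))"
    using Cons.IH by (auto intro!: fps_agree_sum fps_agree_mult)
  finally show ?case by simp
qed

definition wpolylog :: "nat \<Rightarrow> nat \<Rightarrow> rat fps" where
  "wpolylog k u = fps_const (of_nat u) * polylog k u"

text \<open>The weight at \<open>u - m\<close> equals \<open>u / 2 - (m + 1) / 2\<close>. The second
  part stays explicit in \<open>m\<close>, which is the preceding summation index when this sum
  occurs inside a longer one.\<close>

lemma dual_sum_weighted_agree:
  "fps_agree N (dual_sum N m ((\<lambda>n. (of_nat n - 1) / 2, k) # unweighted ks))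
     (fps_const (1/2) * nested_sum N m (wpolylog k # map polylog ks) - fps_const ((of_nat m
         + 1) / 2) * nested_sum N m (polylog k # map polylog ks))"
proof -
  have "fps_agree N (dual_sum N m ((\<lambda>n. (of_nat n - 1) / 2, k) # unweighted ks))
     (\<Sum>u\<in>{m<..N}. fps_const ((of_nat (u - m) - 1) / 2) * (polylog k u * dual_sum N u (unweighted
         ks)))"
    by (rule dual_sum_Cons_agree)
  also have "fps_agree N \<dots> (\<Sum>u\<in>{m<..N}. fps_const ((of_nat (u - m)
      - 1) / 2) * (polylog k u * nested_sum N u (map polylog ks)))"
    by (intro fps_agree_sum fps_agree_mult fps_agree_refl dual_sum_unweighted_agree)
  also have "\<dots> = (\<Sum>u\<in>{m<..N}. fps_const (1/2) * (wpolylog k u * nested_sum N u (map polylog ks))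
      - fps_const ((of_nat m + 1) / 2) * (polylog k u * nested_sum N u (map polylog ks)))"
  proof (rule sum.cong[OF refl])
    fix u assume "u \<in> {m<..N}"
    then have "(of_nat (u - m) - 1) / 2 = (1/2 * of_nat u - (of_nat m + 1) / 2 :: rat)"
      by (simp add: of_nat_diff field_simps)
    then show "fps_const ((of_nat (u - m) - 1) / 2) * (polylog k u * nested_sum N u (map polylog
        ks)) =
        fps_const (1/2) * (wpolylog k u * nested_sum N u (map polylog ks)) - fps_const ((of_nat m
            + 1) / 2) * (polylog k u * nested_sum N u (map polylog ks))"
      by (simp only: fps_const_sub[symmetric] fps_const_mult[symmetric] left_diff_distrib
          wpolylog_def mult.assoc)
  qed
  finally show ?thesis by (simp add: sum_subtractf sum_distrib_left)
qed

text \<open>Now \<open>m\<close> of the previous lemma is the summation index attached to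
  \<open>j\<close>, so \<open>(m + 1) / 2\<close> becomes a \<open>wpolylog j\<close> term and a
  \<open>polylog j\<close> term.\<close>

lemma dual_sum_weighted_prefix_agree:
  "fps_agree N (dual_sum N m (unweighted (pre @ [j]) @ (\<lambda>n. (of_nat n
      - 1) / 2, k) # unweighted post))
    (fps_const (1/2) * (nested_sum N m (map polylog (pre @ [j]) @ wpolylog k # map polylog post)
       - nested_sum N m (map polylog pre @ wpolylog j # polylog k # map polylog post)
       - nested_sum N m (map polylog (pre @ [j]) @ polylog k # map polylog post)))"
proof (induction pre arbitrary: m)
  case Nil
  let ?ps = "(\<lambda>n. (of_nat n - 1) / 2, k) # unweighted post"
  let ?A = "\<lambda>u. nested_sum N u (wpolylog k # map polylog post)" and ?B
      = "\<lambda>u. nested_sum N u (polylog k # map polylog post)"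
  have "fps_agree N (dual_sum N m (unweighted [j] @ ?ps)) (\<Sum>u\<in>{m<..N}. fps_const 1 * (polylog j u
      * dual_sum N u ?ps))"
    using dual_sum_Cons_agree[of N m "\<lambda>_. 1" j ?ps] by simp
  also have "fps_agree N \<dots> (\<Sum>u\<in>{m<..N}. fps_const 1 * (polylog j u * (fps_const (1/2) * ?A u
      - fps_const ((of_nat u + 1) / 2) * ?B u)))"
    by (intro fps_agree_sum fps_agree_mult fps_agree_refl dual_sum_weighted_agree)
  also have "\<dots> = (\<Sum>u\<in>{m<..N}. fps_const (1/2) * (polylog j u * ?A u - wpolylog j u * ?B u
      - polylog j u * ?B u))"
  proof (rule sum.cong[OF refl])
    fix u
    have "fps_const ((of_nat u + 1) / 2) = fps_const (1/2) * (fps_const (of_nat u)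
        + 1 :: rat fps)"
      by (simp add: fps_const_1_eq_1[symmetric] del: fps_const_1_eq_1)
    then show "fps_const 1 * (polylog j u * (fps_const (1/2) * ?A u - fps_const ((of_nat u
        + 1) / 2) * ?B u)) =
        fps_const (1/2) * (polylog j u * ?A u - wpolylog j u * ?B u - polylog j u * ?B u)"
      by (simp only: wpolylog_def fps_const_1_eq_1 mult_1_left distrib_left distrib_right
          left_diff_distrib right_diff_distrib mult_ac mult_1_right) (simp only: algebra_simps)
  qed
  finally show ?case by (simp add: sum_subtractf sum_distrib_left right_diff_distrib)
next
  case (Cons i pre)
  let ?ps = "unweighted (pre @ [j]) @ (\<lambda>n. (of_nat n - 1) / 2, k) # unweighted post"
  have "fps_agree N (dual_sum N m (unweighted ((i # pre) @ [j]) @ (\<lambda>n. (of_nat n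
      - 1) / 2, k) # unweighted post))
     (\<Sum>u\<in>{m<..N}. fps_const 1 * (polylog i u * dual_sum N u ?ps))"
    using dual_sum_Cons_agree[of N m "\<lambda>_. 1" i ?ps] by simp
  also have "fps_agree N \<dots> (\<Sum>u\<in>{m<..N}. fps_const 1 * (polylog i u *
     (fps_const (1/2) * (nested_sum N u (map polylog (pre @ [j]) @ wpolylog k # map polylog post)
       - nested_sum N u (map polylog pre @ wpolylog j # polylog k # map polylog post)
       - nested_sum N u (map polylog (pre @ [j]) @ polylog k # map polylog post)))))"
    by (intro fps_agree_sum fps_agree_mult fps_agree_refl Cons.IH)
  finally show ?case by (simp add: sum_subtractf sum_distrib_left right_diff_distrib mult_ac)
qed

lemma fps_eqI_agree: "(\<And>N. fps_agree N f g) \<Longrightarrow> f = g"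
  by (auto simp: fps_agree_def fps_eq_iff)

section \<open>Passage to the limit, and \<open>g_sh\<close> in terms of brackets\<close>

definition q_divisible :: "(nat \<Rightarrow> rat fps) \<Rightarrow> bool" where
  "q_divisible f \<longleftrightarrow> (\<forall>u n. n < u \<longrightarrow> f u $ n = 0)"

lemma q_divisible_polylog: "q_divisible (polylog k)" and q_divisible_wpolylog: "q_divisible
    (wpolylog k)"
  by (auto simp: q_divisible_def polylog_nth_zero wpolylog_def)

lemma nested_sum_stable:
  assumes "\<forall>f\<in>set fs. q_divisible f" and "n \<le> M"
  shows "fps_agree n (nested_sum M m fs) (nested_sum n m fs)"
  using assms(1)
proof (induction fs arbitrary: m)
  case (Cons f fs)
  have "fps_agree n (nested_sum M m (f # fs)) (\<Sum>u\<in>{m<..M}. if u \<le> n then f u * nested_sum n u fs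
      else 0)"
    unfolding nested_sum.simps
  proof (rule fps_agree_sum)
    fix u
    show "fps_agree n (f u * nested_sum M u fs) (if u \<le> n then f u * nested_sum n u fs else 0)"
    proof (cases "u \<le> n")
      case True
      then show ?thesis using Cons by (auto intro: fps_agree_mult)
    next
      case False
      with Cons.prems show ?thesis by (auto simp: fps_agree_def q_divisible_def intro!:
          fps_mult_nth_zero_left)
    qed
  qed
  also have "(\<Sum>u\<in>{m<..M}. if u \<le> n then f u * nested_sum n u fs else 0) = nested_sum n m (f # fs)"
    using assms(2) by (subst sum.inter_filter[symmetric]) (auto intro!: sum.cong)
  finally show ?case .
qed simp

text \<open>The limit of the nested sums; for \<^const>\<open>q_divisible\<close> functions the bound \<open>N\<close> no longer matters for
  the coefficient of \<open>q\<^sup>N\<close>.\<close>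

definition bracket :: "(nat \<Rightarrow> rat fps) list \<Rightarrow> rat fps" where
  "bracket fs = Abs_fps (\<lambda>N. nested_sum N 0 fs $ N)"

lemma bracket_agree: "\<forall>f\<in>set fs. q_divisible f \<Longrightarrow> fps_agree N (bracket fs) (nested_sum N 0 fs)"
  using nested_sum_stable[of fs _ N 0] by (auto simp: fps_agree_def bracket_def)

lemma g_sh_agree_g_trunc:
  assumes "\<forall>k\<in>set ks. 1 \<le> k"
  shows "fps_agree N (g_sh ks) (g_trunc (Suc N) 0 ks)"
  using g_sh_nth[OF assms] by (simp add: fps_agree_def)

lemma g_sh_eq_bracket:
  assumes "\<forall>k\<in>set ks. 1 \<le> k" and "1 \<notin> set (butlast ks)"
  shows "g_sh ks = bracket (map polylog ks)"
proof (rule fps_eqI_agree)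
  fix N
  have "fps_agree N (g_sh ks) (g_trunc (Suc N) 0 ks)" by (rule g_sh_agree_g_trunc[OF assms(1)])
  also have "g_trunc (Suc N) 0 ks = dual_sum N 0 (unweighted ks)"
      using g_trunc_eq_chain_sum[OF assms(2)] by (simp add: chain_sum_eq_dual_sum)
  also have "fps_agree N \<dots> (nested_sum N 0 (map polylog ks))" by (rule dual_sum_unweighted_agree)
  also have "fps_agree N \<dots> (bracket (map polylog ks))"
    by (rule fps_agree_sym[OF bracket_agree]) (auto simp: q_divisible_polylog)
  finally show "fps_agree N (g_sh ks) (bracket (map polylog ks))" .
qed

lemma fps_agree_diff: "fps_agree N f f' \<Longrightarrow> fps_agree N g g' \<Longrightarrow> fps_agree N (f - g) (f' - g')"
  by (simp add: fps_agree_def)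

text \<open>The index before the leading 1 is \<open>u_0 = 0\<close>, so the correction has weight
  \<open>(u - 1) / 2\<close>.\<close>

lemma g_sh_leading_1:
  assumes "\<forall>k\<in>set (k # post). 1 \<le> k" and "1 \<notin> set (butlast (k # post))"
  shows "g_sh (1 # k # post) = bracket (map polylog (1 # k # post))
    + fps_const (1/2) * (bracket (wpolylog k # map polylog post) -
        bracket (polylog k # map polylog post))"
proof (rule fps_eqI_agree)
  fix N
  have "fps_agree N (g_sh (1 # k # post)) (g_trunc (Suc N) 0 (1 # k # post))"
    by (rule g_sh_agree_g_trunc) (use assms in auto)
  also have "g_trunc (Suc N) 0 (1 # k # post) = dual_sum N 0 (unweighted (1 # k # post))
      + dual_sum N 0 ((\<lambda>n. (of_nat n - 1) / 2, k) # unweighted post)"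
    using g_trunc_eq_chain_sum_single_1[of "[]" k post "Suc N" 0] assms(2)
        unfolding chain_sum_eq_dual_sum by simp
  also have "fps_agree N \<dots> (nested_sum N 0 (map polylog (1 # k # post))
      + (fps_const (1/2) * nested_sum N 0 (wpolylog k # map polylog post) - fps_const ((of_nat 0
      + 1) / 2) * nested_sum N 0 (polylog k # map polylog post)))"
    by (intro fps_agree_add dual_sum_unweighted_agree dual_sum_weighted_agree)
  also have "\<dots> = nested_sum N 0 (map polylog (1 # k # post)) + fps_const (1/2) * (nested_sum N 0
      (wpolylog k # map polylog post) - nested_sum N 0 (polylog k # map polylog post))"
    by (simp add: right_diff_distrib)
  also have "fps_agree N \<dots> (bracket (map polylog (1 # k # post))
      + fps_const (1/2) * (bracket (wpolylog k # map polylog post) -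
      bracket (polylog k # map polylog post)))"
    by (intro fps_agree_add fps_agree_mult fps_agree_diff fps_agree_refl fps_agree_sym[OF
        bracket_agree])
      (auto simp: q_divisible_polylog q_divisible_wpolylog)
  finally show "fps_agree N (g_sh (1 # k # post)) (bracket (map polylog (1 # k # post))
    + fps_const (1/2) * (bracket (wpolylog k # map polylog post) -
        bracket (polylog k # map polylog post)))" .
qed

text \<open>The correction weight involves the summation indices of both neighbours \<open>j\<close>
  and \<open>k\<close> of the removed entry, hence a \<open>wpolylog\<close> in each of these slots
  with opposite signs.\<close>

lemma g_sh_inner_1:
  assumes "\<forall>k\<in>set (pre @ j # k # post). 1 \<le> k" and "1 \<notin> set (pre @ [j])" and "1 \<notin> set (butlast (k
      # post))"
  shows "g_sh (pre @ j # 1 # k # post) = bracket (map polylog (pre @ j # 1 # k # post))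
    + fps_const (1/2) * (bracket (map polylog (pre @ [j]) @ wpolylog k # map polylog post)
       - bracket (map polylog pre @ wpolylog j # polylog k # map polylog post) -
           bracket (map polylog (pre @ j # k # post)))"
proof (rule fps_eqI_agree)
  fix N
  let ?ps = "unweighted (pre @ [j]) @ (\<lambda>n. (of_nat n - 1) / 2, k) # unweighted post"
  have "fps_agree N (g_sh (pre @ j # 1 # k # post)) (g_trunc (Suc N) 0 (pre @ j # 1 # k # post))"
    by (rule g_sh_agree_g_trunc) (use assms in auto)
  also have "g_trunc (Suc N) 0 (pre @ j # 1 # k # post) = dual_sum N 0 (unweighted (pre @ j # 1 #
      k # post)) + dual_sum N 0 ?ps"
    using g_trunc_eq_chain_sum_single_1[OF assms(2,3), of "Suc N" 0]
        unfolding chain_sum_eq_dual_sum by simp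
  also have "fps_agree N \<dots> (nested_sum N 0 (map polylog (pre @ j # 1 # k # post))
      + fps_const (1/2) *
      (nested_sum N 0 (map polylog (pre @ [j]) @ wpolylog k # map polylog post)
          - nested_sum N 0 (map polylog pre @ wpolylog j # polylog k # map polylog post)
       - nested_sum N 0 (map polylog (pre @ [j]) @ polylog k # map polylog post)))"
    by (intro fps_agree_add dual_sum_unweighted_agree dual_sum_weighted_prefix_agree)
  also have "fps_agree N \<dots> (bracket (map polylog (pre @ j # 1 # k # post)) + fps_const (1/2) *
      (bracket (map polylog (pre @ [j]) @ wpolylog k # map polylog post) -
          bracket (map polylog pre @ wpolylog j # polylog k # map polylog post)
       - bracket (map polylog (pre @ [j]) @ polylog k # map polylog post)))"
    by (intro fps_agree_add fps_agree_mult fps_agree_diff fps_agree_refl fps_agree_sym[OF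
        bracket_agree])
      (auto simp: q_divisible_polylog q_divisible_wpolylog)
  finally show "fps_agree N (g_sh (pre @ j # 1 # k # post)) (bracket (map polylog (pre @ j # 1 #
      k # post)) + fps_const (1/2) *
      (bracket (map polylog (pre @ [j]) @ wpolylog k # map polylog post) -
          bracket (map polylog pre @ wpolylog j # polylog k # map polylog post)
       - bracket (map polylog (pre @ j # k # post))))" by simp
qed

section \<open>Quasi-shuffle products of nested sums\<close>

fun quasi_shuffle :: "(nat \<Rightarrow> rat fps) list \<Rightarrow> (nat \<Rightarrow> rat fps) list \<Rightarrow> (nat \<Rightarrow> rat fps) list list"
    where
  "quasi_shuffle [] gs = [gs]"
| "quasi_shuffle (f # fs) [] = [f # fs]"
| "quasi_shuffle (f # fs) (g # gs) = map ((#) f) (quasi_shuffle fs (g # gs)) @ map ((#) g)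
    (quasi_shuffle (f # fs) gs)
     @ map ((#) (\<lambda>u. f u * g u)) (quasi_shuffle fs gs)"

lemma nested_sum_step:
  assumes "m < M"
  shows "nested_sum M m (f # fs) = nested_sum M (Suc m) (f # fs)
      + f (Suc m) * nested_sum M (Suc m) fs"
proof -
  have "{m<..M} = insert (Suc m) {Suc m<..M}" using assms by auto
  then show ?thesis by (simp add: add.commute)
qed

text \<open>Induction on the number of available indices: the smallest one, \<open>Suc m\<close>, is
  used by neither factor, by exactly one, or by both, matching the recursion of
  \<open>quasi_shuffle\<close>.\<close>

lemma nested_sum_mult: "nested_sum M m fs * nested_sum M m gs
    = sum_list (map (nested_sum M m) (quasi_shuffle fs gs))"
proof (induction "M - m" arbitrary: m fs gs)
  case 0
  then have "{m<..M} = {}" by auto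
  then have S0: "nested_sum M m (f # fs) = 0" for f fs by simp
  have "sum_list (map (\<lambda>x. nested_sum M m (f # x)) xs) = 0" for f xs
    by (induction xs) (simp_all add: S0 del: nested_sum.simps)
  then show ?case
    by (cases fs; cases gs) (simp_all add: o_def S0 del: nested_sum.simps(2))
next
  case (Suc d)
  then have m: "m < M" and d: "d = M - Suc m" by auto
  note IH = Suc.hyps(1)[OF d]
  show ?case
  proof (cases "fs = [] \<or> gs = []")
    case True
    then show ?thesis by (cases fs) auto
  next
    case False
    then obtain f fs' g gs' where fg: "fs = f # fs'" "gs = g # gs'" by (meson neq_Nil_conv)
    have step: "sum_list (map (\<lambda>x. nested_sum M m (h # x)) xs)
        = sum_list (map (\<lambda>x. nested_sum M (Suc m) (h # x)) xs)
        + h (Suc m) * sum_list (map (nested_sum M (Suc m)) xs)" for h xs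
      by (induction xs) (simp_all add: nested_sum_step[OF m] distrib_left del: nested_sum.simps)
    have "sum_list (map (nested_sum M m) (quasi_shuffle fs gs))
        = sum_list (map (nested_sum M (Suc m)) (quasi_shuffle fs gs))
       + f (Suc m) * sum_list (map (nested_sum M (Suc m)) (quasi_shuffle fs' gs))
           + g (Suc m) * sum_list (map (nested_sum M (Suc m)) (quasi_shuffle fs gs'))
       + f (Suc m) * g (Suc m) * sum_list (map (nested_sum M (Suc m)) (quasi_shuffle fs' gs'))"
      by (simp add: fg o_def step del: nested_sum.simps)
    also have "\<dots> = nested_sum M m fs * nested_sum M m gs"
      unfolding IH[symmetric] unfolding fg nested_sum_step[OF m]
          by (simp add: algebra_simps del: nested_sum.simps)
    finally show ?thesis ..
  qed
qed

lemma bracket_mult: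
  assumes "\<forall>f\<in>set fs. q_divisible f" and "\<forall>f\<in>set gs. q_divisible f"
  shows "bracket fs * bracket gs = sum_list (map bracket (quasi_shuffle fs gs))"
proof (rule fps_ext)
  fix N
  have nth: "sum_list (map bracket xs) $ N = sum_list (map (nested_sum N 0) xs) $ N" for xs
    by (induction xs) (simp_all add: bracket_def)
  have "fps_agree N (bracket fs * bracket gs) (nested_sum N 0 fs * nested_sum N 0 gs)"
    by (intro fps_agree_mult bracket_agree assms)
  then show "(bracket fs * bracket gs) $ N = sum_list (map bracket (quasi_shuffle fs gs)) $ N"
    unfolding nth nested_sum_mult by (simp add: fps_agree_def)
qed

lemma nested_sum_linear:
  "nested_sum M m (pre @ (\<lambda>u. \<Sum>i\<in>A. fps_const (c i) * f i u) # post)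
      = (\<Sum>i\<in>A. fps_const (c i) * nested_sum M m (pre @ f i # post))"
proof (induction pre arbitrary: m)
  case Nil
  then show ?case
    by (simp add: sum_distrib_left sum_distrib_right mult_ac) (rule sum.swap)
next
  case (Cons g pre)
  then show ?case
    by (simp add: sum_distrib_left mult_ac) (rule sum.swap)
qed

lemma bracket_linear:
  "bracket (pre @ (\<lambda>u. \<Sum>i\<in>A. fps_const (c i) * f i u) # post) = (\<Sum>i\<in>A. fps_const (c i) *
      bracket (pre @ f i # post))"
  by (rule fps_ext) (simp add: bracket_def nested_sum_linear fps_sum_nth)

section \<open>The derivation \<open>q d/dq\<close> on nested sums\<close>

lemma q_deriv_nth: "q_deriv f $ n = of_nat n * f $ n"
  by (cases n) (simp_all add: q_deriv_def)

text \<open>At \<open>q^(u v)\<close> the coefficient \<open>v^(k-1) / (k-1)!\<close> is multiplied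
  by \<open>u v\<close>, and the result is \<open>k u v^k / k!\<close>.\<close>

lemma q_deriv_polylog:
  assumes "k \<ge> 1" and "u > 0"
  shows "q_deriv (polylog k u) = of_nat k * wpolylog (Suc k) u"
proof -
  obtain k' where k: "k = Suc k'" using assms(1) by (cases k) auto
  show ?thesis
    by (rule fps_ext) (auto simp: q_deriv_nth wpolylog_def polylog_def divisor_fps_nth k
        fps_of_nat[symmetric] field_simps
        simp del: of_nat_Suc elim!: dvdE)
qed

lemma q_deriv_mult: "q_deriv (f * g) = q_deriv f * g + f * q_deriv g"
  by (simp add: q_deriv_def algebra_simps)

lemma q_deriv_sum: "q_deriv (sum f A) = (\<Sum>x\<in>A. q_deriv (f x))"
  by (simp add: q_deriv_def fps_deriv_sum sum_distrib_left)

lemma q_deriv_nested_sum_polylog: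
  assumes "k \<ge> 1"
  shows "q_deriv (nested_sum M m (polylog k # fs)) = of_nat k * nested_sum M m (wpolylog (Suc k)
      # fs) + (\<Sum>u\<in>{m<..M}. polylog k u * q_deriv (nested_sum M u fs))"
  using q_deriv_polylog[OF assms]
  by (simp add: q_deriv_sum q_deriv_mult sum.distrib sum_distrib_left mult.assoc)

lemma q_deriv_bracket: "q_deriv (bracket fs) $ N = q_deriv (nested_sum N 0 fs) $ N"
  by (simp add: q_deriv_nth bracket_def)

lemma q_deriv_nested_sum_Nil: "q_deriv (nested_sum M m []) = 0"
  by (simp add: q_deriv_def)

lemma q_deriv_bracket_2:
  assumes "a \<ge> 1" "b \<ge> 1"
  shows "q_deriv (bracket [polylog a, polylog b]) = of_nat a *
      bracket [wpolylog (Suc a), polylog b] + of_nat b * bracket [polylog a, wpolylog (Suc b)]"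
proof (rule fps_ext)
  fix N
  have "q_deriv (nested_sum N 0 [polylog a, polylog b]) = of_nat a * nested_sum N 0 [wpolylog
      (Suc a), polylog b] + of_nat b * nested_sum N 0 [polylog a, wpolylog (Suc b)]"
    unfolding q_deriv_nested_sum_polylog[OF assms(1)] q_deriv_nested_sum_polylog[OF assms(2)]
        q_deriv_nested_sum_Nil
    by (simp add: sum_distrib_left mult_ac)
  then show "q_deriv (bracket [polylog a, polylog b]) $ N = (of_nat a *
      bracket [wpolylog (Suc a), polylog b] + of_nat b * bracket [polylog a, wpolylog (Suc b)]) $
      N"
    unfolding q_deriv_bracket by (simp add: bracket_def fps_of_nat[symmetric])
qed

lemma q_deriv_bracket_3:
  assumes "a \<ge> 1" "b \<ge> 1" "c \<ge> 1"
  shows "q_deriv (bracket [polylog a, polylog b, polylog c]) = of_nat a *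
      bracket [wpolylog (Suc a), polylog b, polylog c]
    + of_nat b * bracket [polylog a, wpolylog (Suc b), polylog c] + of_nat c *
        bracket [polylog a, polylog b, wpolylog (Suc c)]"
proof (rule fps_ext)
  fix N
  have "q_deriv (nested_sum N 0 [polylog a, polylog b, polylog c])
      = of_nat a * nested_sum N 0 [wpolylog (Suc a), polylog b, polylog c]
    + of_nat b * nested_sum N 0 [polylog a, wpolylog (Suc b), polylog c]
        + of_nat c * nested_sum N 0 [polylog a, polylog b, wpolylog (Suc c)]"
    unfolding q_deriv_nested_sum_polylog[OF assms(1)] q_deriv_nested_sum_polylog[OF assms(2)]
        q_deriv_nested_sum_polylog[OF assms(3)] q_deriv_nested_sum_Nil
    by (simp add: sum_distrib_left sum.distrib distrib_left mult_ac)
  then show "q_deriv (bracket [polylog a, polylog b, polylog c]) $ N = (of_nat a *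
      bracket [wpolylog (Suc a), polylog b, polylog c]
    + of_nat b * bracket [polylog a, wpolylog (Suc b), polylog c] + of_nat c *
        bracket [polylog a, polylog b, wpolylog (Suc c)]) $ N"
    unfolding q_deriv_bracket by (simp add: bracket_def fps_of_nat[symmetric])
qed

section \<open>Products of the series in one variable\<close>

lemma q_deriv_lin:
  "q_deriv (f + g) = q_deriv f + q_deriv g"
  "q_deriv (fps_const c * f) = fps_const c * q_deriv f"
  "q_deriv 0 = 0"
  by (simp_all add: q_deriv_def algebra_simps)

lemma wpolylog_1: "wpolylog k 1 = polylog k 1"
  by (simp add: wpolylog_def)

lemma q_deriv_polylog_1: "k \<ge> 1 \<Longrightarrow> q_deriv (polylog k 1) = of_nat k * polylog (Suc k) 1"
  using q_deriv_polylog[of k 1] wpolylog_1[of "Suc k"] by simp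

abbreviation polylog_1 :: "rat fps" where "polylog_1 \<equiv> polylog 1 1"

text \<open>With \<open>y = q / (1 - q)\<close>, the coefficient \<open>n\<close> of the derivative
  splits as \<open>1 + (n - 1)\<close>, the coefficients of \<open>y\<close> and
  \<open>y^2\<close>.\<close>

lemma q_deriv_polylog_1_1: "q_deriv polylog_1 = polylog_1 + polylog_1 ^ 2"
proof -
  have "polylog_1 = geom 1" by (simp add: polylog_def geom_eq_divisor_fps)
  then show ?thesis
    using geom_power2_eq_divisor_fps[of 1]
    by (intro fps_ext) (auto simp: q_deriv_nth geom_nth divisor_fps_nth)
qed

text \<open>For \<open>k \<ge> 2\<close> the series \<open>L\<^sub>k(1)\<close> is a polynomial in \<open>y = L\<^sub>1(1)\<close> divisible by \<open>y (1 + y)\<close>, because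
  \<open>q d/dq\<close> sends \<open>y\<^sup>j\<close> to \<open>j y\<^bsup>j-1\<^esup> (y + y\<^sup>2)\<close>. Working with multiples of \<open>y (1
      + y)\<close> keeps \<open>L\<^sub>1\<close> out of
  the expansion of \<open>L\<^sub>a L\<^sub>b\<close>.\<close>

definition zpoly :: "nat \<Rightarrow> rat fps" where
  "zpoly j = polylog_1 ^ j + polylog_1 ^ Suc j"

lemma q_deriv_polylog_1_1_power: "q_deriv (polylog_1 ^ j) = of_nat j * zpoly j"
proof (induction j)
  case 0
  then show ?case by (simp add: q_deriv_def)
next
  case (Suc j)
  then show ?case
    by (simp add: q_deriv_mult q_deriv_polylog_1_1 zpoly_def algebra_simps power2_eq_square del:
        One_nat_def)
qed

lemma q_deriv_zpoly: "q_deriv (zpoly j) = of_nat j * zpoly j + of_nat (Suc j) * zpoly (Suc j)"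
  by (simp only: zpoly_def[of j] q_deriv_lin q_deriv_polylog_1_1_power)

lemma zpoly_mult: "zpoly i * zpoly j = zpoly (i + j) + zpoly (Suc (i + j))"
  by (simp add: zpoly_def algebra_simps power_add)

lemma polylog_1_1_mult_zpoly: "polylog_1 * zpoly j = zpoly (Suc j)"
  by (simp add: zpoly_def algebra_simps)

text \<open>The multiples of \<open>y (1 + y)\<close> among the polynomials in \<open>y\<close> of
  degree at most \<open>n\<close>.\<close>

definition zspan :: "nat \<Rightarrow> rat fps set" where
  "zspan n = rat_fps.span (zpoly ` {1..<n})"

lemma zpoly_in_zspan: "1 \<le> j \<Longrightarrow> j < n \<Longrightarrow> zpoly j \<in> zspan n"
  by (simp add: zspan_def rat_fps.span_base)

lemma zspan_lin:
  "f \<in> zspan n \<Longrightarrow> g \<in> zspan n \<Longrightarrow> f + g \<in> zspan n"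
  "f \<in> zspan n \<Longrightarrow> g \<in> zspan n \<Longrightarrow> f - g \<in> zspan n"
  "f \<in> zspan n \<Longrightarrow> fps_const c * f \<in> zspan n"
  "f \<in> zspan n \<Longrightarrow> of_nat k * f \<in> zspan n"
  "0 \<in> zspan n"
  unfolding zspan_def
  by (auto intro: rat_fps.span_add rat_fps.span_diff rat_fps.span_scale rat_fps.span_zero
      simp flip: fps_of_nat)

lemma zspan_mono: "m \<le> n \<Longrightarrow> zspan m \<subseteq> zspan n"
  unfolding zspan_def by (rule rat_fps.span_mono) auto

lemma zspan_induct [consumes 1, case_names zero add]:
  assumes "f \<in> zspan n" and "P 0"
    and "\<And>c j g. 1 \<le> j \<Longrightarrow> j < n \<Longrightarrow> g \<in> zspan n \<Longrightarrow> P g \<Longrightarrow> P (fps_const c * zpoly j + g)"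
  shows "P f"
proof -
  have "f \<in> zspan n \<and> P f"
    using assms(1) unfolding zspan_def[of n]
  proof (induction rule: rat_fps.span_induct_alt)
    case base
    then show ?case using assms(2) by (simp add: rat_fps.span_zero)
  next
    case (step c x y)
    then obtain j where j: "x = zpoly j" "1 \<le> j" "j < n" by auto
    have y: "y \<in> zspan n" using step unfolding zspan_def by blast
    have "fps_const c * zpoly j + y \<in> zspan n"
      by (intro zspan_lin(1) zspan_lin(3) zpoly_in_zspan y j)
    with j y step assms(3)[of j y c] show ?case
      unfolding zspan_def by blast
  qed
  then show ?thesis ..
qed

lemma q_deriv_zspan: "f \<in> zspan n \<Longrightarrow> q_deriv f \<in> zspan (Suc n)"
proof (induction rule: zspan_induct)
  case zero
  then show ?case by (simp add: q_deriv_lin zspan_lin)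
next
  case (add c j g)
  then show ?case
    unfolding q_deriv_lin q_deriv_zpoly by (intro zspan_lin zpoly_in_zspan) auto
qed

lemma polylog_1_1_mult_zspan: "f \<in> zspan n \<Longrightarrow> polylog_1 * f \<in> zspan (Suc n)"
proof (induction rule: zspan_induct)
  case zero
  then show ?case by (simp add: zspan_lin)
next
  case (add c j g)
  have "polylog_1 * (fps_const c * zpoly j + g) = fps_const c * zpoly (Suc j) + polylog_1 * g"
    by (simp only: polylog_1_1_mult_zpoly[symmetric] algebra_simps)
  with add show ?case by (auto intro!: zspan_lin zpoly_in_zspan)
qed

lemma zpoly_mult_zspan: "f \<in> zspan n \<Longrightarrow> 1 \<le> i \<Longrightarrow> i < m \<Longrightarrow> zpoly i * f \<in> zspan (m + n)"
proof (induction rule: zspan_induct)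
  case zero
  then show ?case by (simp add: zspan_lin)
next
  case (add c j g)
  have "zpoly i * (fps_const c * zpoly j + g) = fps_const c * (zpoly (i + j) + zpoly (Suc (i
      + j))) + zpoly i * g"
    by (simp only: zpoly_mult[symmetric] algebra_simps)
  with add show ?case by (auto intro!: zspan_lin zpoly_in_zspan)
qed

lemma zspan_mult: "f \<in> zspan m \<Longrightarrow> g \<in> zspan n \<Longrightarrow> f * g \<in> zspan (m + n)"
proof (induction rule: zspan_induct)
  case zero
  then show ?case by (simp add: zspan_lin)
next
  case (add c j h)
  have "(fps_const c * zpoly j + h) * g = fps_const c * (zpoly j * g) + h * g"
    by (simp only: algebra_simps)
  with add show ?case by (auto intro!: zspan_lin zpoly_mult_zspan)
qed

text \<open>Triangularity with leading coefficient 1: for \<open>m = k + 2\<close> the derivation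
  sends \<open>L_m(1)\<close> to \<open>m L_(m+1)(1)\<close>, and the leading term
  \<open>z_(m-1)\<close> to \<open>m z_m\<close> plus a lower term, so the factor \<open>m\<close>
  cancels.\<close>

lemma polylog_minus_zpoly: "polylog (Suc (Suc k)) 1 - zpoly (Suc k) \<in> zspan (Suc k)"
proof (induction k)
  case 0
  have "polylog 2 1 = zpoly 1"
    using q_deriv_polylog_1[of 1] q_deriv_polylog_1_1 by (simp add: zpoly_def numeral_2_eq_2)
  then show ?case by (simp add: zspan_lin numeral_2_eq_2)
next
  case (Suc k)
  define v where "v = polylog (Suc (Suc k)) 1 - zpoly (Suc k)"
  have polylog: "polylog (Suc (Suc k)) 1 = zpoly (Suc k) + v" by (simp add: v_def)
  have "of_nat (Suc (Suc k)) * polylog (Suc (Suc (Suc k))) 1 = q_deriv (polylog (Suc (Suc k)) 1)"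
    by (rule q_deriv_polylog_1[symmetric]) simp
  also have "\<dots> = of_nat (Suc (Suc k)) * zpoly (Suc (Suc k)) + (of_nat (Suc k) * zpoly (Suc k)
      + q_deriv v)"
    unfolding polylog q_deriv_lin q_deriv_zpoly by (simp only: algebra_simps)
  finally have "of_nat (Suc (Suc k)) * (polylog (Suc (Suc (Suc k))) 1 - zpoly (Suc (Suc k)))
      = of_nat (Suc k) * zpoly (Suc k) + q_deriv v"
    by (simp only: algebra_simps)
  moreover have "\<dots> \<in> zspan (Suc (Suc k))"
    using Suc.IH unfolding v_def[symmetric] by (intro zspan_lin zpoly_in_zspan q_deriv_zspan) auto
  ultimately have "fps_const (1 / of_nat (Suc (Suc k))) * (fps_const (of_nat (Suc (Suc k))) *
      (polylog (Suc (Suc (Suc k))) 1 - zpoly (Suc (Suc k)))) \<in> zspan (Suc (Suc k))"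
    by (intro zspan_lin(3)[of "fps_const _ * _"]) (simp only: fps_of_nat)
  then show ?case
    by (simp add: mult.assoc[symmetric] del: of_nat_Suc One_nat_def)
qed

lemma polylog_in_zspan: "polylog (Suc (Suc k)) 1 \<in> zspan (Suc (Suc k))"
proof -
  have "polylog (Suc (Suc k)) 1 = (polylog (Suc (Suc k)) 1 - zpoly (Suc k)) + zpoly (Suc k)"
      by simp
  also have "\<dots> \<in> zspan (Suc (Suc k))"
    by (intro zspan_lin(1) zpoly_in_zspan subsetD[OF zspan_mono polylog_minus_zpoly]) auto
  finally show ?thesis .
qed

text \<open>The triangular expansion of \<open>polylog_minus_zpoly\<close> is inverted step by step,
  involving only \<open>L_j(1)\<close> with \<open>j\<close> at least 2.\<close>

lemma zspan_subset_span_polylog: "zspan n \<subseteq> rat_fps.span ((\<lambda>j. polylog j 1) ` {2..n})"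
proof (induction n)
  case 0
  then show ?case by (simp add: zspan_def)
next
  case (Suc n)
  let ?W = "\<lambda>n. rat_fps.span ((\<lambda>j. polylog j 1) ` {2..n})"
  have mono: "?W n \<subseteq> ?W (Suc n)" by (rule rat_fps.span_mono) auto
  show ?case
  proof
    fix f assume "f \<in> zspan (Suc n)"
    then show "f \<in> ?W (Suc n)"
    proof (induction rule: zspan_induct)
      case zero
      then show ?case by (rule rat_fps.span_zero)
    next
      case (add c j g)
      have "zpoly j \<in> ?W (Suc n)"
      proof (cases "j = n")
        case True
        with add obtain k where k: "n = Suc k" by (cases n) auto
        have "zpoly j = polylog (Suc (Suc k)) 1 - (polylog (Suc (Suc k)) 1 - zpoly (Suc k))"
            using True k by simp
        also have "\<dots> \<in> ?W (Suc n)"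
        proof (rule rat_fps.span_diff)
          show "polylog (Suc (Suc k)) 1 \<in> ?W (Suc n)"
            using k by (intro rat_fps.span_base imageI) simp
          show "polylog (Suc (Suc k)) 1 - zpoly (Suc k) \<in> ?W (Suc n)"
            using polylog_minus_zpoly[of k] Suc.IH mono k by blast
        qed
        finally show ?thesis .
      next
        case False
        with add have "zpoly j \<in> zspan n" by (intro zpoly_in_zspan) auto
        with Suc.IH mono show ?thesis by auto
      qed
      with add show ?case by (intro rat_fps.span_add rat_fps.span_scale)
    qed
  qed
qed

text \<open>The top terms cancel: \<open>y z_(b-1) = z_b\<close> for \<open>a = 1\<close>, and
  \<open>z_(a-1) z_(b-1) = z_(a+b-2) + z_(a+b-1)\<close> otherwise. The bound on \<open>b\<close>
  supplies the factor \<open>1 + y\<close> of the product.\<close>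

lemma polylog_1_mult:
  assumes "a \<ge> 1" "b \<ge> 2"
  shows "polylog a 1 * polylog b 1 - polylog (a + b) 1 \<in> zspan (a + b - 1)"
proof (cases "a = 1")
  case True
  obtain k where b: "b = Suc (Suc k)" using assms(2) by (metis add_2_eq_Suc le_Suc_ex)
  have "polylog a 1 * polylog b 1 - polylog (a + b) 1 = polylog_1 * (polylog b 1 - zpoly (Suc k))
      - (polylog (Suc (Suc (Suc k))) 1 - zpoly (Suc (Suc k)))"
    using polylog_1_1_mult_zpoly[of "Suc k"] by (simp add: True b algebra_simps)
  moreover have "polylog_1 * (polylog b 1 - zpoly (Suc k)) \<in> zspan b" unfolding b
      by (intro polylog_1_1_mult_zspan polylog_minus_zpoly)
  moreover have "polylog (Suc (Suc (Suc k))) 1 - zpoly (Suc (Suc k)) \<in> zspan b" unfolding b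
      by (rule polylog_minus_zpoly)
  ultimately show ?thesis by (simp add: True zspan_lin)
next
  case False
  obtain k where b: "b = Suc (Suc k)" using assms(2) by (metis add_2_eq_Suc le_Suc_ex)
  have "2 \<le> a" using assms(1) False by simp
  then obtain l where a: "a = Suc (Suc l)" by (metis add_2_eq_Suc le_Suc_ex)
  let ?n = "Suc (Suc (Suc (k + l)))"
  have e: "Suc l + Suc (Suc k) = ?n" "Suc (Suc l) + Suc k = ?n" by simp_all
  have "(polylog a 1 - zpoly (Suc l)) * polylog b 1 \<in> zspan ?n"
    using zspan_mult[OF polylog_minus_zpoly polylog_in_zspan, of l k] unfolding a b e .
  moreover have "zpoly (Suc l) * (polylog b 1 - zpoly (Suc k)) \<in> zspan ?n"
    using zpoly_mult_zspan[OF polylog_minus_zpoly, of "Suc l" "Suc (Suc l)" k] unfolding a b e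
        by simp
  moreover have "zpoly (Suc (Suc (k + l))) \<in> zspan ?n" by (rule zpoly_in_zspan) auto
  moreover have "polylog (a + b) 1 - zpoly ?n \<in> zspan ?n"
    using polylog_minus_zpoly[of "Suc (Suc (k + l))"] by (simp add: a b add.commute)
  ultimately have "(polylog a 1 - zpoly (Suc l)) * polylog b 1 + zpoly (Suc l) * (polylog b 1
      - zpoly (Suc k))
      + zpoly (Suc (Suc (k + l))) - (polylog (a + b) 1 - zpoly ?n) \<in> zspan ?n"
    by (intro zspan_lin(1)[of "_ * _"] zspan_lin(1)[of "_ + _"] zspan_lin(2)[of "_ + _"])
  also have "(polylog a 1 - zpoly (Suc l)) * polylog b 1 + zpoly (Suc l) * (polylog b 1
      - zpoly (Suc k))
      + zpoly (Suc (Suc (k + l))) - (polylog (a + b) 1 - zpoly ?n) = polylog a 1 * polylog b 1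
          - polylog (a + b) 1"
    using zpoly_mult[of "Suc l" "Suc k"] by (simp add: algebra_simps)
  finally show ?thesis by (simp add: a b add.commute)
qed

lemma span_image_finite_sum:
  assumes "x \<in> rat_fps.span (f ` A)" and "finite A"
  shows "\<exists>c. x = (\<Sum>j\<in>A. fps_const (c j) * f j)"
  using assms(1)
proof (induction rule: rat_fps.span_induct_alt)
  case base
  then show ?case by (intro exI[of _ "\<lambda>_. 0"]) simp
next
  case (step c x y)
  then obtain d i where d: "y = (\<Sum>j\<in>A. fps_const (d j) * f j)" and i: "i \<in> A" "x = f i" by blast
  have "fps_const c * x + y = (\<Sum>j\<in>A. fps_const ((if j = i then c else 0) + d j) * f j)"
  proof -
    have "(\<Sum>j\<in>A. fps_const ((if j = i then c else 0) + d j) * f j) =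
      (\<Sum>j\<in>A. fps_const (if j = i then c else 0) * f j) + (\<Sum>j\<in>A. fps_const (d j) * f j)"
      by (simp add: sum.distrib[symmetric] fps_const_add[symmetric] distrib_right del:
          fps_const_add)
    also have "(\<Sum>j\<in>A. fps_const (if j = i then c else 0) * f j) = (\<Sum>j\<in>A. if j
        = i then fps_const c * f j else 0)"
      by (rule sum.cong) auto
    also have "\<dots> = fps_const c * x" using i assms(2) by simp
    finally show ?thesis using d by simp
  qed
  then show ?case by (rule exI[of _ "\<lambda>j. (if j = i then c else 0) + d j"])
qed

text \<open>The substitution of \<open>q^u\<close> for \<open>q\<close>, by which relations at
  \<open>u = 1\<close> carry over to all \<open>u\<close> with the same coefficients.\<close>

lemma divisor_fps_eq_compose:
  assumes "u > 0"
  shows "divisor_fps h u = divisor_fps h 1 oo fps_X ^ u"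
proof (rule fps_ext)
  fix n
  have "(divisor_fps h 1 oo fps_X ^ u) $ n = (\<Sum>i=0..n. if u * i
      = n then divisor_fps h 1 $ i else 0)"
    by (auto simp: fps_compose_nth simp flip: power_mult intro!: sum.cong)
  also have "\<dots> = divisor_fps h u $ n"
  proof (cases "u dvd n")
    case True
    then obtain j where j: "n = u * j" by blast
    have "(u * i = n) = (i = j)" for i using j assms by simp
    moreover have "j \<le> n" using j assms by simp
    ultimately show ?thesis using j assms by (simp add: divisor_fps_nth)
  next
    case False
    then have "(if u * i = n then divisor_fps h 1 $ i else 0) = 0" for i by auto
    with False show ?thesis by (simp add: divisor_fps_nth)
  qed
  finally show "divisor_fps h u $ n = (divisor_fps h 1 oo fps_X ^ u) $ n" ..
qed

text \<open>The coefficients \<open>c\<close> do not depend on \<open>u\<close>, so they can be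
  taken out of a nested sum. At \<open>u = 0\<close> all the series vanish.\<close>

lemma polylog_mult:
  assumes "a \<ge> 1" "b \<ge> 2"
  obtains c where "\<And>u. polylog a u * polylog b u = polylog (a + b) u + (\<Sum>j\<in>{2..<a
      + b}. fps_const (c j) * polylog j u)"
proof -
  obtain c where c: "polylog a 1 * polylog b 1 - polylog (a + b) 1 = (\<Sum>j\<in>{2..a + b
      - 1}. fps_const (c j) * polylog j 1)"
    using span_image_finite_sum polylog_1_mult[OF assms] zspan_subset_span_polylog by blast
  have "{2..a + b - 1} = {2..<a + b}" using assms by auto
  with c have c': "polylog a 1 * polylog b 1 = polylog (a + b) 1 + (\<Sum>j\<in>{2..<a
      + b}. fps_const (c j) * polylog j 1)"
    by (simp add: algebra_simps)
  have "polylog a u * polylog b u = polylog (a + b) u + (\<Sum>j\<in>{2..<a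
      + b}. fps_const (c j) * polylog j u)" for u
  proof (cases "u = 0")
    case True
    have "polylog k 0 = 0" for k by (rule fps_ext) (auto simp: polylog_def divisor_fps_nth)
    with True show ?thesis by simp
  next
    case False
    then have X: "(fps_X ^ u) $ 0 = (0 :: rat)" by simp
    have polylog: "polylog k u = polylog k 1 oo fps_X ^ u" for k
      unfolding polylog_def using divisor_fps_eq_compose False by blast
    have "(polylog a 1 * polylog b 1) oo fps_X ^ u = (polylog (a + b) 1 + (\<Sum>j\<in>{2..<a
        + b}. fps_const (c j) * polylog j 1)) oo fps_X ^ u"
      by (simp only: c')
    then show ?thesis
      by (simp only: fps_compose_mult_distrib[OF X] fps_compose_add_distrib
          fps_compose_sum_distrib
          fps_const_compose polylog[symmetric])
  qed
  then show ?thesis by (rule that)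
qed

section \<open>The map on words and the weight filtration\<close>

lemma g_sh_map_eq:
  assumes "finite A" "Poly_Mapping.keys u \<subseteq> A"
  shows "g_sh_map u = (\<Sum>w\<in>A. fps_const (Poly_Mapping.lookup u w) * g_sh (index_of_word w))"
  unfolding g_sh_map_def using assms by (intro sum.mono_neutral_left) (auto simp: in_keys_iff)

lemma g_sh_map_add: "g_sh_map (u + v) = g_sh_map u + g_sh_map v"
proof -
  let ?A = "Poly_Mapping.keys u \<union> Poly_Mapping.keys v"
  have "g_sh_map (u + v) = (\<Sum>w\<in>?A. fps_const (Poly_Mapping.lookup (u
      + v) w) * g_sh (index_of_word w))"
    by (rule g_sh_map_eq) (simp_all add: Poly_Mapping.keys_add)
  also have "\<dots> = (\<Sum>w\<in>?A. fps_const (Poly_Mapping.lookup u w) * g_sh (index_of_word w)) +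
      (\<Sum>w\<in>?A. fps_const (Poly_Mapping.lookup v w) * g_sh (index_of_word w))"
    by (simp add: lookup_add sum.distrib[symmetric] fps_const_add[symmetric] distrib_right del:
        fps_const_add)
  also have "\<dots> = g_sh_map u + g_sh_map v"
    using g_sh_map_eq[of ?A u] g_sh_map_eq[of ?A v] by simp
  finally show ?thesis .
qed

lemma g_sh_map_diff: "g_sh_map (u - v) = g_sh_map u - g_sh_map v"
  using g_sh_map_add[of "u - v" v] by simp

lemma g_sh_map_word [simp]: "g_sh_map (word w) = g_sh (index_of_word w)"
  by (simp add: g_sh_map_def word_def)

lemma g_sh_map_0 [simp]: "g_sh_map 0 = 0"
  by (simp add: g_sh_map_def)

lemma g_sh_map_sum_list: "g_sh_map (sum_list us) = sum_list (map g_sh_map us)"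
  by (induction us) (simp_all add: g_sh_map_add)

lemma g_sh_map_e_word:
  "\<forall>k\<in>set ks. 1 \<le> k \<Longrightarrow> g_sh_map (e_word ks) = g_sh ks"
  by (simp only: e_word_eq_word g_sh_map_word index_of_word_concat)

lemma index_of_word_ge_1: "\<forall>k\<in>set (index_of_word w). 1 \<le> k"
  by (induction w rule: index_of_word.induct) auto

lemma index_word_index_of_word:
  assumes "w = [] \<or> hd w = L1"
  shows "index_word (index_of_word w) = w"
proof -
  \<comment> \<open>Restoring the initial run of \<open>L0\<close>, which
    \<open>index_of_word\<close> drops, makes the claim inductive over all words.\<close>
  have "replicate (length (takeWhile (\<lambda>a. a = L0) w)) L0 @ index_word (index_of_word w) = w" for w
    by (induction w rule: index_of_word.induct) simp_all
  from this[of w] show ?thesis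
    using assms by (cases w) auto
qed

lemma path_character_agree_g_sh:
  assumes "w = [] \<or> hd w = L1"
  shows "fps_agree N (path_character N w) (g_sh (index_of_word w))"
proof -
  have "path_character N w = g_trunc (Suc N) 0 (index_of_word w)"
    using path_character_eq_g_trunc[OF index_of_word_ge_1[of w], of N 0]
        index_word_index_of_word[OF assms] by simp
  then show ?thesis
    using g_sh_agree_g_trunc[OF index_of_word_ge_1] by (simp add: fps_agree_sym)
qed

lemma hd_shuffle_list:
  assumes "v = [] \<or> hd v = a" "w = [] \<or> hd w = a" "x \<in> set (shuffle_list v w)"
  shows "x = [] \<or> hd x = a"
  using assms by (cases "(v, w)" rule: shuffle_list.cases) auto

lemma length_shuffle_list: "x \<in> set (shuffle_list v w) \<Longrightarrow> length x = length v + length w"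
  by (induction v w arbitrary: x rule: shuffle_list.induct) auto

lemma fps_agree_sum_list:
  "(\<And>x. x \<in> set xs \<Longrightarrow> fps_agree N (f x) (g x)) \<Longrightarrow> fps_agree N (sum_list (map f xs)) (sum_list (map
      g xs))"
  by (induction xs) (auto intro: fps_agree_add)

text \<open>Modulo each power of \<open>q\<close>, the values of \<open>g_sh\<close> on words of
  \<open>H1\<close> are those of a shuffle character, and shuffles of such words again lie in
  \<open>H1\<close>.\<close>

lemma g_sh_shuffle:
  assumes "v = [] \<or> hd v = L1" and "w = [] \<or> hd w = L1"
  shows "sum_list (map (\<lambda>x. g_sh (index_of_word x)) (shuffle_list v w))
      = g_sh (index_of_word v) * g_sh (index_of_word w)"
proof (rule fps_eqI_agree)
  fix N
  have "fps_agree N (sum_list (map (\<lambda>x. g_sh (index_of_word x)) (shuffle_list v w))) (sum_list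
      (map (path_character N) (shuffle_list v w)))"
    by (intro fps_agree_sum_list fps_agree_sym[OF path_character_agree_g_sh] hd_shuffle_list[OF
        assms])
  also have "sum_list (map (path_character N) (shuffle_list v w))
      = path_character N v * path_character N w"
    using shuffle_character_path_character[of N] by (simp add: shuffle_character_def
        shuffle_sum_def)
  also have "fps_agree N \<dots> (g_sh (index_of_word v) * g_sh (index_of_word w))"
    by (intro fps_agree_mult path_character_agree_g_sh assms)
  finally show "fps_agree N (sum_list (map (\<lambda>x. g_sh (index_of_word x)) (shuffle_list v w)))
      (g_sh (index_of_word v) * g_sh (index_of_word w))" .
qed

lemma hd_index_word: "index_word ks = [] \<or> hd (index_word ks) = L1"
  by (cases ks) auto

lemma bilinear_ext_word: "bilinear_ext f (word v) (word w) = f v w"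
proof -
  have "Poly_Mapping.single [] 1 = (1 :: ncpoly)"
    using word_Nil by (simp add: word_def)
  then show ?thesis by (simp add: bilinear_ext_def word_def)
qed

section \<open>The harmonic product and the image of \<open>ds\<close>\<close>

fun harmonic_list :: "nat list \<Rightarrow> nat list \<Rightarrow> nat list list" where
  "harmonic_list [] w = [w]"
| "harmonic_list (k # v) [] = [k # v]"
| "harmonic_list (k # v) (l # w) = map ((#) k) (harmonic_list v (l # w)) @ map ((#) l)
    (harmonic_list (k # v) w)
     @ map ((#) (k + l)) (harmonic_list v w)"

lemma harmonic_index_eq: "harmonic_index v w = sum_list (map e_word (harmonic_list v w))"
proof (induction v w rule: harmonic_index.induct)
  case (3 k v l w)
  have "ek c * sum_list (map e_word xs) = sum_list (map (e_word \<circ> (#) c) xs)" for c xs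
    by (induction xs) (simp_all add: distrib_left e_word_def)
  with 3 show ?case by (simp add: add.assoc)
qed simp_all

lemma harmonic_list_ge_1:
  assumes "\<forall>k\<in>set ks. 1 \<le> k" "\<forall>k\<in>set ls. 1 \<le> k" "x \<in> set (harmonic_list ks ls)"
  shows "\<forall>k\<in>set x. 1 \<le> k"
  using assms
proof (induction ks ls arbitrary: x rule: harmonic_list.induct)
  case (3 k v l w)
  from 3(6) obtain y where
    "x = k # y \<and> y \<in> set (harmonic_list v (l # w)) \<or> x = l # y \<and> y \<in> set (harmonic_list (k # v) w)
      \<or> x = (k + l) # y \<and> y \<in> set (harmonic_list v w)"
    by auto
  moreover have "1 \<le> k" "1 \<le> l" "1 \<le> k + l" "\<forall>k\<in>set v. 1 \<le> k" "\<forall>k\<in>set w. 1 \<le> k"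
    using 3(4,5) by auto
  ultimately show ?case
    using 3(1)[of y] 3(2)[of y] 3(3)[of y] 3(4,5) by (elim disjE conjE) simp_all
qed auto

lemma g_sh_map_ds:
  assumes "\<forall>k\<in>set ks. 1 \<le> k" "\<forall>k\<in>set ls. 1 \<le> k"
  shows "g_sh_map (ds (e_word ks) (e_word ls)) = sum_list (map g_sh (harmonic_list ks ls))
      - g_sh ks * g_sh ls"
proof -
  have "g_sh_map (harmonic_prod (e_word ks) (e_word ls)) = sum_list (map g_sh (harmonic_list ks
      ls))"
    unfolding harmonic_prod_def e_word_eq_word[of ks] e_word_eq_word[of ls] bilinear_ext_word
        index_of_word_concat[OF assms(1)] index_of_word_concat[OF assms(2)]
      harmonic_index_eq g_sh_map_sum_list
    using g_sh_map_e_word[OF harmonic_list_ge_1[OF assms]]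
    by (intro arg_cong[where f = sum_list]) simp
  moreover have "g_sh_map (shuffle_prod (e_word ks) (e_word ls)) = g_sh ks * g_sh ls"
    unfolding shuffle_prod_def e_word_eq_word bilinear_ext_word shuffle_words_eq g_sh_map_sum_list
    using g_sh_shuffle[OF hd_index_word hd_index_word, of ks ls]
    by (simp only: map_map o_def g_sh_map_word index_of_word_concat[OF assms(1)]
        index_of_word_concat[OF assms(2)])
  ultimately show ?thesis by (simp add: ds_def g_sh_map_diff)
qed

section \<open>Membership in the weight filtration\<close>

lemma length_le_sum_list: "\<forall>k\<in>set ks. 1 \<le> k \<Longrightarrow> length ks \<le> sum_list (ks :: nat list)"
  by (induction ks) auto

lemma g_sh_in_G:
  assumes "\<forall>k\<in>set ks. 1 \<le> k" "sum_list ks \<le> W"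
  shows "g_sh ks \<in> G_sh_le W"
  unfolding G_sh_le_def using assms length_le_sum_list[OF assms(1)]
  by (intro rat_fps.span_base) auto

lemma G_sh_le_lin:
  "f \<in> G_sh_le W \<Longrightarrow> g \<in> G_sh_le W \<Longrightarrow> f + g \<in> G_sh_le W"
  "f \<in> G_sh_le W \<Longrightarrow> g \<in> G_sh_le W \<Longrightarrow> f - g \<in> G_sh_le W"
  "f \<in> G_sh_le W \<Longrightarrow> fps_const c * f \<in> G_sh_le W"
  "f \<in> G_sh_le W \<Longrightarrow> of_nat k * f \<in> G_sh_le W"
  "0 \<in> G_sh_le W"
  unfolding G_sh_le_def
  by (auto intro: rat_fps.span_add rat_fps.span_diff rat_fps.span_scale rat_fps.span_zero
      simp flip: fps_of_nat)

lemma length_index_word: "\<forall>k\<in>set ks. 1 \<le> k \<Longrightarrow> length (index_word ks) = sum_list ks"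
  by (induction ks) auto

text \<open>Shuffling preserves the total length, and the length of a word in \<open>H1\<close> is
  its weight.\<close>

lemma g_sh_mult_in_G:
  assumes "\<forall>k\<in>set ks. 1 \<le> k" "\<forall>k\<in>set ls. 1 \<le> k" "sum_list ks + sum_list ls \<le> W"
  shows "g_sh ks * g_sh ls \<in> G_sh_le W"
proof -
  have "g_sh (index_of_word x) \<in> G_sh_le W" if x: "x \<in> set (shuffle_list (index_word ks)
      (index_word ls))" for x
  proof (rule g_sh_in_G[OF index_of_word_ge_1])
    have "length x = sum_list ks + sum_list ls"
      using length_shuffle_list[OF x] length_index_word assms by simp
    moreover have "length x = sum_list (index_of_word x)"
      using length_index_word[OF index_of_word_ge_1, of x] index_word_index_of_word[OF
          hd_shuffle_list[OF hd_index_word hd_index_word x]] by simp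
    ultimately show "sum_list (index_of_word x) \<le> W" using assms by simp
  qed
  then have "sum_list (map (\<lambda>x. g_sh (index_of_word x)) xs) \<in> G_sh_le W"
      if "set xs \<subseteq> set (shuffle_list (index_word ks) (index_word ls))" for xs
    using that by (induction xs) (auto intro: G_sh_le_lin)
  from this[OF subset_refl] show ?thesis
    unfolding g_sh_shuffle[OF hd_index_word hd_index_word] index_of_word_concat[OF assms(1)]
        index_of_word_concat[OF assms(2)] .
qed

lemma bracket_in_G:
  assumes "\<forall>k\<in>set ks. 1 \<le> k" "1 \<notin> set (butlast ks)" "sum_list ks \<le> W"
  shows "bracket (map polylog ks) \<in> G_sh_le W"
  using g_sh_in_G[OF assms(1,3)] g_sh_eq_bracket[OF assms(1,2)] by simp

lemma sum_in_G: "(\<And>x. x \<in> A \<Longrightarrow> f x \<in> G_sh_le W) \<Longrightarrow> sum f A \<in> G_sh_le W"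
  by (induction A rule: infinite_finite_induct) (auto intro: G_sh_le_lin)

text \<open>Since \<open>a + b\<close> is at least 3, one of the factors has index at least 2, and
  \<open>polylog_mult\<close> applies up to order. Multilinearity of the bracket in the merged slot
  leaves the lower terms covered by the last hypothesis.\<close>

lemma bracket_merge:
  assumes "a \<ge> 1" "b \<ge> 1" "a + b \<ge> 3"
    and "\<And>j. 2 \<le> j \<Longrightarrow> j < a + b \<Longrightarrow> bracket (pre @ polylog j # post) \<in> G_sh_le W"
  shows "bracket (pre @ (\<lambda>u. polylog a u * polylog b u) # post) - bracket (pre @ polylog (a
      + b) # post) \<in> G_sh_le W"
proof -
  obtain c where c: "\<And>u. polylog a u * polylog b u = polylog (a + b) u + (\<Sum>j\<in>{2..<a
      + b}. fps_const (c j) * polylog j u)"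
  proof (cases "b \<ge> 2")
    case True
    with assms(1) polylog_mult that show ?thesis by blast
  next
    case False
    with assms have "b \<ge> 1" "a \<ge> 2" by auto
    then obtain c where "\<And>u. polylog b u * polylog a u = polylog (b + a) u + (\<Sum>j\<in>{2..<b
        + a}. fps_const (c j) * polylog j u)"
      using polylog_mult by blast
    then show ?thesis by (intro that[of c]) (simp add: add.commute mult.commute)
  qed
  define d where "d j = (if j = a + b then 1 else c j)" for j
  have "(\<lambda>u. polylog a u * polylog b u) = (\<lambda>u. \<Sum>j\<in>{2..a + b}. fps_const (d j) * polylog j u)"
  proof
    fix u
    have "{2..a + b} = insert (a + b) {2..<a + b}" using assms by auto
    then show "polylog a u * polylog b u = (\<Sum>j\<in>{2..a + b}. fps_const (d j) * polylog j u)"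
      by (simp add: c d_def)
  qed
  then have "bracket (pre @ (\<lambda>u. polylog a u * polylog b u) # post) = (\<Sum>j\<in>{2..a
      + b}. fps_const (d j) * bracket (pre @ polylog j # post))"
    by (simp only: bracket_linear)
  also have "\<dots> = bracket (pre @ polylog (a + b) # post) + (\<Sum>j\<in>{2..<a + b}. fps_const (c j) *
      bracket (pre @ polylog j # post))"
  proof -
    have "{2..a + b} = insert (a + b) {2..<a + b}" using assms by auto
    then show ?thesis by (simp add: d_def)
  qed
  finally show ?thesis
    using assms(4) by (auto intro!: sum_in_G G_sh_le_lin)
qed

lemma e_word_simps:
  "ek a = e_word [a]"
  "e_word ks * e_word ls = e_word (ks @ ls)"
  by (simp_all add: e_word_def)

section \<open>The double shuffle defect in low depth\<close>

text \<open>\<open>L\<^sub>j L\<^sub>1 L\<^sub>c\<close> is the one term of the product of \<open>L\<^sub>c\<close> and \<open>L\<^sub>j L\<^sub>1\<close> that is not visibly a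
  \<open>g\<^sup>s\<^sup>h\<close>.\<close>

lemma bracket_inner_1_in_G:
  assumes "j \<ge> 2" "c \<ge> 2" "j + 1 + c \<le> W"
  shows "bracket [polylog j, polylog 1, polylog c] \<in> G_sh_le W"
proof -
  have m1: "bracket [\<lambda>u. polylog c u * polylog j u, polylog 1] - bracket [polylog (c
      + j), polylog 1] \<in> G_sh_le W"
    using bracket_merge[of c j "[]" "[polylog 1]" W] bracket_in_G[of "[i, 1]" W for i] assms
        by simp
  have m2: "bracket [polylog j, \<lambda>u. polylog c u * polylog 1 u] - bracket [polylog j, polylog (c
      + 1)] \<in> G_sh_le W"
    using bracket_merge[of c 1 "[polylog j]" "[]" W] bracket_in_G[of "[j, i]" W for i] assms
        by simp
  have m3: "bracket [polylog (c + j), polylog 1] \<in> G_sh_le W" "bracket [polylog j, polylog (c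
      + 1)] \<in> G_sh_le W"
      "bracket [polylog c, polylog j, polylog 1] \<in> G_sh_le W" "bracket [polylog j, polylog c,
          polylog 1] \<in> G_sh_le W"
    using bracket_in_G[of "[c + j, 1]" W] bracket_in_G[of "[j, c + 1]" W]
        bracket_in_G[of "[c, j, 1]" W]
      bracket_in_G[of "[j, c, 1]" W] assms by simp_all
  have m4: "bracket [polylog c] * bracket [polylog j, polylog 1] \<in> G_sh_le W"
    using g_sh_mult_in_G[of "[c]" "[j, 1]" W] g_sh_eq_bracket[of "[c]"] g_sh_eq_bracket[of "[j,
        1]"] assms by simp
  \<comment> \<open>The quasi-shuffle product is solved for the term with the inner 1, and each
    merged slot is written as its replacement plus an error.\<close>
  have "bracket [polylog j, polylog 1, polylog c] = bracket [polylog c] *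
      bracket [polylog j, polylog 1]
      - bracket [polylog c, polylog j, polylog 1] - bracket [polylog j, polylog c, polylog 1]
      - (bracket [\<lambda>u. polylog c u * polylog j u, polylog 1] - bracket [polylog (c
          + j), polylog 1]) - bracket [polylog (c + j), polylog 1]
      - (bracket [polylog j, \<lambda>u. polylog c u * polylog 1 u] - bracket [polylog j, polylog (c
          + 1)]) - bracket [polylog j, polylog (c + 1)]"
    using bracket_mult[of "[polylog c]" "[polylog j, polylog 1]"]
        by (simp add: q_divisible_polylog)
  also have "\<dots> \<in> G_sh_le W"
    by (intro G_sh_le_lin(2) m1 m2 m3 m4)
  finally show ?thesis .
qed

text \<open>Harmonic words and quasi-shuffle terms correspond one to one, so the brackets cancel up
  to merged slots and the corrections for entries 1. Those of \<open>[1, a, b]\<close> and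
  \<open>[a, 1, b]\<close> telescope to the index weight in the last slot.\<close>

lemma ds_1_2:
  assumes "a \<ge> 2" "b \<ge> 2" "a + b \<le> W"
  shows "g_sh_map (ds (e_word [1]) (e_word [a, b])) - fps_const (1/2) * (bracket [polylog a,
      wpolylog b]) \<in> G_sh_le W"
proof -
  define M1 where "M1 = bracket [polylog a, \<lambda>u. polylog 1 u * polylog b u] -
      bracket [polylog a, polylog (1+b)]"
  define M2 where "M2 = bracket [\<lambda>u. polylog 1 u * polylog a u, polylog b] -
      bracket [polylog (1+a), polylog b]"
  define C1 where "C1 = bracket [polylog a, polylog b]"
  \<comment> \<open>The exact error: half of \<open>C1\<close> from each correction, and
    \<open>M1\<close>, \<open>M2\<close> from the two merged slots.\<close>
  have eq: "g_sh_map (ds (e_word [1]) (e_word [a, b])) - fps_const (1/2) * (bracket [polylog a,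
      wpolylog b]) =
     0 - fps_const (1/2) * C1 - fps_const (1/2) * C1 - M1 - M2"
  proof -
    have 1: "g_sh_map (ds (e_word [1]) (e_word [a, b])) =
      g_sh [1, a, b] + (g_sh [a, 1, b] + (g_sh [a, b, 1] + (g_sh [a, 1+b] + (g_sh [1+a, b]))))
       - g_sh [1] * g_sh [a, b]"
      by (subst g_sh_map_ds) (use assms in \<open>simp_all add: add_ac\<close>)
    have 2: "g_sh [1] * g_sh [a, b] =
      bracket [polylog 1, polylog a, polylog b] + (bracket [polylog a, polylog 1, polylog b]
          + (bracket [polylog a, polylog b, polylog 1] + (bracket [polylog a, \<lambda>u. polylog 1 u *
          polylog b u] + (bracket [\<lambda>u. polylog 1 u * polylog a u, polylog b]))))"
      using bracket_mult[of "[polylog 1]" "[polylog a, polylog b]"] g_sh_eq_bracket[of "[1]"]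
          g_sh_eq_bracket[of "[a, b]"] assms
      by (simp add: q_divisible_polylog add_ac)
    have 3: "g_sh [1, a, b] = bracket [polylog 1, polylog a, polylog b]
        + fps_const (1/2) * (bracket [wpolylog a, polylog b] - C1)"
      using g_sh_leading_1[of "a" "[b]"] assms by (simp add: C1_def)
    have 4: "g_sh [a, 1, b] = bracket [polylog a, polylog 1, polylog b]
        + fps_const (1/2) * (bracket [polylog a, wpolylog b] - bracket [wpolylog a, polylog b]
        - C1)"
      using g_sh_inner_1[of "[]" "a" "b" "[]"] assms by (simp add: C1_def)
    have 5: "g_sh [a, b, 1] = bracket [polylog a, polylog b, polylog 1]"
      using g_sh_eq_bracket[of "[a, b, 1]"] assms by simp
    have 6: "g_sh [a, 1+b] = bracket [polylog a, polylog (1+b)]"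
      using g_sh_eq_bracket[of "[a, 1+b]"] assms by simp
    have 7: "g_sh [1+a, b] = bracket [polylog (1+a), polylog b]"
      using g_sh_eq_bracket[of "[1+a, b]"] assms by simp
    show ?thesis
      unfolding M1_def M2_def 1 2 3 4 5 6 7 by (simp add: algebra_simps)
  qed
  have "M1 \<in> G_sh_le W"
    using bracket_merge[of 1 b "[polylog a]" "[]" W] bracket_in_G[of "[a, j]" W for j] assms
        by (simp add: M1_def)
  moreover have "M2 \<in> G_sh_le W"
    using bracket_merge[of 1 a "[]" "[polylog b]" W] bracket_in_G[of "[j, b]" W for j] assms
        by (simp add: M2_def)
  moreover have "C1 \<in> G_sh_le W"
    using bracket_in_G[of "[a, b]" W] assms by (simp add: C1_def)
  ultimately show ?thesis unfolding eq by (intro G_sh_le_lin)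
qed

text \<open>Among the harmonic words only \<open>[a, 1, b]\<close> has a 1 before its last place, so
  a single correction remains.\<close>

lemma ds_tail_1_2:
  assumes "a \<ge> 2" "b \<ge> 2" "a + b \<le> W"
  shows "g_sh_map (ds (e_word [b]) (e_word [a, 1])) - fps_const (1/2) * (bracket [polylog a,
      wpolylog b] - bracket [wpolylog a, polylog b]) \<in> G_sh_le W"
proof -
  define M1 where "M1 = bracket [polylog a, \<lambda>u. polylog b u * polylog 1 u] -
      bracket [polylog a, polylog (b+1)]"
  define M2 where "M2 = bracket [\<lambda>u. polylog b u * polylog a u, polylog 1] -
      bracket [polylog (b+a), polylog 1]"
  define C1 where "C1 = bracket [polylog a, polylog b]"
  have eq: "g_sh_map (ds (e_word [b]) (e_word [a, 1])) - fps_const (1/2) * (bracket [polylog a,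
      wpolylog b] - bracket [wpolylog a, polylog b]) =
     0 - fps_const (1/2) * C1 - M1 - M2"
  proof -
    have 1: "g_sh_map (ds (e_word [b]) (e_word [a, 1])) =
      g_sh [b, a, 1] + (g_sh [a, b, 1] + (g_sh [a, 1, b] + (g_sh [a, b+1] + (g_sh [b+a, 1]))))
       - g_sh [b] * g_sh [a, 1]"
      by (subst g_sh_map_ds) (use assms in \<open>simp_all add: add_ac\<close>)
    have 2: "g_sh [b] * g_sh [a, 1] =
      bracket [polylog b, polylog a, polylog 1] + (bracket [polylog a, polylog b, polylog 1]
          + (bracket [polylog a, polylog 1, polylog b] + (bracket [polylog a, \<lambda>u. polylog b u *
          polylog 1 u] + (bracket [\<lambda>u. polylog b u * polylog a u, polylog 1]))))"
      using bracket_mult[of "[polylog b]" "[polylog a, polylog 1]"] g_sh_eq_bracket[of "[b]"]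
          g_sh_eq_bracket[of "[a, 1]"] assms
      by (simp add: q_divisible_polylog add_ac)
    have 3: "g_sh [b, a, 1] = bracket [polylog b, polylog a, polylog 1]"
      using g_sh_eq_bracket[of "[b, a, 1]"] assms by simp
    have 4: "g_sh [a, b, 1] = bracket [polylog a, polylog b, polylog 1]"
      using g_sh_eq_bracket[of "[a, b, 1]"] assms by simp
    have 5: "g_sh [a, 1, b] = bracket [polylog a, polylog 1, polylog b]
        + fps_const (1/2) * (bracket [polylog a, wpolylog b] - bracket [wpolylog a, polylog b]
        - C1)"
      using g_sh_inner_1[of "[]" "a" "b" "[]"] assms by (simp add: C1_def)
    have 6: "g_sh [a, b+1] = bracket [polylog a, polylog (b+1)]"
      using g_sh_eq_bracket[of "[a, b+1]"] assms by simp
    have 7: "g_sh [b+a, 1] = bracket [polylog (b+a), polylog 1]"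
      using g_sh_eq_bracket[of "[b+a, 1]"] assms by simp
    show ?thesis
      unfolding M1_def M2_def 1 2 3 4 5 6 7 by (simp add: algebra_simps)
  qed
  have "M1 \<in> G_sh_le W"
    using bracket_merge[of b 1 "[polylog a]" "[]" W] bracket_in_G[of "[a, j]" W for j] assms
        by (simp add: M1_def)
  moreover have "M2 \<in> G_sh_le W"
    using bracket_merge[of b a "[]" "[polylog 1]" W] bracket_in_G[of "[j, 1]" W for j] assms
        by (simp add: M2_def)
  moreover have "C1 \<in> G_sh_le W"
    using bracket_in_G[of "[a, b]" W] assms by (simp add: C1_def)
  ultimately show ?thesis unfolding eq by (intro G_sh_le_lin)
qed

text \<open>The entry 1 precedes \<open>a\<close>, \<open>b\<close> or \<open>c\<close> in turn, and
  the three corrections telescope to the index weight in the last slot.\<close>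

lemma ds_1_3:
  assumes "a \<ge> 2" "b \<ge> 2" "c \<ge> 2" "a + b + c \<le> W"
  shows "g_sh_map (ds (e_word [1]) (e_word [a, b, c])) - fps_const (1/2) * (bracket [polylog a,
      polylog b, wpolylog c]) \<in> G_sh_le W"
proof -
  define M1 where "M1 = bracket [polylog a, polylog b, \<lambda>u. polylog 1 u * polylog c u] -
      bracket [polylog a, polylog b, polylog (1+c)]"
  define M2 where "M2 = bracket [polylog a, \<lambda>u. polylog 1 u * polylog b u, polylog c] -
      bracket [polylog a, polylog (1+b), polylog c]"
  define M3 where "M3 = bracket [\<lambda>u. polylog 1 u * polylog a u, polylog b, polylog c] -
      bracket [polylog (1+a), polylog b, polylog c]"
  define C1 where "C1 = bracket [polylog a, polylog b, polylog c]"
  have eq: "g_sh_map (ds (e_word [1]) (e_word [a, b, c])) - fps_const (1/2) * (bracket [polylog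
      a, polylog b, wpolylog c]) =
     0 - fps_const (1/2) * C1 - fps_const (1/2) * C1 - fps_const (1/2) * C1 - M1 - M2 - M3"
  proof -
    have 1: "g_sh_map (ds (e_word [1]) (e_word [a, b, c])) =
      g_sh [1, a, b, c] + (g_sh [a, 1, b, c] + (g_sh [a, b, 1, c] + (g_sh [a, b, c, 1]
          + (g_sh [a, b, 1+c] + (g_sh [a, 1+b, c] + (g_sh [1+a, b, c]))))))
       - g_sh [1] * g_sh [a, b, c]"
      by (subst g_sh_map_ds) (use assms in \<open>simp_all add: add_ac\<close>)
    have 2: "g_sh [1] * g_sh [a, b, c] =
      bracket [polylog 1, polylog a, polylog b, polylog c] + (bracket [polylog a, polylog 1,
          polylog b, polylog c] + (bracket [polylog a, polylog b, polylog 1, polylog c]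
          + (bracket [polylog a, polylog b, polylog c, polylog 1]
          + (bracket [polylog a, polylog b, \<lambda>u. polylog 1 u * polylog c u]
          + (bracket [polylog a, \<lambda>u. polylog 1 u * polylog b u, polylog c]
          + (bracket [\<lambda>u. polylog 1 u * polylog a u, polylog b, polylog c]))))))"
      using bracket_mult[of "[polylog 1]" "[polylog a, polylog b, polylog c]"] g_sh_eq_bracket[of
          "[1]"] g_sh_eq_bracket[of "[a, b, c]"] assms
      by (simp add: q_divisible_polylog add_ac)
    have 3: "g_sh [1, a, b, c] = bracket [polylog 1, polylog a, polylog b, polylog c]
        + fps_const (1/2) * (bracket [wpolylog a, polylog b, polylog c] - C1)"
      using g_sh_leading_1[of "a" "[b, c]"] assms by (simp add: C1_def)
    have 4: "g_sh [a, 1, b, c] = bracket [polylog a, polylog 1, polylog b, polylog c]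
        + fps_const (1/2) * (bracket [polylog a, wpolylog b, polylog c] -
        bracket [wpolylog a, polylog b, polylog c] - C1)"
      using g_sh_inner_1[of "[]" "a" "b" "[c]"] assms by (simp add: C1_def)
    have 5: "g_sh [a, b, 1, c] = bracket [polylog a, polylog b, polylog 1, polylog c]
        + fps_const (1/2) * (bracket [polylog a, polylog b, wpolylog c] -
        bracket [polylog a, wpolylog b, polylog c] - C1)"
      using g_sh_inner_1[of "[a]" "b" "c" "[]"] assms by (simp add: C1_def)
    have 6: "g_sh [a, b, c, 1] = bracket [polylog a, polylog b, polylog c, polylog 1]"
      using g_sh_eq_bracket[of "[a, b, c, 1]"] assms by simp
    have 7: "g_sh [a, b, 1+c] = bracket [polylog a, polylog b, polylog (1+c)]"
      using g_sh_eq_bracket[of "[a, b, 1+c]"] assms by simp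
    have 8: "g_sh [a, 1+b, c] = bracket [polylog a, polylog (1+b), polylog c]"
      using g_sh_eq_bracket[of "[a, 1+b, c]"] assms by simp
    have 9: "g_sh [1+a, b, c] = bracket [polylog (1+a), polylog b, polylog c]"
      using g_sh_eq_bracket[of "[1+a, b, c]"] assms by simp
    show ?thesis
      unfolding M1_def M2_def M3_def 1 2 3 4 5 6 7 8 9 by (simp add: algebra_simps)
  qed
  have "M1 \<in> G_sh_le W"
    using bracket_merge[of 1 c "[polylog a, polylog b]" "[]" W]
        bracket_in_G[of "[a, b, j]" W for j] assms by (simp add: M1_def)
  moreover have "M2 \<in> G_sh_le W"
    using bracket_merge[of 1 b "[polylog a]" "[polylog c]" W]
        bracket_in_G[of "[a, j, c]" W for j] assms by (simp add: M2_def)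
  moreover have "M3 \<in> G_sh_le W"
    using bracket_merge[of 1 a "[]" "[polylog b, polylog c]" W]
        bracket_in_G[of "[j, b, c]" W for j] assms by (simp add: M3_def)
  moreover have "C1 \<in> G_sh_le W"
    using bracket_in_G[of "[a, b, c]" W] assms by (simp add: C1_def)
  ultimately show ?thesis unfolding eq by (intro G_sh_le_lin)
qed

text \<open>Only \<open>[a, b, 1, c]\<close> is corrected, as the 1 is last in every other harmonic
  word that contains it as a separate entry.\<close>

lemma ds_tail_1_3:
  assumes "a \<ge> 2" "b \<ge> 2" "c \<ge> 2" "a + b + c \<le> W"
  shows "g_sh_map (ds (e_word [c]) (e_word [a, b, 1])) - fps_const (1/2) * (bracket [polylog a,
      polylog b, wpolylog c] - bracket [polylog a, wpolylog b, polylog c]) \<in> G_sh_le W"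
proof -
  define M1 where "M1 = bracket [polylog a, polylog b, \<lambda>u. polylog c u * polylog 1 u] -
      bracket [polylog a, polylog b, polylog (c+1)]"
  define M2 where "M2 = bracket [polylog a, \<lambda>u. polylog c u * polylog b u, polylog 1] -
      bracket [polylog a, polylog (c+b), polylog 1]"
  define M3 where "M3 = bracket [\<lambda>u. polylog c u * polylog a u, polylog b, polylog 1] -
      bracket [polylog (c+a), polylog b, polylog 1]"
  define C1 where "C1 = bracket [polylog a, polylog b, polylog c]"
  have eq: "g_sh_map (ds (e_word [c]) (e_word [a, b, 1])) - fps_const (1/2) * (bracket [polylog
      a, polylog b, wpolylog c] - bracket [polylog a, wpolylog b, polylog c]) =
     0 - fps_const (1/2) * C1 - M1 - M2 - M3"
  proof -
    have 1: "g_sh_map (ds (e_word [c]) (e_word [a, b, 1])) =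
      g_sh [c, a, b, 1] + (g_sh [a, c, b, 1] + (g_sh [a, b, c, 1] + (g_sh [a, b, 1, c]
          + (g_sh [a, b, c+1] + (g_sh [a, c+b, 1] + (g_sh [c+a, b, 1]))))))
       - g_sh [c] * g_sh [a, b, 1]"
      by (subst g_sh_map_ds) (use assms in \<open>simp_all add: add_ac\<close>)
    have 2: "g_sh [c] * g_sh [a, b, 1] =
      bracket [polylog c, polylog a, polylog b, polylog 1] + (bracket [polylog a, polylog c,
          polylog b, polylog 1] + (bracket [polylog a, polylog b, polylog c, polylog 1]
          + (bracket [polylog a, polylog b, polylog 1, polylog c]
          + (bracket [polylog a, polylog b, \<lambda>u. polylog c u * polylog 1 u]
          + (bracket [polylog a, \<lambda>u. polylog c u * polylog b u, polylog 1]
          + (bracket [\<lambda>u. polylog c u * polylog a u, polylog b, polylog 1]))))))"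
      using bracket_mult[of "[polylog c]" "[polylog a, polylog b, polylog 1]"] g_sh_eq_bracket[of
          "[c]"] g_sh_eq_bracket[of "[a, b, 1]"] assms
      by (simp add: q_divisible_polylog add_ac)
    have 3: "g_sh [c, a, b, 1] = bracket [polylog c, polylog a, polylog b, polylog 1]"
      using g_sh_eq_bracket[of "[c, a, b, 1]"] assms by simp
    have 4: "g_sh [a, c, b, 1] = bracket [polylog a, polylog c, polylog b, polylog 1]"
      using g_sh_eq_bracket[of "[a, c, b, 1]"] assms by simp
    have 5: "g_sh [a, b, c, 1] = bracket [polylog a, polylog b, polylog c, polylog 1]"
      using g_sh_eq_bracket[of "[a, b, c, 1]"] assms by simp
    have 6: "g_sh [a, b, 1, c] = bracket [polylog a, polylog b, polylog 1, polylog c]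
        + fps_const (1/2) * (bracket [polylog a, polylog b, wpolylog c] -
        bracket [polylog a, wpolylog b, polylog c] - C1)"
      using g_sh_inner_1[of "[a]" "b" "c" "[]"] assms by (simp add: C1_def)
    have 7: "g_sh [a, b, c+1] = bracket [polylog a, polylog b, polylog (c+1)]"
      using g_sh_eq_bracket[of "[a, b, c+1]"] assms by simp
    have 8: "g_sh [a, c+b, 1] = bracket [polylog a, polylog (c+b), polylog 1]"
      using g_sh_eq_bracket[of "[a, c+b, 1]"] assms by simp
    have 9: "g_sh [c+a, b, 1] = bracket [polylog (c+a), polylog b, polylog 1]"
      using g_sh_eq_bracket[of "[c+a, b, 1]"] assms by simp
    show ?thesis
      unfolding M1_def M2_def M3_def 1 2 3 4 5 6 7 8 9 by (simp add: algebra_simps)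
  qed
  have "M1 \<in> G_sh_le W"
    using bracket_merge[of c 1 "[polylog a, polylog b]" "[]" W]
        bracket_in_G[of "[a, b, j]" W for j] assms by (simp add: M1_def)
  moreover have "M2 \<in> G_sh_le W"
    using bracket_merge[of c b "[polylog a]" "[polylog 1]" W]
        bracket_in_G[of "[a, j, 1]" W for j] assms by (simp add: M2_def)
  moreover have "M3 \<in> G_sh_le W"
    using bracket_merge[of c a "[]" "[polylog b, polylog 1]" W]
        bracket_in_G[of "[j, b, 1]" W for j] assms by (simp add: M3_def)
  moreover have "C1 \<in> G_sh_le W"
    using bracket_in_G[of "[a, b, c]" W] assms by (simp add: C1_def)
  ultimately show ?thesis unfolding eq by (intro G_sh_le_lin)
qed

text \<open>Corrections come from \<open>[a, 1, b, c]\<close>, \<open>[a, b, 1, c]\<close>,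
  \<open>[b, a, 1, c]\<close> and \<open>[a + b, 1, c]\<close>. The first two telescope to the first
  difference; the others give one difference each.\<close>

lemma ds_2_2:
  assumes "a \<ge> 2" "b \<ge> 2" "c \<ge> 2" "a + b + c \<le> W"
  shows "g_sh_map (ds (e_word [a, 1]) (e_word [b, c])) - fps_const (1/2) * (bracket [polylog a,
      polylog b, wpolylog c] - bracket [wpolylog a, polylog b, polylog c]
      + (bracket [polylog b, polylog a, wpolylog c] - bracket [polylog b, wpolylog a, polylog c])
      + (bracket [polylog (a+b), wpolylog c] - bracket [wpolylog (a+b), polylog c])) \<in> G_sh_le W"
proof -
  define M1 where "M1 = bracket [polylog a, polylog b, \<lambda>u. polylog 1 u * polylog c u] -
      bracket [polylog a, polylog b, polylog (1+c)]"
  define M2 where "M2 = bracket [polylog a, \<lambda>u. polylog 1 u * polylog b u, polylog c] -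
      bracket [polylog a, polylog (1+b), polylog c]"
  define M3 where "M3 = bracket [polylog b, polylog a, \<lambda>u. polylog 1 u * polylog c u] -
      bracket [polylog b, polylog a, polylog (1+c)]"
  define M4 where "M4 = bracket [polylog b, \<lambda>u. polylog a u * polylog c u, polylog 1] -
      bracket [polylog b, polylog (a+c), polylog 1]"
  define M5 where "M5 = bracket [\<lambda>u. polylog a u * polylog b u, polylog 1, polylog c] -
      bracket [polylog (a+b), polylog 1, polylog c]"
  define M6 where "M6 = bracket [\<lambda>u. polylog a u * polylog b u, polylog c, polylog 1] -
      bracket [polylog (a+b), polylog c, polylog 1]"
  \<comment> \<open>The term with two merged slots is reduced in two stages, the first slot in
    \<open>M7\<close> and the second in \<open>M8\<close>.\<close>
  define M7 where "M7 = bracket [\<lambda>u. polylog a u * polylog b u, \<lambda>u. polylog 1 u * polylog c u] -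
      bracket [polylog (a+b), \<lambda>u. polylog 1 u * polylog c u]"
  define M8 where "M8 = bracket [polylog (a+b), \<lambda>u. polylog 1 u * polylog c u] -
      bracket [polylog (a+b), polylog (1+c)]"
  define C1 where "C1 = bracket [polylog a, polylog b, polylog c]"
  define C2 where "C2 = bracket [polylog b, polylog a, polylog c]"
  define C3 where "C3 = bracket [polylog (a+b), polylog c]"
  have eq: "g_sh_map (ds (e_word [a, 1]) (e_word [b, c])) - fps_const (1/2) * (bracket [polylog
      a, polylog b, wpolylog c] - bracket [wpolylog a, polylog b, polylog c]
      + (bracket [polylog b, polylog a, wpolylog c] - bracket [polylog b, wpolylog a, polylog c])
      + (bracket [polylog (a+b), wpolylog c] - bracket [wpolylog (a+b), polylog c])) =
     0 - fps_const (1/2) * C1 - fps_const (1/2) * C1 - fps_const (1/2) * C2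
         - fps_const (1/2) * C3 - M1 - M2 - M3 - M4 - M5 - M6 - M7 - M8"
  proof -
    have 1: "g_sh_map (ds (e_word [a, 1]) (e_word [b, c])) =
      g_sh [a, 1, b, c] + (g_sh [a, b, 1, c] + (g_sh [a, b, c, 1] + (g_sh [a, b, 1+c]
          + (g_sh [a, 1+b, c] + (g_sh [b, a, 1, c] + (g_sh [b, a, c, 1] + (g_sh [b, a, 1+c]
          + (g_sh [b, c, a, 1] + (g_sh [b, a+c, 1] + (g_sh [a+b, 1, c] + (g_sh [a+b, c, 1]
          + (g_sh [a+b, 1+c]))))))))))))
       - g_sh [a, 1] * g_sh [b, c]"
      by (subst g_sh_map_ds) (use assms in \<open>simp_all add: add_ac\<close>)
    have 2: "g_sh [a, 1] * g_sh [b, c] =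
      bracket [polylog a, polylog 1, polylog b, polylog c] + (bracket [polylog a, polylog b,
          polylog 1, polylog c] + (bracket [polylog a, polylog b, polylog c, polylog 1]
          + (bracket [polylog a, polylog b, \<lambda>u. polylog 1 u * polylog c u]
          + (bracket [polylog a, \<lambda>u. polylog 1 u * polylog b u, polylog c]
          + (bracket [polylog b, polylog a, polylog 1, polylog c]
          + (bracket [polylog b, polylog a, polylog c, polylog 1]
          + (bracket [polylog b, polylog a, \<lambda>u. polylog 1 u * polylog c u]
          + (bracket [polylog b, polylog c, polylog a, polylog 1]
          + (bracket [polylog b, \<lambda>u. polylog a u * polylog c u, polylog 1]
          + (bracket [\<lambda>u. polylog a u * polylog b u, polylog 1, polylog c]
          + (bracket [\<lambda>u. polylog a u * polylog b u, polylog c, polylog 1]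
          + (bracket [\<lambda>u. polylog a u * polylog b u, \<lambda>u. polylog 1 u * polylog c u]))))))))))))"
      using bracket_mult[of "[polylog a, polylog 1]" "[polylog b, polylog c]"] g_sh_eq_bracket[of
          "[a, 1]"] g_sh_eq_bracket[of "[b, c]"] assms
      by (simp add: q_divisible_polylog add_ac)
    have 3: "g_sh [a, 1, b, c] = bracket [polylog a, polylog 1, polylog b, polylog c]
        + fps_const (1/2) * (bracket [polylog a, wpolylog b, polylog c] -
        bracket [wpolylog a, polylog b, polylog c] - C1)"
      using g_sh_inner_1[of "[]" "a" "b" "[c]"] assms by (simp add: C1_def)
    have 4: "g_sh [a, b, 1, c] = bracket [polylog a, polylog b, polylog 1, polylog c]
        + fps_const (1/2) * (bracket [polylog a, polylog b, wpolylog c] -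
        bracket [polylog a, wpolylog b, polylog c] - C1)"
      using g_sh_inner_1[of "[a]" "b" "c" "[]"] assms by (simp add: C1_def)
    have 5: "g_sh [a, b, c, 1] = bracket [polylog a, polylog b, polylog c, polylog 1]"
      using g_sh_eq_bracket[of "[a, b, c, 1]"] assms by simp
    have 6: "g_sh [a, b, 1+c] = bracket [polylog a, polylog b, polylog (1+c)]"
      using g_sh_eq_bracket[of "[a, b, 1+c]"] assms by simp
    have 7: "g_sh [a, 1+b, c] = bracket [polylog a, polylog (1+b), polylog c]"
      using g_sh_eq_bracket[of "[a, 1+b, c]"] assms by simp
    have 8: "g_sh [b, a, 1, c] = bracket [polylog b, polylog a, polylog 1, polylog c]
        + fps_const (1/2) * (bracket [polylog b, polylog a, wpolylog c] -
        bracket [polylog b, wpolylog a, polylog c] - C2)"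
      using g_sh_inner_1[of "[b]" "a" "c" "[]"] assms by (simp add: C2_def)
    have 9: "g_sh [b, a, c, 1] = bracket [polylog b, polylog a, polylog c, polylog 1]"
      using g_sh_eq_bracket[of "[b, a, c, 1]"] assms by simp
    have 10: "g_sh [b, a, 1+c] = bracket [polylog b, polylog a, polylog (1+c)]"
      using g_sh_eq_bracket[of "[b, a, 1+c]"] assms by simp
    have 11: "g_sh [b, c, a, 1] = bracket [polylog b, polylog c, polylog a, polylog 1]"
      using g_sh_eq_bracket[of "[b, c, a, 1]"] assms by simp
    have 12: "g_sh [b, a+c, 1] = bracket [polylog b, polylog (a+c), polylog 1]"
      using g_sh_eq_bracket[of "[b, a+c, 1]"] assms by simp
    have 13: "g_sh [a+b, 1, c] = bracket [polylog (a+b), polylog 1, polylog c]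
        + fps_const (1/2) * (bracket [polylog (a+b), wpolylog c] -
        bracket [wpolylog (a+b), polylog c] - C3)"
      using g_sh_inner_1[of "[]" "a+b" "c" "[]"] assms by (simp add: C3_def)
    have 14: "g_sh [a+b, c, 1] = bracket [polylog (a+b), polylog c, polylog 1]"
      using g_sh_eq_bracket[of "[a+b, c, 1]"] assms by simp
    have 15: "g_sh [a+b, 1+c] = bracket [polylog (a+b), polylog (1+c)]"
      using g_sh_eq_bracket[of "[a+b, 1+c]"] assms by simp
    show ?thesis
      unfolding M1_def M2_def M3_def M4_def M5_def M6_def M7_def M8_def 1 2 3 4 5 6 7 8 9 10 11
          12 13 14 15 by (simp add: algebra_simps)
  qed
  have "M1 \<in> G_sh_le W"
    using bracket_merge[of 1 c "[polylog a, polylog b]" "[]" W]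
        bracket_in_G[of "[a, b, j]" W for j] assms by (simp add: M1_def)
  moreover have "M2 \<in> G_sh_le W"
    using bracket_merge[of 1 b "[polylog a]" "[polylog c]" W]
        bracket_in_G[of "[a, j, c]" W for j] assms by (simp add: M2_def)
  moreover have "M3 \<in> G_sh_le W"
    using bracket_merge[of 1 c "[polylog b, polylog a]" "[]" W]
        bracket_in_G[of "[b, a, j]" W for j] assms by (simp add: M3_def)
  moreover have "M4 \<in> G_sh_le W"
    using bracket_merge[of a c "[polylog b]" "[polylog 1]" W]
        bracket_in_G[of "[b, j, 1]" W for j] assms by (simp add: M4_def)
  \<comment> \<open>The lower terms \<open>[L_j, L_1, L_c]\<close> have an inner 1, so
    \<open>bracket_inner_1_in_G\<close> replaces \<open>bracket_in_G\<close>.\<close>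
  moreover have "M5 \<in> G_sh_le W"
    using bracket_merge[of a b "[]" "[polylog 1, polylog c]" W]
        bracket_inner_1_in_G[of j c W for j] assms by (simp add: M5_def)
  moreover have "M6 \<in> G_sh_le W"
    using bracket_merge[of a b "[]" "[polylog c, polylog 1]" W]
        bracket_in_G[of "[j, c, 1]" W for j] assms by (simp add: M6_def)
  \<comment> \<open>The lower terms still carry a product in the second slot, which has to be merged
    as well before they are seen to lie in the filtration.\<close>
  moreover have "M7 \<in> G_sh_le W"
    unfolding M7_def
  proof (rule bracket_merge[of a b "[]" "[\<lambda>u. polylog 1 u * polylog c u]" W, simplified
      append_Nil])
    fix j assume j: "2 \<le> j" "j < a + b"
    have "bracket [polylog j, \<lambda>u. polylog 1 u * polylog c u] - bracket [polylog j, polylog (1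
        + c)] \<in> G_sh_le W"
      using bracket_merge[of 1 c "[polylog j]" "[]" W] bracket_in_G[of "[j, i]" W for i] assms j
          by simp
    moreover have "bracket [polylog j, polylog (1 + c)] \<in> G_sh_le W"
      using bracket_in_G[of "[j, 1 + c]" W] assms j by simp
    ultimately show "bracket [polylog j, \<lambda>u. polylog 1 u * polylog c u] \<in> G_sh_le W"
        using G_sh_le_lin(1) by fastforce
  qed (use assms in simp_all)
  moreover have "M8 \<in> G_sh_le W"
    using bracket_merge[of 1 c "[polylog (a+b)]" "[]" W] bracket_in_G[of "[a+b, j]" W for j]
        assms by (simp add: M8_def)
  moreover have "C1 \<in> G_sh_le W"
    using bracket_in_G[of "[a, b, c]" W] assms by (simp add: C1_def)
  moreover have "C2 \<in> G_sh_le W"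
    using bracket_in_G[of "[b, a, c]" W] assms by (simp add: C2_def)
  moreover have "C3 \<in> G_sh_le W"
    using bracket_in_G[of "[a+b, c]" W] assms by (simp add: C3_def)
  ultimately show ?thesis unfolding eq by (intro G_sh_le_lin)
qed

section \<open>Assembly of the derivative formulas\<close>

text \<open>Turns a congruence into an equation with a named error, so that the final combinations
  reduce to ring arithmetic.\<close>

lemma obtain_double:
  assumes "d - fps_const (1/2) * x \<in> G_sh_le W"
  obtains e where "e \<in> G_sh_le W" and "2 * d = x + e"
proof
  show "of_nat 2 * (d - fps_const (1/2) * x) \<in> G_sh_le W"
    by (rule G_sh_le_lin(4)[OF assms])
  have "2 * (fps_const (1/2) * x) = x"
    by (simp add: numeral_fps_const mult.assoc[symmetric])
  then show "2 * d = x + of_nat 2 * (d - fps_const (1/2) * x)"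
    by (simp add: right_diff_distrib)
qed

theorem theorem4p10:
  fixes k1 k2 k3 :: nat
  assumes "k1 \<ge> 2" and "k2 \<ge> 2" and "k3 \<ge> 2"
  shows
    "q_deriv (g_sh [k1, k2])
      - (of_nat (2 * k1) * (g_sh_map (ds (ek 1) (ek (k1 + 1) * ek k2))
            - g_sh_map (ds (ek k2) (ek (k1 + 1) * ek 1)))
         + of_nat (2 * k2) * g_sh_map (ds (ek 1) (ek k1 * ek (k2 + 1))))
      \<in> G_sh_le (k1 + k2 + 1)
    \<and>
     q_deriv (g_sh [k1, k2, k3])
      - (of_nat (2 * k1) * g_sh_map (ds (ek 1) (ek (k1 + 1) * ek k2 * ek k3)
            + ds (ek k3) (ek k2 * ek (k1 + 1) * ek 1))
         + of_nat (2 * k1) * g_sh_map (ds (ek k3) (ek (k1 + 1 + k2) * ek 1)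
            - ds (ek (k1 + 1) * ek 1) (ek k2 * ek k3))
         + of_nat (2 * k2) * g_sh_map (ds (ek 1) (ek k1 * ek (k2 + 1) * ek k3)
            - ds (ek k3) (ek k1 * ek (k2 + 1) * ek 1))
         + of_nat (2 * k3) * g_sh_map (ds (ek 1) (ek k1 * ek k2 * ek (k3 + 1))))
      \<in> G_sh_le (k1 + k2 + k3 + 1)"
proof -
  let ?gds = "\<lambda>ks ls. g_sh_map (ds (e_word ks) (e_word ls))"
  have double: "of_nat (2 * k) * x = of_nat k * (2 * x)" for k and x :: "rat fps"
    by (simp add: mult_ac)
  have part1: "q_deriv (g_sh [k1, k2])
      - (of_nat (2 * k1) * (?gds [1] [k1 + 1, k2] - ?gds [k2] [k1 + 1, 1])
         + of_nat (2 * k2) * ?gds [1] [k1, k2 + 1]) \<in> G_sh_le (k1 + k2 + 1)"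
    (is "?T \<in> G_sh_le ?W")
  proof -
    obtain E1 where E1: "E1 \<in> G_sh_le ?W" "2 * ?gds [1] [k1 + 1, k2] = bracket [polylog (k1
        + 1), wpolylog k2] + E1"
      using ds_1_2[of "k1 + 1" k2 ?W] assms by (auto elim: obtain_double)
    obtain E2 where E2: "E2 \<in> G_sh_le ?W"
        "2 * ?gds [k2] [k1 + 1, 1] = bracket [polylog (k1 + 1), wpolylog k2] -
            bracket [wpolylog (k1 + 1), polylog k2] + E2"
      using ds_tail_1_2[of "k1 + 1" k2 ?W] assms by (auto elim: obtain_double)
    obtain E3 where E3: "E3 \<in> G_sh_le ?W" "2 * ?gds [1] [k1, k2 + 1] =
        bracket [polylog k1, wpolylog (k2 + 1)] + E3"
      using ds_1_2[of k1 "k2 + 1" ?W] assms by (auto elim: obtain_double)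
    have g: "q_deriv (g_sh [k1, k2]) = of_nat k1 * bracket [wpolylog (k1 + 1), polylog k2]
        + of_nat k2 * bracket [polylog k1, wpolylog (k2 + 1)]"
      using g_sh_eq_bracket[of "[k1, k2]"] q_deriv_bracket_2[of k1 k2] assms by simp
    \<comment> \<open>The two brackets with \<open>wpolylog k2\<close> cancel in the difference
      multiplied by \<open>k1\<close>, leaving the first term of the Leibniz rule; the defect
      multiplied by \<open>k2\<close> gives the second.\<close>
    have "?T = of_nat k1 * E2 - of_nat k1 * E1 - of_nat k2 * E3"
      unfolding g double right_diff_distrib E1(2) E2(2) E3(2) by (simp add: algebra_simps)
    also have "\<dots> \<in> G_sh_le ?W"
      by (intro G_sh_le_lin E1 E2 E3)
    finally show ?thesis .
  qed
  have part2: "q_deriv (g_sh [k1, k2, k3])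
      - (of_nat (2 * k1) * (?gds [1] [k1 + 1, k2, k3] + ?gds [k3] [k2, k1 + 1, 1])
         + of_nat (2 * k1) * (?gds [k3] [k1 + 1 + k2, 1] - ?gds [k1 + 1, 1] [k2, k3])
         + of_nat (2 * k2) * (?gds [1] [k1, k2 + 1, k3] - ?gds [k3] [k1, k2 + 1, 1])
         + of_nat (2 * k3) * ?gds [1] [k1, k2, k3 + 1]) \<in> G_sh_le (k1 + k2 + k3 + 1)"
    (is "?T \<in> G_sh_le ?W")
  proof -
    let ?a = "k1 + 1"
    obtain E1 where E1: "E1 \<in> G_sh_le ?W" "2 * ?gds [1] [?a, k2, k3] =
        bracket [polylog ?a, polylog k2, wpolylog k3] + E1"
      using ds_1_3[of ?a k2 k3 ?W] assms by (auto elim: obtain_double)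
    obtain E2 where E2: "E2 \<in> G_sh_le ?W" "2 * ?gds [k3] [k2, ?a, 1] =
        bracket [polylog k2, polylog ?a, wpolylog k3] - bracket [polylog k2, wpolylog ?a, polylog
            k3] + E2"
      using ds_tail_1_3[of k2 ?a k3 ?W] assms by (auto elim: obtain_double)
    obtain E3 where E3: "E3 \<in> G_sh_le ?W" "2 * ?gds [k3] [?a + k2, 1] =
        bracket [polylog (?a + k2), wpolylog k3] - bracket [wpolylog (?a + k2), polylog k3] + E3"
      using ds_tail_1_2[of "?a + k2" k3 ?W] assms by (auto elim: obtain_double)
    obtain E4 where E4: "E4 \<in> G_sh_le ?W" "2 * ?gds [?a, 1] [k2, k3] =
        bracket [polylog ?a, polylog k2, wpolylog k3] - bracket [wpolylog ?a, polylog k2, polylog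
            k3]
        + (bracket [polylog k2, polylog ?a, wpolylog k3] - bracket [polylog k2, wpolylog ?a,
            polylog k3])
        + (bracket [polylog (?a + k2), wpolylog k3] - bracket [wpolylog (?a + k2), polylog k3])
            + E4"
      using ds_2_2[of ?a k2 k3 ?W] assms by (auto elim: obtain_double)
    obtain E5 where E5: "E5 \<in> G_sh_le ?W" "2 * ?gds [1] [k1, k2 + 1, k3] =
        bracket [polylog k1, polylog (k2 + 1), wpolylog k3] + E5"
      using ds_1_3[of k1 "k2 + 1" k3 ?W] assms by (auto elim: obtain_double)
    obtain E6 where E6: "E6 \<in> G_sh_le ?W" "2 * ?gds [k3] [k1, k2 + 1, 1] =
        bracket [polylog k1, polylog (k2 + 1), wpolylog k3] - bracket [polylog k1, wpolylog (k2
            + 1), polylog k3] + E6"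
      using ds_tail_1_3[of k1 "k2 + 1" k3 ?W] assms by (auto elim: obtain_double)
    obtain E7 where E7: "E7 \<in> G_sh_le ?W" "2 * ?gds [1] [k1, k2, k3 + 1] =
        bracket [polylog k1, polylog k2, wpolylog (k3 + 1)] + E7"
      using ds_1_3[of k1 k2 "k3 + 1" ?W] assms by (auto elim: obtain_double)
    have g: "q_deriv (g_sh [k1, k2, k3]) = of_nat k1 * bracket [wpolylog (k1
        + 1), polylog k2, polylog k3]
        + of_nat k2 * bracket [polylog k1, wpolylog (k2 + 1), polylog k3] + of_nat k3 *
            bracket [polylog k1, polylog k2, wpolylog (k3 + 1)]"
      using g_sh_eq_bracket[of "[k1, k2, k3]"] q_deriv_bracket_3[of k1 k2 k3] assms by simp
    \<comment> \<open>In the part with \<open>k1\<close>, the defect of \<open>[?a, 1]\<close> and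
      \<open>[k2, k3]\<close> cancels everything in the other three defects and leaves the bracket
      with \<open>wpolylog ?a\<close> in front. The parts with \<open>k2\<close> and
      \<open>k3\<close> leave the other two terms of the Leibniz rule, so only errors
      remain.\<close>
    have "?T = of_nat k1 * E4 - of_nat k1 * E1 - of_nat k1 * E2 - of_nat k1 * E3
        + of_nat k2 * E6 - of_nat k2 * E5 - of_nat k3 * E7"
      unfolding g double right_diff_distrib distrib_left E1(2) E2(2) E3(2) E4(2) E5(2) E6(2) E7(2)
      by (simp add: algebra_simps)
    also have "\<dots> \<in> G_sh_le ?W"
      by (intro G_sh_le_lin E1 E2 E3 E4 E5 E6 E7)
    finally show ?thesis .
  qed
  from part1 part2 show ?thesis
    unfolding e_word_simps append.simps g_sh_map_add g_sh_map_diff by blast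
qed

end
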